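(* Let $q=2$. Let $A=\begin{pmatrix}a_{11} & a_{12} \\ a_{21} & 0\end{pmatrix}$ with entries in $\mathbb{C}_\infty$, $\operatorname{ord}a_{11}=-1$, $a_{12}\neq0$, $a_{21}\neq0$, and put $u=\operatorname{ord}a_{12}$, $v=\operatorname{ord}a_{21}$. If $(u,v)\in D_{12}$ and $v\ge-\frac43$, then $h^1(M(A))=4$.
   Context: Let $q=2$ and $\theta$ a variable. $\mathbb{C}_\infty$ is the completion of an algebraic closure of the completion of $\mathbb{F}_q(\theta)$ at the valuation at infinity $\operatorname{ord}$, normalized by $\operatorname{ord}\theta=-1$ (and $\operatorname{ord}0=+\infty$). $\mathbb{C}_\infty[T,\tau]$ is the ring of non-commutative polynomials with relations $Ta=aT$, $T\tau=\tau T$, $\tau a=a^q\tau$ for $a\in\mathbb{C}_\infty$; $\mathbb{C}_\infty\{\tau\}$ is the subring generated over $\mathbb{C}_\infty$ by $\tau$. For a $2\times2$ matrix $A$ over $\mathbb{C}_\infty$, $M(A)$ is the left $\mathbb{C}_\infty[T,\tau]$-module (Anderson t-motive of dimension 2 and rank 4) which is free over $\mathbb{C}_\infty\{\tau\}$ with basis $e_1,e_2$, where multiplication by $T$ is given, for the column $e_*=(e_1,e_2)^t$, by $Te_*=\theta e_*+A\tau e_*+\tau^2e_*$. It is free of rank 4 over $\mathbb{C}_\infty[T]$. $\mathbb{C}_\infty\{T\}$ is the ring of power series $\sum_{i\ge0}a_iT^i$ with $a_i\in\mathbb{C}_\infty$, $a_i\to0$, on which $\tau$ acts by $\tau(\sum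 a_iT^i)=\sum a_i^qT^i$. On $M\otimes_{\mathbb{C}_\infty[T]}\mathbb{C}_\infty\{T\}$, $\tau$ acts by $\tau(m\otimes f)=\tau(m)\otimes\tau(f)$. $H^1(M)$ is the $\mathbb{F}_q[T]$-module of $\tau$-invariant elements of $M\otimes_{\mathbb{C}_\infty[T]}\mathbb{C}_\infty\{T\}$; it is free, and $h^1(M)$ is its rank over $\mathbb{F}_q[T]$. The domain $D_{12}$ is the set of $(u,v)$ with $\operatorname{ord}\frac{\theta^q}{a_{21}}<\operatorname{ord}\frac{\theta^{q^2}}{a_{21}^{q^2}}$ and $\operatorname{ord}\frac{\theta^q}{a_{21}}<\operatorname{ord}a_{12}^q$; for $q=2$ this is $-v-2<-4v-4$ and $-v-2<2u$, i.e. $v<-\frac23$ and $v>-2u-2$. *)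

theory Defs
  imports
    "HOL-Analysis.Analysis"
    "HOL-Computational_Algebra.Computational_Algebra"
    "HOL-Algebra.Free_Abelian_Groups"
begin

text \<open>Throughout q = 2. In a field of characteristic 2 the subfield with two elements is
  \<open>{0, 1}\<close>, and Frobenius is squaring.\<close>

section \<open>The field of constants\<close>

locale valued_field =
  fixes ord :: "'a::field \<Rightarrow> ereal"
  assumes ord_eq_infty_iff: "ord x = \<infinity> \<longleftrightarrow> x = 0"
    and ord_neq_minus_infty: "ord x \<noteq> -\<infinity>"
    and ord_mult: "ord (x * y) = ord x + ord y"
    and ord_add: "ord (x + y) \<ge> min (ord x) (ord y)"

definition ord_lim :: "('a::field \<Rightarrow> ereal) \<Rightarrow> (nat \<Rightarrow> 'a) \<Rightarrow> 'a \<Rightarrow> bool" where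
  "ord_lim ord X x \<longleftrightarrow> (\<lambda>n. ord (X n - x)) \<longlonglongrightarrow> \<infinity>"

definition ord_Cauchy :: "('a::field \<Rightarrow> ereal) \<Rightarrow> (nat \<Rightarrow> 'a) \<Rightarrow> bool" where
  "ord_Cauchy ord X \<longleftrightarrow> (\<forall>r::real. \<exists>N. \<forall>m\<ge>N. \<forall>n\<ge>N. ord (X m - X n) > ereal r)"

definition ord_closure :: "('a::field \<Rightarrow> ereal) \<Rightarrow> 'a set \<Rightarrow> 'a set" where
  "ord_closure ord S = {x. \<exists>X. (\<forall>n. X n \<in> S) \<and> ord_lim ord X x}"

definition polys_over :: "'a::comm_semiring_0 set \<Rightarrow> 'a poly set" where
  "polys_over S = {p. \<forall>i. coeff p i \<in> S}"

definition rational_functions :: "'a::field \<Rightarrow> 'a set" where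
  "rational_functions \<theta> =
     {poly p \<theta> / poly r \<theta> |p r. p \<in> polys_over {0, 1} \<and> r \<in> polys_over {0, 1} \<and> poly r \<theta> \<noteq> 0}"

definition algebraic_elements :: "'a::field set \<Rightarrow> 'a set" where
  "algebraic_elements k = {x. \<exists>p \<in> polys_over k. p \<noteq> 0 \<and> poly p x = 0}"

text \<open>
  The type \<open>'a\<close> with \<open>ord\<close> and \<open>\<theta>\<close> is (up to isomorphism) the field
  \<open>C\<^sub>\<infinity>\<close>. Since \<open>'a\<close> is complete, the closure of the field of rational functions in
  \<open>'a\<close> is its completion; \<open>ord \<theta> = -1\<close> makes \<open>\<theta>\<close> transcendental and forces \<open>ord\<close> to be the
  valuation at infinity on the rational functions. An algebraic closure of the completion,
  embedded in \<open>'a\<close>, necessarily consists of all elements algebraic over the completion;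
  \<open>'a\<close> is required to be its completion, i.e. complete and containing it as a dense subset.
\<close>

locale C_infinity = valued_field ord for ord :: "'a::field \<Rightarrow> ereal" +
  fixes \<theta> :: 'a
  assumes char_2: "CHAR('a) = 2"
    and ord_theta: "ord \<theta> = -1"
    and complete: "ord_Cauchy ord X \<Longrightarrow> \<exists>x. ord_lim ord X x"
    and closure_alg_closed:
      "\<lbrakk>p \<in> polys_over (algebraic_elements (ord_closure ord (rational_functions \<theta>)));
        degree p > 0\<rbrakk>
       \<Longrightarrow> \<exists>x \<in> algebraic_elements (ord_closure ord (rational_functions \<theta>)). poly p x = 0"
    and closure_dense:
      "ord_closure ord (algebraic_elements (ord_closure ord (rational_functions \<theta>))) = UNIV"


section \<open>Tensor products of modules over a commutative ring\<close>

text \<open>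
  \<open>V\<close> and \<open>W\<close> are modules over the commutative ring \<open>'r\<close> with scalar multiplications \<open>sV\<close>,
  \<open>sW\<close>. Their tensor product is the free abelian group on \<open>V \<times> W\<close> (an HOL-Algebra group
  written multiplicatively, whose operation is addition of finitely supported functions)
  modulo the bilinearity relations.
\<close>

definition tensor_relators ::
  "('r \<Rightarrow> 'm \<Rightarrow> 'm::ab_group_add) \<Rightarrow> ('r \<Rightarrow> 'n \<Rightarrow> 'n::ab_group_add) \<Rightarrow> 'm set \<Rightarrow> 'n set
     \<Rightarrow> ('m \<times> 'n \<Rightarrow>\<^sub>0 int) set" where
  "tensor_relators sV sW V W =
     {frag_of (m + m', n) - frag_of (m, n) - frag_of (m', n) |m m' n. m \<in> V \<and> m' \<in> V \<and> n \<in> W} \<union>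
     {frag_of (m, n + n') - frag_of (m, n) - frag_of (m, n') |m n n'. m \<in> V \<and> n \<in> W \<and> n' \<in> W} \<union>
     {frag_of (sV r m, n) - frag_of (m, sW r n) |r m n. m \<in> V \<and> n \<in> W}"

definition tensor_null ::
  "('r \<Rightarrow> 'm \<Rightarrow> 'm::ab_group_add) \<Rightarrow> ('r \<Rightarrow> 'n \<Rightarrow> 'n::ab_group_add) \<Rightarrow> 'm set \<Rightarrow> 'n set
     \<Rightarrow> ('m \<times> 'n \<Rightarrow>\<^sub>0 int) set" where
  "tensor_null sV sW V W =
     generate (free_Abelian_group (V \<times> W)) (tensor_relators sV sW V W)"

definition tensor_product ::
  "('r \<Rightarrow> 'm \<Rightarrow> 'm::ab_group_add) \<Rightarrow> ('r \<Rightarrow> 'n \<Rightarrow> 'n::ab_group_add) \<Rightarrow> 'm set \<Rightarrow> 'n set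
     \<Rightarrow> ('m \<times> 'n \<Rightarrow>\<^sub>0 int) set monoid" where
  "tensor_product sV sW V W = free_Abelian_group (V \<times> W) Mod tensor_null sV sW V W"

text \<open>
  The endomorphism of the tensor product sending the class of \<open>m \<otimes> n\<close> to the class of
  \<open>\<phi> m \<otimes> \<psi> n\<close>: all representatives of a coset \<open>C\<close> have the same image class. This is
  meaningful for additive \<open>\<phi>\<close>, \<open>\<psi>\<close> that are semilinear for the same ring endomorphism.
\<close>

definition tensor_map ::
  "('r \<Rightarrow> 'm \<Rightarrow> 'm::ab_group_add) \<Rightarrow> ('r \<Rightarrow> 'n \<Rightarrow> 'n::ab_group_add) \<Rightarrow> 'm set \<Rightarrow> 'n set
     \<Rightarrow> ('m \<Rightarrow> 'm) \<Rightarrow> ('n \<Rightarrow> 'n) \<Rightarrow> ('m \<times> 'n \<Rightarrow>\<^sub>0 int) set \<Rightarrow> ('m \<times> 'n \<Rightarrow>\<^sub>0 int) set" where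
  "tensor_map sV sW V W \<phi> \<psi> C =
     the_elem ((\<lambda>x. tensor_null sV sW V W #>\<^bsub>free_Abelian_group (V \<times> W)\<^esub>
                      frag_extend (\<lambda>(m, n). frag_of (\<phi> m, \<psi> n)) x) ` C)"


section \<open>The t-motive M(A)\<close>

text \<open>
  An element \<open>\<Sum>c\<^sub>i \<tau>\<^sup>i\<close> of the twisted polynomial ring in \<open>\<tau>\<close> is encoded by the
  element of \<^typ>\<open>'a poly\<close> with coefficients \<open>c\<^sub>i\<close>. The sum is the one of \<^typ>\<open>'a poly\<close>, but
  the product is the one below, determined by \<open>\<tau> a = a\<^sup>2 \<tau>\<close>.
\<close>

definition twisted_mult :: "'a::field poly \<Rightarrow> 'a poly \<Rightarrow> 'a poly" where
  "twisted_mult f g =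
     (\<Sum>i\<le>degree f. \<Sum>j\<le>degree g. monom (coeff f i * coeff g j ^ (2 ^ i)) (i + j))"

text \<open>
  The free left module over twisted polynomials with basis \<open>e\<^sub>1, e\<^sub>2\<close> is \<^typ>\<open>'a poly ^ 2\<close>,
  where \<open>m\<close> stands for \<open>m\<^sub>1 e\<^sub>1 + m\<^sub>2 e\<^sub>2\<close>. The action of \<open>T\<close> is left linear over
  twisted polynomials, with \<open>T e\<^sub>i = \<Sum>\<^sub>j (T_matrix \<theta> A)\<^sub>i\<^sub>j e\<^sub>j\<close>, where
  \<open>T_matrix \<theta> A = \<theta> + A \<tau> + \<tau>\<^sup>2\<close>. The actions of constants, \<open>\<tau>\<close> and \<open>T\<close> make up
  the module structure over the ring of non-commutative polynomials in \<open>T, \<tau>\<close>.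
\<close>

definition T_matrix :: "'a::field \<Rightarrow> 'a^2^2 \<Rightarrow> 'a poly^2^2" where
  "T_matrix \<theta> A = (\<chi> i j. [:mat \<theta> $ i $ j, A $ i $ j, mat 1 $ i $ j:])"

definition twisted_scale :: "'a::field poly \<Rightarrow> 'a poly^2 \<Rightarrow> 'a poly^2" where
  "twisted_scale f m = (\<chi> j. twisted_mult f (m $ j))"

definition motive_tau :: "'a::field poly^2 \<Rightarrow> 'a poly^2" where
  "motive_tau = twisted_scale [:0, 1:]"

definition motive_T :: "'a::field \<Rightarrow> 'a^2^2 \<Rightarrow> 'a poly^2 \<Rightarrow> 'a poly^2" where
  "motive_T \<theta> A m = (\<chi> j. \<Sum>i\<in>UNIV. twisted_mult (m $ i) (T_matrix \<theta> A $ i $ j))"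

text \<open>Here \<open>p\<close> is an ordinary polynomial in \<open>T\<close>.\<close>

definition motive_scale :: "'a::field \<Rightarrow> 'a^2^2 \<Rightarrow> 'a poly \<Rightarrow> 'a poly^2 \<Rightarrow> 'a poly^2" where
  "motive_scale \<theta> A p m =
     (\<Sum>i\<le>degree p. twisted_scale [:coeff p i:] ((motive_T \<theta> A ^^ i) m))"


section \<open>The invariants\<close>

definition tate_algebra :: "('a::field \<Rightarrow> ereal) \<Rightarrow> 'a fps set" where
  "tate_algebra ord = {f. (\<lambda>i. ord (fps_nth f i)) \<longlonglongrightarrow> \<infinity>}"

definition tate_tau :: "'a::field fps \<Rightarrow> 'a fps" where
  "tate_tau f = Abs_fps (\<lambda>i. fps_nth f i ^ 2)"

definition tate_scale :: "'a::field poly \<Rightarrow> 'a fps \<Rightarrow> 'a fps" where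
  "tate_scale p f = fps_of_poly p * f"

definition tate_motive ::
  "('a::field \<Rightarrow> ereal) \<Rightarrow> 'a \<Rightarrow> 'a^2^2 \<Rightarrow> (('a poly^2) \<times> 'a fps \<Rightarrow>\<^sub>0 int) set monoid" where
  "tate_motive ord \<theta> A =
     tensor_product (motive_scale \<theta> A) tate_scale UNIV (tate_algebra ord)"

definition tate_motive_tau ::
  "('a::field \<Rightarrow> ereal) \<Rightarrow> 'a \<Rightarrow> 'a^2^2
     \<Rightarrow> (('a poly^2) \<times> 'a fps \<Rightarrow>\<^sub>0 int) set \<Rightarrow> (('a poly^2) \<times> 'a fps \<Rightarrow>\<^sub>0 int) set" where
  "tate_motive_tau ord \<theta> A =
     tensor_map (motive_scale \<theta> A) tate_scale UNIV (tate_algebra ord) motive_tau tate_tau"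

definition tate_motive_scale ::
  "('a::field \<Rightarrow> ereal) \<Rightarrow> 'a \<Rightarrow> 'a^2^2 \<Rightarrow> 'a poly
     \<Rightarrow> (('a poly^2) \<times> 'a fps \<Rightarrow>\<^sub>0 int) set \<Rightarrow> (('a poly^2) \<times> 'a fps \<Rightarrow>\<^sub>0 int) set" where
  "tate_motive_scale ord \<theta> A p =
     tensor_map (motive_scale \<theta> A) tate_scale UNIV (tate_algebra ord) (motive_scale \<theta> A p) id"

definition H1 ::
  "('a::field \<Rightarrow> ereal) \<Rightarrow> 'a \<Rightarrow> 'a^2^2 \<Rightarrow> (('a poly^2) \<times> 'a fps \<Rightarrow>\<^sub>0 int) set set" where
  "H1 ord \<theta> A = {C \<in> carrier (tate_motive ord \<theta> A). tate_motive_tau ord \<theta> A C = C}"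

text \<open>Finite bases of \<open>H1\<close> over the polynomials in \<open>T\<close> with coefficients in \<open>{0, 1}\<close>; the
  linear combinations are products because \<open>tate_motive\<close> is written multiplicatively.\<close>

definition is_H1_basis ::
  "('a::field \<Rightarrow> ereal) \<Rightarrow> 'a \<Rightarrow> 'a^2^2 \<Rightarrow> (('a poly^2) \<times> 'a fps \<Rightarrow>\<^sub>0 int) set set \<Rightarrow> bool" where
  "is_H1_basis ord \<theta> A B \<longleftrightarrow>
     finite B \<and> B \<subseteq> H1 ord \<theta> A \<and>
     (\<forall>C \<in> H1 ord \<theta> A. \<exists>!c. c \<in> B \<rightarrow>\<^sub>E polys_over {0, 1} \<and>
        C = (\<Otimes>\<^bsub>tate_motive ord \<theta> A\<^esub> b\<in>B. tate_motive_scale ord \<theta> A (c b) b))"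

definition h1 :: "('a::field \<Rightarrow> ereal) \<Rightarrow> 'a \<Rightarrow> 'a^2^2 \<Rightarrow> nat" where
  "h1 ord \<theta> A = (THE n. \<exists>B. is_H1_basis ord \<theta> A B \<and> card B = n)"


section \<open>The domain of valuations\<close>

definition D12 :: "('a::field \<Rightarrow> ereal) \<Rightarrow> 'a \<Rightarrow> (ereal \<times> ereal) set" where
  "D12 ord \<theta> =
     {(ord a12, ord a21) |a12 a21. a12 \<noteq> 0 \<and> a21 \<noteq> 0 \<and>
        ord (\<theta> ^ 2 / a21) < ord (\<theta> ^ (2 ^ 2) / a21 ^ (2 ^ 2)) \<and>
        ord (\<theta> ^ 2 / a21) < ord (a12 ^ 2)}"

end

theory Submission
  imports Defs
begin

no_notation fps_nth (infixl "$" 75)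

text \<open>
  In the basis \<open>e\<^sub>1, e\<^sub>2, \<tau> e\<^sub>1, \<tau> e\<^sub>2\<close> over the Tate algebra, an invariant is determined by its
  coordinates \<open>y = \<Sum>y\<^sub>n T\<^sup>n\<close> at \<open>\<tau> e\<^sub>1, \<tau> e\<^sub>2\<close>, and invariance means \<open>y\<^sub>0 = G y\<^sub>0\<close> and
  \<open>y\<^sub>n = y\<^sub>n\<^sub>-\<^sub>1'' + G y\<^sub>n\<close>, where \<open>G y = y' A + \<theta>\<^sup>2 y''\<close> is additive, \<open>'\<close> denotes
  squaring of the entries, and \<open>y\<^sub>n \<rightarrow> 0\<close>. The solutions of \<open>y = G y\<close> form a group of order 16. For a
  suitable norm \<open>G\<close> contracts the open unit ball, and the hypotheses on \<open>u, v\<close> imply that \<open>y''\<close>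
  lies in this ball whenever \<open>y = G y\<close>. Hence every solution \<open>y\<^sub>0\<close> extends to a unique invariant with
  \<open>y\<^sub>n\<close> in the ball for all \<open>n \<ge> 1\<close>. Since only finitely many coefficients of an invariant lie outside
  the ball, and all of them lie inside only for \<open>0\<close>, the invariants are the polynomials in \<open>T\<close> over
  these lifts.
\<close>

section \<open>The absolute value\<close>

context valued_field
begin

text \<open>The order 16 requires exact roots, but only a dense subfield of the constants is given
  as algebraically closed. Additivity bridges the gap: an approximate root of an additive polynomial
  becomes an exact one after adding a small correction, and small equations are solved by
  contraction. The obstacle for the invariants is the condition
  \<open>y\<^sub>n \<rightarrow> 0\<close>. Given \<open>y\<^sub>n\<^sub>-\<^sub>1\<close>, the next
  coefficient is determined only up to the 16 solutions of \<open>y = G y\<close>, and from some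
  index on it has to be the one inside the ball. The first step is the critical one: a nonzero
  solution of \<open>y = G y\<close> never lies in the ball, so the bound on \<open>y''\<close>
  cannot come from the contraction. It comes from comparing the terms of the two equations, and
  there \<open>v \<ge> -4/3\<close> enters. In absolute values, where \<open>|\<theta>| = 2\<close>,
  the hypotheses read \<open>4 < |a21|^3 \<le> 16\<close> and \<open>|a12|^2 |a21| < 4\<close>. The
  rank is read off modulo \<open>T\<close>, the quotient being the group of solutions
  \<open>y\<^sub>0\<close>, of order \<open>2^4\<close>.\<close>

definition absval :: "'a \<Rightarrow> real" where
  "absval x = (if x = 0 then 0 else 2 powr - real_of_ereal (ord x))"

lemma ord_eq_ereal: "x \<noteq> 0 \<Longrightarrow> ord x = ereal (real_of_ereal (ord x))"
  using ord_eq_infty_iff[of x] ord_neq_minus_infty[of x] by (cases "ord x") auto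

lemma ord_0: "ord 0 = \<infinity>"
  by (simp add: ord_eq_infty_iff)

lemma absval_nonneg: "0 \<le> absval x"
  by (simp add: absval_def)

lemma absval_0 [simp]: "absval 0 = 0"
  by (simp add: absval_def)

lemma absval_eq_0_iff [simp]: "absval x = 0 \<longleftrightarrow> x = 0"
  by (simp add: absval_def)

lemma absval_pos_iff [simp]: "absval x > 0 \<longleftrightarrow> x \<noteq> 0"
  by (simp add: absval_def)

lemma absval_eq_powr: "ord x = ereal r \<Longrightarrow> absval x = 2 powr - r"
  by (auto simp: absval_def ord_0)

lemma absval_mult: "absval (x * y) = absval x * absval y"
proof (cases "x = 0 \<or> y = 0")
  case False
  then obtain r s where r: "ord x = ereal r" and s: "ord y = ereal s"
    using ord_eq_ereal by metis
  then have "ord (x * y) = ereal (r + s)"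
    by (simp add: ord_mult)
  with r s show ?thesis
    by (simp add: absval_eq_powr flip: powr_add)
qed auto

lemma absval_1 [simp]: "absval 1 = 1"
  using absval_mult[of 1 1] absval_pos_iff[of 1] by simp

lemma absval_power: "absval (x ^ n) = absval x ^ n"
  by (induction n) (simp_all add: absval_mult)

lemma absval_divide: "absval (x / y) = absval x / absval y"
proof (cases "y = 0")
  case False
  then have "absval x = absval (x / y) * absval y"
    by (simp flip: absval_mult)
  with False show ?thesis
    by (simp add: field_simps)
qed auto

lemma absval_minus [simp]: "absval (- x) = absval x"
proof -
  have "absval (-1) ^ 2 = 1"
    by (simp flip: absval_power)
  then have "absval (-1) = 1"
    using absval_nonneg[of "-1"] by (simp add: power2_eq_1_iff)
  then show ?thesis
    using absval_mult[of "-1" x] by simp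
qed

lemma absval_less_powr_iff: "absval x < 2 powr - r \<longleftrightarrow> ereal r < ord x"
  by (cases "x = 0") (auto simp: ord_0 absval_def dest!: ord_eq_ereal, (metis ereal_less(2) less_ereal.simps(1) ord_eq_ereal)+)

lemma absval_le_powr_iff: "absval x \<le> 2 powr - r \<longleftrightarrow> ereal r \<le> ord x"
  by (cases "x = 0") (auto simp: ord_0 absval_def dest!: ord_eq_ereal, (metis ereal_less_eq(3) ord_eq_ereal)+)

lemma absval_le_iff: "absval x \<le> absval y \<longleftrightarrow> ord y \<le> ord x"
proof (cases "y = 0")
  case True
  then show ?thesis
    using absval_nonneg[of x] by (auto simp: ord_0 ord_eq_infty_iff order.antisym)
next
  case False
  then obtain s where s: "ord y = ereal s"
    using ord_eq_ereal by metis
  then show ?thesis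
    by (simp add: absval_eq_powr absval_le_powr_iff)
qed

lemma absval_add: "absval (x + y) \<le> max (absval x) (absval y)"
  using ord_add[of x y] by (auto simp: le_max_iff_disj absval_le_iff min_le_iff_disj)

lemma absval_diff: "absval (x - y) \<le> max (absval x) (absval y)"
  using absval_add[of x "- y"] by simp

lemma absval_add_le: "absval x \<le> r \<Longrightarrow> absval y \<le> r \<Longrightarrow> absval (x + y) \<le> r"
  using absval_add[of x y] by linarith

lemma absval_sum_le:
  assumes "\<And>i. i \<in> I \<Longrightarrow> absval (f i) \<le> r" and "0 \<le> r"
  shows "absval (sum f I) \<le> r"
  using assms by (induction I rule: infinite_finite_induct) (auto intro: absval_add_le)

lemma absval_add_eq: "absval y < absval x \<Longrightarrow> absval (x + y) = absval x"
  using absval_add[of x y] absval_diff[of "x + y" y] by auto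

lemma absval_tendsto_0_iff:
  "((\<lambda>n. absval (X n)) \<longlongrightarrow> 0) F \<longleftrightarrow> ((\<lambda>n. ord (X n)) \<longlongrightarrow> \<infinity>) F"
proof
  assume "((\<lambda>n. absval (X n)) \<longlongrightarrow> 0) F"
  then have "eventually (\<lambda>n. absval (X n) < 2 powr - r) F" for r
    by (rule order_tendstoD) simp
  then show "((\<lambda>n. ord (X n)) \<longlongrightarrow> \<infinity>) F"
    by (simp add: tendsto_PInfty absval_less_powr_iff)
next
  assume *: "((\<lambda>n. ord (X n)) \<longlongrightarrow> \<infinity>) F"
  show "((\<lambda>n. absval (X n)) \<longlongrightarrow> 0) F"
  proof (rule order_tendstoI)
    fix a :: real assume a: "0 < a"
    have "eventually (\<lambda>n. ord (X n) > ereal (- log 2 a)) F"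
      using * by (simp add: tendsto_PInfty)
    then show "eventually (\<lambda>n. absval (X n) < a) F"
      using a by (simp flip: absval_less_powr_iff)
  qed (use absval_nonneg in \<open>auto intro: always_eventually less_le_trans\<close>)
qed

end

section \<open>Contractions in a complete ultrametric group\<close>

text \<open>Banach iteration started at \<open>0\<close>. Since \<open>g\<close> is additive and
  balls are subgroups, the estimate at single points of the ball also covers differences of
  iterates. The radius \<open>\<rho>\<close> may exceed \<open>N c\<close>, but the iterates, and
  with them the solution, stay in the ball of radius \<open>N c\<close>.\<close>

lemma additive_contraction:
  fixes N :: "'b::ab_group_add \<Rightarrow> real" and g :: "'b \<Rightarrow> 'b"
  assumes N0: "\<And>x. N x = 0 \<longleftrightarrow> x = 0" and Npos: "\<And>x. 0 \<le> N x"
    and ultra: "\<And>x y. N (x - y) \<le> max (N x) (N y)"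
    and complete: "\<And>X. (\<lambda>n. N (X (Suc n) - X n)) \<longlonglongrightarrow> 0 \<Longrightarrow> \<exists>x. (\<lambda>n. N (X n - x)) \<longlonglongrightarrow> 0"
    and add: "\<And>x y. g (x + y) = g x + g y"
    and contr: "\<And>x. N x \<le> \<rho> \<Longrightarrow> N (g x) \<le> l * N x"
    and l: "0 \<le> l" "l < 1" and c: "N c \<le> \<rho>"
  shows "\<exists>x. x = c + g x \<and> N x \<le> N c"
proof -
  have Nm: "N (- x) \<le> N x" for x
    using ultra[of 0 x] N0[of 0] Npos[of x] by simp
  have plus: "N (x + y) \<le> r" if "N x \<le> r" "N y \<le> r" for x y r
    using ultra[of x "- y"] Nm[of y] that by simp
  have g0: "g 0 = 0"
    using add[of 0 0] by simp
  have gminus: "g (x - y) = g x - g y" for x y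
    using add[of "x - y" y] by (simp add: algebra_simps)
  define S where "S n = ((\<lambda>x. c + g x) ^^ n) 0" for n
  have S0: "S 0 = 0" and SSuc: "S (Suc n) = c + g (S n)" for n
    by (simp_all add: S_def)
  have SN: "N (S n) \<le> N c" for n
  proof (induction n)
    case (Suc n)
    have "N (g (S n)) \<le> l * N (S n)"
      using Suc c by (intro contr) simp
    also have "\<dots> \<le> 1 * N (S n)"
      using l Npos by (intro mult_right_mono) auto
    finally show ?case
      using Suc by (auto simp: SSuc intro: plus)
  qed (use N0[of 0] Npos in \<open>simp add: S0\<close>)
  have diff: "N (S (Suc n) - S n) \<le> l ^ n * N c" for n
  proof (induction n)
    case (Suc n)
    have "N (S (Suc n) - S n) \<le> \<rho>"
      using ultra[of "S (Suc n)" "S n"] SN[of n] SN[of "Suc n"] c by linarith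
    then have "N (g (S (Suc n) - S n)) \<le> l * N (S (Suc n) - S n)"
      by (rule contr)
    also have "\<dots> \<le> l * (l ^ n * N c)"
      using Suc l by (intro mult_left_mono) auto
    finally show ?case
      by (simp add: SSuc gminus algebra_simps)
  qed (simp add: S0 SSuc g0)
  have "(\<lambda>n. l ^ n * N c) \<longlonglongrightarrow> 0"
    using LIMSEQ_power_zero[of l] l tendsto_mult_left_zero by fastforce
  then have "(\<lambda>n. N (S (Suc n) - S n)) \<longlonglongrightarrow> 0"
    by (rule Lim_null_comparison[rotated]) (use diff Npos in \<open>auto intro: always_eventually\<close>)
  then obtain x where x: "(\<lambda>n. N (S n - x)) \<longlonglongrightarrow> 0"
    using complete by blast
  \<comment> \<open>Passage to the limit: a norm independent of \<open>n\<close> that is bounded by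
    the maximum of two null sequences vanishes.\<close>
  have small: "N z = 0" if "\<And>n. N z \<le> max (f n) (h n)" "f \<longlonglongrightarrow> 0" "h \<longlonglongrightarrow> 0" for z and f h :: "nat \<Rightarrow> real"
  proof -
    have "(\<lambda>n. max (f n) (h n)) \<longlonglongrightarrow> max 0 0"
      using that by (intro tendsto_max) auto
    then have "N z \<le> max 0 0"
      by (rule LIMSEQ_le_const) (use that in auto)
    then show ?thesis
      using Npos[of z] by simp
  qed
  have Nx: "N x \<le> N c"
  proof (rule ccontr)
    assume *: "\<not> N x \<le> N c"
    \<comment> \<open>Here \<open>x\<close> is the difference of \<open>S n\<close> and
      \<open>S n - x\<close>, and \<open>S n\<close> is too small to account for its norm.\<close>
    have "N x \<le> N (S n - x)" for n
      using ultra[of "S n" "S n - x"] SN[of n] * by simp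
    then have "N x = 0"
      by (intro small[of x "\<lambda>n. N (S n - x)" "\<lambda>n. N (S n - x)"]) (use x in auto)
    with * Npos[of c] show False by simp
  qed
  have "N (x - (c + g x)) \<le> max (N (S (Suc n) - x)) (l * N (S n - x))" for n
  proof -
    have "N (S n - x) \<le> \<rho>"
      using ultra[of "S n" x] SN[of n] Nx c by linarith
    then have "N (g (S n - x)) \<le> l * N (S n - x)"
      by (rule contr)
    moreover have "N (x - (c + g x)) \<le> max (N (g (S n - x))) (N (S (Suc n) - x))"
      using ultra[of "g (S n - x)" "S (Suc n) - x"] by (simp add: SSuc gminus algebra_simps)
    ultimately show ?thesis
      by linarith
  qed
  then have "N (x - (c + g x)) = 0"
    by (rule small) (use LIMSEQ_Suc[OF x] tendsto_mult_right_zero[OF x] in auto)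
  with Nx N0 show ?thesis
    by auto
qed

section \<open>Additive polynomials\<close>

lemma power2_add_char_2:
  fixes x y :: "'a::comm_ring_1"
  assumes "CHAR('a) = 2"
  shows "(x + y) ^ 2 ^ n = x ^ 2 ^ n + y ^ 2 ^ n"
  by (rule freshmans_dream') (simp_all add: assms)

context C_infinity
begin

lemma add_self [simp]: "x + x = (0::'a)"
  using uminus_CHAR_2[OF char_2, of x] by (metis add.right_inverse)

lemma diff_eq_add: "x - y = x + (y::'a)"
  by (rule minus_CHAR_2[OF char_2])

lemma add_eq_0_iff_eq: "x + y = 0 \<longleftrightarrow> x = (y::'a)"
  by (metis diff_eq_add eq_iff_diff_eq_0)

text \<open>In an ultrametric the distance of two terms is at most the largest successive difference
  between them, so null successive differences already give a Cauchy sequence.\<close>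

lemma absval_complete:
  assumes "(\<lambda>n. absval (X (Suc n) - X n)) \<longlonglongrightarrow> 0"
  shows "\<exists>x. (\<lambda>n. absval (X n - x)) \<longlonglongrightarrow> 0"
proof -
  have "ord_Cauchy ord X"
    unfolding ord_Cauchy_def
  proof
    fix r :: real
    have "eventually (\<lambda>n. absval (X (Suc n) - X n) < 2 powr - r) sequentially"
      using assms by (rule order_tendstoD) simp
    then obtain N where N: "\<And>n. n \<ge> N \<Longrightarrow> absval (X (Suc n) - X n) < 2 powr - r"
      by (auto simp: eventually_sequentially)
    have *: "absval (X n - X N) < 2 powr - r" if "n \<ge> N" for n
      using that
    proof (induction rule: dec_induct)
      case (step n)
      with N[of n] absval_add[of "X (Suc n) - X n" "X n - X N"] show ?case
        by simp
    qed simp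
    have "absval (X m - X n) < 2 powr - r" if "m \<ge> N" "n \<ge> N" for m n
      using absval_diff[of "X m - X N" "X n - X N"] *[OF that(1)] *[OF that(2)] by simp
    then show "\<exists>N. \<forall>m\<ge>N. \<forall>n\<ge>N. ord (X m - X n) > ereal r"
      by (auto simp: absval_less_powr_iff)
  qed
  then obtain x where "ord_lim ord X x"
    using complete by blast
  then show ?thesis
    by (auto simp: ord_lim_def absval_tendsto_0_iff)
qed

section \<open>Approximate roots from a dense algebraically closed set\<close>

definition alg_closure :: "'a set" where
  "alg_closure = algebraic_elements (ord_closure ord (rational_functions \<theta>))"

lemma zero_one_in_alg_closure: "0 \<in> alg_closure" "1 \<in> alg_closure"
proof -
  let ?k = "ord_closure ord (rational_functions \<theta>)"
  have "c \<in> rational_functions \<theta>" if "c = 0 \<or> c = 1" for c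
    unfolding rational_functions_def mem_Collect_eq
    by (rule exI[of _ "[:c:]"], rule exI[of _ "[:1:]"])
       (use that in \<open>auto simp: polys_over_def coeff_pCons split: nat.splits\<close>)
  then have k: "c \<in> ?k" if "c = 0 \<or> c = 1" for c
    unfolding ord_closure_def ord_lim_def using that by (auto simp: ord_0 intro!: exI[of _ "\<lambda>_. c"])
  have "c \<in> alg_closure" if "c = 0 \<or> c = 1" for c
    unfolding alg_closure_def algebraic_elements_def
    by (rule CollectI, rule bexI[of _ "[:c, 1:]"])
       (use that k in \<open>auto simp: polys_over_def coeff_pCons split: nat.splits\<close>)
  then show "0 \<in> alg_closure" "1 \<in> alg_closure" by auto
qed

lemma alg_closure_dense:
  assumes "\<epsilon> > 0"
  shows "\<exists>y\<in>alg_closure. absval (y - x) < \<epsilon>"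
proof -
  have "x \<in> ord_closure ord alg_closure"
    by (simp add: alg_closure_def closure_dense)
  then obtain X where "\<And>n. X n \<in> alg_closure" "(\<lambda>n. absval (X n - x)) \<longlonglongrightarrow> 0"
    by (auto simp: ord_closure_def ord_lim_def absval_tendsto_0_iff)
  moreover from this(2) assms have "eventually (\<lambda>n. absval (X n - x) < \<epsilon>) sequentially"
    by (rule order_tendstoD)
  ultimately show ?thesis
    by (auto simp: eventually_sequentially)
qed

text \<open>The roots of monic polynomials over \<^term>\<open>alg_closure\<close> close to \<^term>\<open>p\<close> stay in a fixed disc.\<close>

lemma approximate_root:
  assumes p: "degree p > 0" "lead_coeff p = 1"
  shows "\<exists>R>0. \<forall>\<epsilon>>0. \<exists>x. absval x \<le> R \<and> absval (poly p x) < \<epsilon>"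
proof -
  define n where "n = degree p"
  define R where "R = Max (insert 1 ((\<lambda>i. absval (coeff p i)) ` {..n}))"
  have R: "1 \<le> R" and Rc: "\<And>i. i \<le> n \<Longrightarrow> absval (coeff p i) \<le> R"
    unfolding R_def by (rule Max_ge; simp)+
  have "\<exists>x. absval x \<le> R \<and> absval (poly p x) < \<epsilon>" if "\<epsilon> > 0" for \<epsilon>
  proof -
    \<comment> \<open>The entry \<open>1\<close> keeps the perturbed coefficients within
      \<open>R\<close>, so the root bound does not depend on \<open>\<epsilon>\<close>; the other
      entry makes the perturbation smaller than \<open>\<epsilon>\<close> at every point of norm at
      most \<open>R\<close>.\<close>
    define \<delta> where "\<delta> = min 1 (\<epsilon> / (2 * R ^ n))"
    have \<delta>: "0 < \<delta>" "\<delta> \<le> 1" "\<delta> * R ^ n < \<epsilon>"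
    proof -
      show "0 < \<delta>" "\<delta> \<le> 1" using R \<open>\<epsilon> > 0\<close> by (auto simp: \<delta>_def)
      have "\<delta> * R ^ n \<le> \<epsilon> / (2 * R ^ n) * R ^ n"
        using R by (intro mult_right_mono) (auto simp: \<delta>_def)
      also have "\<dots> < \<epsilon>" using R \<open>\<epsilon> > 0\<close> by simp
      finally show "\<delta> * R ^ n < \<epsilon>" .
    qed
    have "\<exists>c. \<forall>i. c i \<in> alg_closure \<and> absval (c i - coeff p i) < \<delta>"
      using alg_closure_dense[OF \<open>0 < \<delta>\<close>] by (intro choice) blast
    then obtain c where cK: "\<And>i. c i \<in> alg_closure" and c\<delta>: "\<And>i. absval (c i - coeff p i) < \<delta>"
      by blast
    define q where "q = monom 1 n + (\<Sum>i<n. monom (c i) i)"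
    have cq: "coeff q i = (if i < n then c i else if i = n then 1 else 0)" for i
      by (auto simp: q_def coeff_sum if_distrib[of "\<lambda>f. f _"] cong: if_cong)
    have "degree q = n"
      by (rule antisym) (auto simp: cq intro!: degree_le le_degree)
    moreover have "q \<in> polys_over alg_closure"
      using cK zero_one_in_alg_closure by (auto simp: polys_over_def cq)
    ultimately obtain x where "poly q x = 0"
      using closure_alg_closed[of q] p(1) by (auto simp: alg_closure_def n_def)
    then have x: "x ^ n + (\<Sum>i<n. c i * x ^ i) = 0"
      by (simp add: q_def poly_sum poly_monom)
    have cR: "absval (c i) \<le> R" if "i < n" for i
      using absval_add_le[of "c i - coeff p i" R "coeff p i"] c\<delta>[of i] \<delta>(2) R Rc[of i] that by simp
    have xR: "absval x \<le> R"
    proof (rule ccontr)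
      assume "\<not> absval x \<le> R"
      then have x1: "absval x > R" by simp
      \<comment> \<open>Outside the disc of radius \<open>R\<close> the leading term beats all the
        others, so \<open>x\<close> could not be a root.\<close>
      have "absval (\<Sum>i<n. c i * x ^ i) \<le> R * absval x ^ (n - 1)"
      proof (rule absval_sum_le)
        fix i assume "i \<in> {..<n}"
        then show "absval (c i * x ^ i) \<le> R * absval x ^ (n - 1)"
          using cR[of i] x1 R absval_nonneg
          by (auto simp: absval_mult absval_power intro!: mult_mono power_increasing)
      qed (use R absval_nonneg in auto)
      also have "\<dots> < absval x * absval x ^ (n - 1)"
        using x1 R by (intro mult_strict_right_mono zero_less_power) linarith+
      also have "\<dots> = absval (x ^ n)"
        using p(1) power_Suc[of "absval x" "n - 1"] by (simp add: absval_power n_def del: power_Suc)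
      finally have "absval (x ^ n + (\<Sum>i<n. c i * x ^ i)) = absval (x ^ n)"
        by (rule absval_add_eq)
      with x show False
        using x1 R by (auto simp: absval_power)
    qed
    have "poly p x = x ^ n + (\<Sum>i<n. coeff p i * x ^ i)"
      using p(2) by (simp add: poly_altdef n_def flip: lessThan_Suc_atMost)
    also have "\<dots> = (\<Sum>i<n. coeff p i * x ^ i) - (\<Sum>i<n. c i * x ^ i)"
      using x by (simp add: algebra_simps eq_neg_iff_add_eq_0)
    also have "\<dots> = - (\<Sum>i<n. (c i - coeff p i) * x ^ i)"
      by (simp add: sum_subtractf algebra_simps)
    finally have "absval (poly p x) = absval (\<Sum>i<n. (c i - coeff p i) * x ^ i)"
      by simp
    also have "\<dots> \<le> \<delta> * R ^ n"
    proof (rule absval_sum_le)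
      fix i assume i: "i \<in> {..<n}"
      have "absval x ^ i \<le> R ^ i" using xR absval_nonneg by (intro power_mono)
      also have "\<dots> \<le> R ^ n" using R i by (intro power_increasing) auto
      finally show "absval ((c i - coeff p i) * x ^ i) \<le> \<delta> * R ^ n"
        using less_imp_le[OF c\<delta>[of i]] absval_nonneg \<delta>(1)
        by (auto simp: absval_mult absval_power intro!: mult_mono)
    qed (use R \<delta> in auto)
    finally show ?thesis
      using \<delta>(3) xR by (intro exI[of _ x]) simp
  qed
  then show ?thesis
    using R by (intro exI[of _ R]) auto
qed

section \<open>Small solutions, nonzero roots and root counts of additive polynomials\<close>

definition additive_poly :: "(nat \<Rightarrow> 'a) \<Rightarrow> nat \<Rightarrow> 'a \<Rightarrow> 'a" where
  "additive_poly a n x = (\<Sum>i\<le>n. a i * x ^ 2 ^ i)"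

lemma additive_poly_add: "additive_poly a n (x + y) = additive_poly a n x + additive_poly a n y"
  by (simp add: additive_poly_def power2_add_char_2[OF char_2] algebra_simps sum.distrib)

lemma additive_poly_0 [simp]: "additive_poly a n 0 = 0"
  by (simp add: additive_poly_def power_0_left)

text \<open>An inverse function theorem at \<open>0\<close>: solving for the linear term turns the
  equation into \<open>x = c / a 0 + g x\<close>, where \<open>g\<close> has only terms of order at
  least two and contracts a small ball. The bound on \<open>x\<close> later keeps a corrected root
  away from \<open>0\<close>.\<close>

lemma additive_poly_small:
  assumes "a 0 \<noteq> 0"
  shows "\<exists>\<rho>>0. \<forall>c. absval c \<le> \<rho> \<longrightarrow>
    (\<exists>x. additive_poly a n x = c \<and> absval x \<le> absval c / absval (a 0))"
proof -
  define M where "M = Max (insert 1 ((\<lambda>i. absval (a i / a 0)) ` {..n}))"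
  have M: "1 \<le> M" and Ma: "\<And>i. i \<le> n \<Longrightarrow> absval (a i / a 0) \<le> M"
    unfolding M_def by (rule Max_ge; simp)+
  \<comment> \<open>For \<open>|x| \<le> r\<close> a power \<open>|x| ^ 2 ^ i\<close> with
    \<open>i \<ge> 1\<close> is at most \<open>r * |x|\<close>, and \<open>M * r = 1 / 2\<close>
    becomes the contraction factor.\<close>
  define r where "r = 1 / (2 * M)"
  have r: "0 < r" "r \<le> 1"
    using M by (auto simp: r_def)
  define g where "g x = - (\<Sum>i\<in>{1..n}. a i / a 0 * x ^ 2 ^ i)" for x
  have g: "absval (g x) \<le> 1 / 2 * absval x" if x: "absval x \<le> r" for x
  proof -
    have "absval (a i / a 0 * x ^ 2 ^ i) \<le> 1 / 2 * absval x" if i: "i \<in> {1..n}" for i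
    proof -
      have "(2::nat) ^ 1 \<le> 2 ^ i"
        using i by (intro power_increasing) auto
      then have "absval x ^ 2 ^ i \<le> absval x ^ 2"
        using x r absval_nonneg by (intro power_decreasing) auto
      also have "\<dots> \<le> r * absval x"
        using x absval_nonneg[of x] by (simp add: power2_eq_square mult_right_mono)
      finally have "absval (a i / a 0 * x ^ 2 ^ i) \<le> M * (r * absval x)"
        unfolding absval_mult absval_power
        using Ma[of i] i M absval_nonneg by (intro mult_mono) auto
      then show ?thesis
        using M by (simp add: r_def)
    qed
    then show ?thesis
      unfolding g_def absval_minus using absval_nonneg[of x] by (intro absval_sum_le) auto
  qed
  have gadd: "g (x + y) = g x + g y" for x y
    by (simp add: g_def power2_add_char_2[OF char_2] algebra_simps sum.distrib)
  have L: "additive_poly a n x = a 0 * (x - g x)" for x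
  proof -
    have "additive_poly a n x = a 0 * x + (\<Sum>i\<in>{1..n}. a i * x ^ 2 ^ i)"
      unfolding additive_poly_def using sum.atLeast_Suc_atMost[of 0 n "\<lambda>i. a i * x ^ 2 ^ i"]
      by (simp add: atMost_atLeast0)
    then show ?thesis
      using assms by (simp add: g_def ring_distribs sum_distrib_left)
  qed
  show ?thesis
  proof (intro exI[of _ "r * absval (a 0)"] conjI allI impI)
    fix c assume "absval c \<le> r * absval (a 0)"
    then have "absval (c / a 0) \<le> r"
      using assms by (simp add: absval_divide divide_simps)
    then obtain x where x: "x = c / a 0 + g x" "absval x \<le> absval (c / a 0)"
      using additive_contraction[of absval g r "1/2" "c / a 0"]
        absval_nonneg absval_diff absval_complete gadd g by auto
    have "x - g x = c / a 0"
      using x(1) by (metis add_diff_cancel_right')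
    with x(2) assms show "\<exists>x. additive_poly a n x = c \<and> absval x \<le> absval c / absval (a 0)"
      by (intro exI[of _ x]) (simp add: L absval_divide)
  qed (use r assms in auto)
qed

text \<open>The error of an approximate solution is so small that it is itself a value of the
  additive polynomial; adding its preimage gives an exact solution.\<close>

lemma square_plus_linear_surj:
  assumes "r \<noteq> 0"
  shows "\<exists>x. x ^ 2 + r * x = (c::'a)"
proof -
  define a where "a i = (if i = 0 then r else 1)" for i :: nat
  have a: "additive_poly a 1 x = x ^ 2 + r * x" for x
    by (simp add: additive_poly_def a_def add.commute power2_eq_square)
  obtain \<rho> where \<rho>: "\<rho> > 0" "\<And>c. absval c \<le> \<rho> \<Longrightarrow> \<exists>x. additive_poly a 1 x = c"
    using additive_poly_small[of a 1] assms by (auto simp: a_def)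
  obtain x where x: "absval (poly [:-c, r, 1:] x) < \<rho>"
    using approximate_root[of "[:-c, r, 1:]"] \<rho> by auto
  obtain h where h: "additive_poly a 1 h = - poly [:-c, r, 1:] x"
    using \<rho>(2)[of "- poly [:-c, r, 1:] x"] x absval_minus[of "poly [:-c, r, 1:] x"]
    by (metis less_imp_le)
  have "additive_poly a 1 (x + h) = c"
    unfolding additive_poly_add h by (simp only: a) (simp add: power2_eq_square algebra_simps)
  then have "(x + h) ^ 2 + r * (x + h) = c"
    by (simp only: a)
  then show ?thesis ..
qed

text \<open>Dividing by \<open>x\<close> removes the trivial root and leaves \<open>p\<close> with
  nonzero constant term. An approximate root of \<open>p\<close> is corrected by a summand of
  strictly smaller norm, so the sum cannot be \<open>0\<close>.\<close>

lemma additive_poly_nonzero_root: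
  assumes "a 0 \<noteq> 0" "a n \<noteq> 0" "n > 0"
  shows "\<exists>r. r \<noteq> 0 \<and> additive_poly a n r = 0"
proof -
  define p where "p = (\<Sum>i\<le>n. monom (a i / a n) (2 ^ i - 1))"
  have px: "x * poly p x = additive_poly a n x / a n" for x
  proof -
    have "x * (a i / a n * x ^ (2 ^ i - 1)) = a i * x ^ 2 ^ i / a n" for i
    proof -
      have "x * x ^ (2 ^ i - 1) = x ^ 2 ^ i"
        using power_Suc[of x "2 ^ i - 1"] by (simp del: power_Suc)
      then show ?thesis
        by (metis mult.left_commute times_divide_eq_left)
    qed
    then show ?thesis
      by (simp only: p_def poly_sum poly_monom additive_poly_def sum_distrib_left sum_divide_distrib)
  qed
  have inj: "2 ^ i - Suc 0 = 2 ^ j - Suc 0 \<longleftrightarrow> i = j" for i j :: nat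
  proof -
    have "(2::nat) ^ i > 0" "(2::nat) ^ j > 0" by auto
    then have "2 ^ i - Suc 0 = 2 ^ j - Suc 0 \<longleftrightarrow> (2::nat) ^ i = 2 ^ j" by linarith
    then show ?thesis by simp
  qed
  have lead: "coeff p (2 ^ n - 1) = 1"
    using assms by (simp add: p_def coeff_sum inj)
  have pn: "(2::nat) ^ n - 1 > 0"
    using assms(3) one_less_power[of "2::nat" n] by simp
  have deg: "degree p = 2 ^ n - 1"
  proof (rule antisym)
    show "degree p \<le> 2 ^ n - 1"
      unfolding p_def
      by (intro degree_sum_le order.trans[OF degree_monom_le] diff_le_mono power_increasing) auto
    show "2 ^ n - 1 \<le> degree p"
      using lead by (intro le_degree) simp
  qed
  define b where "b i = a i / a n" for i
  have ba: "additive_poly b n x = additive_poly a n x / a n" for x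
    by (simp add: additive_poly_def b_def sum_divide_distrib)
  have b0: "b 0 \<noteq> 0" using assms by (simp add: b_def)
  obtain \<rho> where \<rho>: "\<rho> > 0"
    "\<And>c. absval c \<le> \<rho> \<Longrightarrow> \<exists>x. additive_poly b n x = c \<and> absval x \<le> absval c / absval (b 0)"
    using additive_poly_small[of b n] b0 by blast
  obtain R where R: "R > 0" "\<And>\<epsilon>. \<epsilon> > 0 \<Longrightarrow> \<exists>x. absval x \<le> R \<and> absval (poly p x) < \<epsilon>"
    using approximate_root[of p] deg lead pn by auto
  \<comment> \<open>The bound \<open>\<rho> / R\<close> brings \<open>x * poly p x\<close> into the
    range of small solutions. The bound \<open>absval (b 0)\<close> makes the correction strictly
    smaller than \<open>x\<close>, and excludes \<open>x = 0\<close> because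
    \<open>poly p 0 = b 0\<close>.\<close>
  obtain x where x: "absval x \<le> R" "absval (poly p x) < min (\<rho> / R) (absval (b 0))"
    using R(2)[of "min (\<rho> / R) (absval (b 0))"] R(1) b0 \<rho>(1) by auto
  have x0: "additive_poly b n x = x * poly p x"
    by (simp add: ba px)
  show ?thesis
  proof (cases "x = 0")
    case True
    have "poly p 0 = b 0"
    proof -
      have "coeff p 0 = (\<Sum>i\<le>n. if i = 0 then a i / a n else 0)"
        unfolding p_def coeff_sum using inj[of _ 0] by (intro sum.cong) auto
      then show ?thesis
        by (simp add: poly_0_coeff_0 b_def)
    qed
    with x True show ?thesis
      by simp
  next
    case False
    have "absval (additive_poly b n x) \<le> R * (\<rho> / R)"
      unfolding x0 absval_mult using x absval_nonneg R by (intro mult_mono) auto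
    then obtain h where h: "additive_poly b n h = additive_poly b n x"
        "absval h \<le> absval (additive_poly b n x) / absval (b 0)"
      using \<rho>(2) R by force
    have "absval x * absval (poly p x) < absval x * absval (b 0)"
      using x False by (intro mult_strict_left_mono) auto
    then have "absval (additive_poly b n x) / absval (b 0) < absval x"
      using b0 by (simp add: x0 absval_mult pos_divide_less_eq)
    then have "absval h < absval x"
      using h(2) by linarith
    then have "x + h \<noteq> 0"
      by (auto simp: add_eq_0_iff_eq)
    moreover have "additive_poly b n (x + h) = 0"
      by (simp add: additive_poly_add h)
    ultimately show ?thesis
      using assms ba by auto
  qed
qed

text \<open>A nonzero root \<open>r\<close> splits off a right factor: the polynomial is an additive
  polynomial with one term less, composed with \<open>q x = x ^ 2 + r * x\<close>. The map
  \<open>q\<close> is onto with fibres \<open>{x, x + r}\<close>, so the number of roots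
  doubles.\<close>

lemma card_additive_poly_roots:
  assumes "a 0 \<noteq> 0" "a n \<noteq> 0"
  shows "card {x. additive_poly a n x = 0} = 2 ^ n"
  using assms
proof (induction n arbitrary: a)
  case 0
  then have "{x. additive_poly a 0 x = 0} = {0}"
    by (auto simp: additive_poly_def)
  then show ?case by simp
next
  case (Suc n)
  obtain r where r: "r \<noteq> 0" "additive_poly a (Suc n) r = 0"
    using additive_poly_nonzero_root[of a "Suc n"] Suc.prems by auto
  text \<open>Right division by \<open>\<tau> + r\<close>: the quotient has coefficients \<open>b\<close>.\<close>
  define b where "b = rec_nat (a 0 / r) (\<lambda>i c. (a (Suc i) - c) / r ^ 2 ^ Suc i)"
  have b0: "b 0 * r = a 0" and bSuc: "b i + b (Suc i) * r ^ 2 ^ Suc i = a (Suc i)" for i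
    using r by (simp_all add: b_def)
  define q where "q x = x ^ 2 + r * x" for x
  have q_add: "q (x + y) = q x + q y" for x y
    using power2_add_char_2[OF char_2, of x y 1]
    by (simp only: q_def ring_distribs ac_simps power_one_right)
  \<comment> \<open>Each truncated composite has one surplus term. At \<open>m = Suc n\<close> and
    \<open>x = r\<close> all other terms vanish, which forces \<open>b (Suc n) = 0\<close>: the
    division leaves no remainder because \<open>r\<close> is a root.\<close>
  have comp: "additive_poly b m (q x) = additive_poly a m x + b m * x ^ 2 ^ Suc m" for m x
  proof (induction m)
    case 0
    show ?case
      by (simp add: additive_poly_def q_def ring_distribs flip: b0)
  next
    case (Suc m)
    have "q x ^ 2 ^ Suc m = x ^ 2 ^ Suc (Suc m) + r ^ 2 ^ Suc m * x ^ 2 ^ Suc m"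
      unfolding q_def power2_add_char_2[OF char_2] by (simp add: power_mult_distrib flip: power_mult)
    then have "additive_poly b (Suc m) (q x) = additive_poly a m x +
        (b m + b (Suc m) * r ^ 2 ^ Suc m) * x ^ 2 ^ Suc m + b (Suc m) * x ^ 2 ^ Suc (Suc m)"
      using Suc by (simp add: additive_poly_def algebra_simps)
    then show ?case
      unfolding bSuc by (simp add: additive_poly_def)
  qed
  have "q r = 0"
    by (simp add: q_def power2_eq_square)
  with comp[of "Suc n" r] r have bn: "b (Suc n) = 0"
    by simp
  then have comp': "additive_poly b n (q x) = additive_poly a (Suc n) x" for x
    using comp[of "Suc n" x] by (simp add: additive_poly_def)
  have "b n \<noteq> 0" "b 0 \<noteq> 0"
    using bSuc[of n] bn Suc.prems b0 by auto
  then have IH: "card {y. additive_poly b n y = 0} = 2 ^ n" (is "card ?Y = _")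
    using Suc.IH by blast
  have q_iff: "q x = q y \<longleftrightarrow> x = y \<or> x = y + r" for x y
  proof -
    have "q x = q y \<longleftrightarrow> q (x + y) = 0"
      by (simp add: q_add add_eq_0_iff_eq)
    also have "\<dots> \<longleftrightarrow> (x + y) * (x + (y + r)) = 0"
      by (simp only: q_def power2_eq_square ring_distribs ac_simps)
    also have "\<dots> \<longleftrightarrow> x = y \<or> x = y + r"
      by (simp add: add_eq_0_iff_eq)
    finally show ?thesis .
  qed
  have "{x. additive_poly a (Suc n) x = 0} = (\<Union>y\<in>?Y. {x. q x = y})"
    by (auto simp: comp')
  also have "card \<dots> = (\<Sum>y\<in>?Y. card {x. q x = y})"
  proof (rule card_UN_disjoint)
    show "finite ?Y" using IH card.infinite by fastforce
    show "\<forall>y\<in>?Y. finite {x. q x = y}"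
    proof
      fix y
      obtain x where "q x = y" using square_plus_linear_surj[OF r(1)] by (auto simp: q_def)
      then have "{x'. q x' = y} = {x, x + r}" using q_iff by auto
      then show "finite {x. q x = y}" by simp
    qed
  qed auto
  also have "\<dots> = (\<Sum>y\<in>?Y. 2)"
  proof (rule sum.cong)
    fix y
    obtain x where "q x = y" using square_plus_linear_surj[OF r(1)] by (auto simp: q_def)
    then have "{x'. q x' = y} = {x, x + r}" using q_iff by auto
    then show "card {x. q x = y} = 2" using r(1) by simp
  qed simp
  finally show ?case
    using IH by simp
qed

end

section \<open>Elementary abelian 2-groups\<close>

lemma sum_symm_diff_char_2:
  fixes f :: "'b \<Rightarrow> 'c::ab_group_add"
  assumes "\<And>x::'c. x + x = 0" "finite S" "finite T"
  shows "sum f S + sum f T = sum f ((S - T) \<union> (T - S))"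
proof -
  have "sum f S + sum f T = (sum f (S - T) + sum f (S \<inter> T)) + (sum f (T - S) + sum f (S \<inter> T))"
    using assms sum.Int_Diff[of S f T] sum.Int_Diff[of T f S] by (simp add: Int_commute add.commute)
  also have "\<dots> = sum f (S - T) + sum f (T - S) + (sum f (S \<inter> T) + sum f (S \<inter> T))"
    by (simp only: ac_simps)
  also have "\<dots> = sum f ((S - T) \<union> (T - S))"
    using assms by (subst sum.union_disjoint) auto
  finally show ?thesis .
qed

text \<open>An \<open>F\<^sub>2\<close>-basis, expressed by subset sums because the coefficients of
  a linear combination are \<open>0\<close> and \<open>1\<close>. A largest subset of
  \<open>H\<close> with distinct subset sums spans \<open>H\<close>.\<close>

lemma elementary_2_group_basis:
  fixes H :: "'c::ab_group_add set"
  assumes two: "\<And>x::'c. x + x = 0" and H: "finite H" "0 \<in> H" "\<And>x y. x \<in> H \<Longrightarrow> y \<in> H \<Longrightarrow> x + y \<in> H"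
  obtains B where "B \<subseteq> H" "bij_betw (\<lambda>S. \<Sum>S) (Pow B) H"
proof -
  define P where "P = {B. B \<subseteq> H \<and> inj_on (\<lambda>S. \<Sum>S) (Pow B)}"
  have "P \<subseteq> Pow H" "{} \<in> P"
    by (auto simp: P_def)
  then have fP: "finite (card ` P)" "card ` P \<noteq> {}"
    using finite_subset[OF _ finite_Pow_iff[THEN iffD2, OF H(1)]] by auto
  then obtain B where B: "B \<in> P" and cB: "card B = Max (card ` P)"
    using Max_in by (metis imageE)
  have max: "card B' \<le> card B" if "B' \<in> P" for B'
    using fP(1) that by (simp add: cB)
  have BH: "B \<subseteq> H" and inj: "inj_on (\<lambda>S. \<Sum>S) (Pow B)" and fin: "finite B"
    using B H finite_subset by (auto simp: P_def)
  have sumH: "\<Sum>S \<in> H" if "S \<subseteq> B" for S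
    using finite_subset[OF that fin] that BH H by (induction S rule: finite_induct) auto
  have "h \<in> (\<lambda>S. \<Sum>S) ` Pow B" if h: "h \<in> H" for h
  proof (rule ccontr)
    assume no: "h \<notin> (\<lambda>S. \<Sum>S) ` Pow B"
    then have hB: "h \<notin> B" by (auto intro!: image_eqI[of _ _ "{h}"])
    have "inj_on (\<lambda>S. \<Sum>S) (Pow (insert h B))"
    proof (rule inj_onI)
      fix S T assume ST: "S \<in> Pow (insert h B)" "T \<in> Pow (insert h B)" and eq: "\<Sum>S = \<Sum>T"
      have f: "finite S" "finite T" using ST fin finite_subset by auto
      \<comment> \<open>Equal sums mean that the symmetric difference has sum \<open>0\<close>. If
        it contained \<open>h\<close>, then \<open>h\<close> would be a subset sum of
        \<open>B\<close>; otherwise it is a subset of \<open>B\<close> with the same sum as the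
        empty set.\<close>
      define D where "D = (S - T) \<union> (T - S)"
      have D: "finite D" "D \<subseteq> insert h B" using ST f by (auto simp: D_def)
      have D0: "\<Sum>D = 0"
        using sum_symm_diff_char_2[of S T "\<lambda>x. x"] two f eq by (simp add: D_def)
      have "h \<notin> D"
      proof
        assume "h \<in> D"
        then have "h + \<Sum>(D - {h}) = 0"
          using D0 D by (simp flip: sum.remove[of D h "\<lambda>x. x"])
        then have "h = \<Sum>(D - {h})"
          using two by (metis add_right_cancel)
        with no D show False by blast
      qed
      then have "D \<in> Pow B" using D by auto
      with inj D0 have "D = {}"
        by (metis Pow_bottom inj_onD sum.empty)
      then show "S = T" by (auto simp: D_def)
    qed
    then have "insert h B \<in> P" using h BH by (auto simp: P_def)
    from max[OF this] hB fin show False by simp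
  qed
  then have "bij_betw (\<lambda>S. \<Sum>S) (Pow B) H"
    using inj sumH by (auto simp: bij_betw_def)
  with BH show ?thesis by (rule that)
qed

section \<open>Coordinates on a tensor product\<close>

lemma keys_add_subset:
  fixes x y :: "'b \<Rightarrow>\<^sub>0 int"
  assumes "Poly_Mapping.keys x \<subseteq> A" "Poly_Mapping.keys y \<subseteq> A"
  shows "Poly_Mapping.keys (x + y) \<subseteq> A"
  by (rule order_trans[OF keys_add]) (use assms in simp)

lemma keys_diff_subset:
  fixes x y :: "'b \<Rightarrow>\<^sub>0 int"
  assumes "Poly_Mapping.keys x \<subseteq> A" "Poly_Mapping.keys y \<subseteq> A"
  shows "Poly_Mapping.keys (x - y) \<subseteq> A"
  by (rule order_trans[OF keys_diff]) (use assms in simp)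

text \<open>A bilinear map, extended additively to \<open>lift\<close>, identifies the tensor product with \<open>Z\<close> as
  soon as every class of \<open>m \<otimes> n\<close> has the representative \<open>E\<close> determined by its image.\<close>

locale tensor_coordinates =
  fixes sV :: "'r \<Rightarrow> 'm \<Rightarrow> 'm::ab_group_add" and sW :: "'r \<Rightarrow> 'n \<Rightarrow> 'n::ab_group_add"
    and V :: "'m set" and W :: "'n set"
    and lift :: "('m \<times> 'n \<Rightarrow>\<^sub>0 int) \<Rightarrow> 'z::ab_group_add"
    and E :: "'z \<Rightarrow> ('m \<times> 'n \<Rightarrow>\<^sub>0 int)" and Z :: "'z set"
  assumes relators_subset: "tensor_relators sV sW V W \<subseteq> carrier (free_Abelian_group (V \<times> W))"
    and lift_add: "lift (x + y) = lift x + lift y"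
    and lift_relator: "x \<in> tensor_relators sV sW V W \<Longrightarrow> lift x = 0"
    and lift_in: "m \<in> V \<Longrightarrow> n \<in> W \<Longrightarrow> lift (frag_of (m, n)) \<in> Z"
    and zero_in: "0 \<in> Z" and diff_in: "z \<in> Z \<Longrightarrow> w \<in> Z \<Longrightarrow> z - w \<in> Z"
    and E_carrier: "z \<in> Z \<Longrightarrow> E z \<in> carrier (free_Abelian_group (V \<times> W))"
    and lift_E: "z \<in> Z \<Longrightarrow> lift (E z) = z"
    and E_lift: "m \<in> V \<Longrightarrow> n \<in> W \<Longrightarrow> frag_of (m, n) - E (lift (frag_of (m, n))) \<in> tensor_null sV sW V W"
    and E_diff: "z \<in> Z \<Longrightarrow> w \<in> Z \<Longrightarrow> E (z - w) - (E z - E w) \<in> tensor_null sV sW V W"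
begin

abbreviation "FA \<equiv> free_Abelian_group (V \<times> W)"
abbreviation "Null \<equiv> tensor_null sV sW V W"
abbreviation "TP \<equiv> tensor_product sV sW V W"

text \<open>The fibres of \<open>lift\<close> turn out to be the cosets of \<open>Null\<close>, so
  that computations in the quotient become computations in \<open>Z\<close>.\<close>

definition coset_of :: "'z \<Rightarrow> ('m \<times> 'n \<Rightarrow>\<^sub>0 int) set" where
  "coset_of z = {x \<in> carrier FA. lift x = z}"

sublocale FA: comm_group FA
  by (rule abelian_free_Abelian_group)

lemma Null_subgroup: "subgroup Null FA"
  unfolding tensor_null_def by (rule FA.generate_is_subgroup[OF relators_subset])

lemma add_in:
  assumes "z \<in> Z" "w \<in> Z"
  shows "z + w \<in> Z"
proof -
  have "z - (0 - w) \<in> Z"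
    by (intro diff_in zero_in assms)
  then show ?thesis
    by (simp only: diff_0 diff_minus_eq_add)
qed

lemma Null_carrier: "x \<in> Null \<Longrightarrow> Poly_Mapping.keys x \<subseteq> V \<times> W"
  using subgroup.mem_carrier[OF Null_subgroup] by fastforce

lemma Null_add: "x \<in> Null \<Longrightarrow> y \<in> Null \<Longrightarrow> x + y \<in> Null"
  using subgroup.m_closed[OF Null_subgroup] by fastforce

lemma Null_minus: "x \<in> Null \<Longrightarrow> - x \<in> Null"
  using subgroup.m_inv_closed[OF Null_subgroup, of x] Null_carrier[of x] by simp

lemma Null_diff: "x \<in> Null \<Longrightarrow> y \<in> Null \<Longrightarrow> x - y \<in> Null"
  using Null_add[of x "- y"] Null_minus[of y] by simp

lemma lift_0: "lift 0 = 0"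
  using lift_add[of 0 0] by simp

lemma lift_diff: "lift (x - y) = lift x - lift y"
  using lift_add[of "x - y" y] by (simp add: algebra_simps)

lemma lift_minus: "lift (- x) = - lift x"
  using lift_diff[of 0 x] by (simp add: lift_0)

lemma lift_Null: "x \<in> Null \<Longrightarrow> lift x = 0"
  unfolding tensor_null_def
proof (induction rule: generate.induct)
  case (inv h)
  then show ?case
    using relators_subset by (auto simp: lift_minus lift_relator subset_iff)
qed (simp_all add: lift_0 lift_relator lift_add)

text \<open>Modulo \<open>Null\<close>, the composite of \<open>lift\<close> and \<open>E\<close> is
  additive and fixes the generators, so it fixes everything. This yields that \<open>lift\<close>
  has no kernel beyond \<open>Null\<close>.\<close>

lemma lift_in_Z_and_E_lift:
  assumes "Poly_Mapping.keys x \<subseteq> V \<times> W"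
  shows "lift x \<in> Z \<and> x - E (lift x) \<in> Null"
proof (rule free_Abelian_group_induct[OF assms])
  show "lift 0 \<in> Z \<and> 0 - E (lift 0) \<in> Null"
    using E_diff[OF zero_in zero_in] Null_minus by (fastforce simp: lift_0 zero_in)
next
  fix x y assume "lift x \<in> Z \<and> x - E (lift x) \<in> Null" "lift y \<in> Z \<and> y - E (lift y) \<in> Null"
  then have *: "lift x \<in> Z" "lift y \<in> Z" "x - E (lift x) \<in> Null" "y - E (lift y) \<in> Null"
    by auto
  then have "(x - E (lift x)) - (y - E (lift y)) -
      (E (lift x - lift y) - (E (lift x) - E (lift y))) \<in> Null"
    by (metis Null_diff E_diff)
  with * show "lift (x - y) \<in> Z \<and> x - y - E (lift (x - y)) \<in> Null"
    by (simp add: lift_diff diff_in algebra_simps)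
next
  fix a assume "a \<in> V \<times> W"
  then show "lift (frag_of a) \<in> Z \<and> frag_of a - E (lift (frag_of a)) \<in> Null"
    by (cases a) (auto intro: lift_in E_lift)
qed

lemma Null_iff: "x \<in> Null \<longleftrightarrow> Poly_Mapping.keys x \<subseteq> V \<times> W \<and> lift x = 0"
proof
  assume "Poly_Mapping.keys x \<subseteq> V \<times> W \<and> lift x = 0"
  then have "x - E 0 \<in> Null" "0 - E 0 \<in> Null"
    using lift_in_Z_and_E_lift[of x] lift_in_Z_and_E_lift[of 0] by (auto simp: lift_0)
  then show "x \<in> Null"
    using Null_diff by fastforce
qed (use lift_Null Null_carrier in auto)

lemma r_coset_Null:
  assumes "Poly_Mapping.keys x \<subseteq> V \<times> W"
  shows "Null #>\<^bsub>FA\<^esub> x = coset_of (lift x)"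
proof
  show "Null #>\<^bsub>FA\<^esub> x \<subseteq> coset_of (lift x)"
  proof
    fix y assume "y \<in> Null #>\<^bsub>FA\<^esub> x"
    then obtain h where "h \<in> Null" "y = h + x"
      by (auto simp: r_coset_def)
    then show "y \<in> coset_of (lift x)"
      using assms keys_add_subset[of h "V \<times> W" x] by (simp add: coset_of_def Null_iff lift_add)
  qed
  show "coset_of (lift x) \<subseteq> Null #>\<^bsub>FA\<^esub> x"
  proof
    fix y assume "y \<in> coset_of (lift x)"
    then have "y - x \<in> Null"
      using assms by (auto simp: coset_of_def Null_iff lift_diff keys_diff_subset)
    then show "y \<in> Null #>\<^bsub>FA\<^esub> x"
      by (force simp: r_coset_def)
  qed
qed

lemma E_in_coset: "z \<in> Z \<Longrightarrow> E z \<in> coset_of z"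
  by (simp add: coset_of_def lift_E E_carrier[simplified])

lemma coset_of_inj:
  assumes "z \<in> Z" "coset_of z = coset_of w"
  shows "z = w"
proof -
  have "E z \<in> coset_of w"
    using E_in_coset[OF assms(1)] assms(2) by simp
  then show ?thesis
    using lift_E[OF assms(1)] by (simp add: coset_of_def)
qed

lemma carrier_TP: "carrier TP = coset_of ` Z"
proof -
  have "carrier TP = (\<lambda>x. Null #>\<^bsub>FA\<^esub> x) ` carrier FA"
    by (simp add: tensor_product_def carrier_FactGroup)
  also have "\<dots> = (\<lambda>x. coset_of (lift x)) ` carrier FA"
    by (rule image_cong) (simp_all add: r_coset_Null)
  also have "\<dots> = coset_of ` lift ` carrier FA"
    by (simp add: image_image)
  also have "lift ` carrier FA = Z"
  proof
    show "lift ` carrier FA \<subseteq> Z"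
      using lift_in_Z_and_E_lift by auto
    show "Z \<subseteq> lift ` carrier FA"
    proof
      fix z assume "z \<in> Z"
      then show "z \<in> lift ` carrier FA"
        using imageI[OF E_carrier, of z lift] lift_E[of z] by simp
    qed
  qed
  finally show ?thesis .
qed

lemma mult_TP:
  assumes "z \<in> Z" "w \<in> Z"
  shows "coset_of z \<otimes>\<^bsub>TP\<^esub> coset_of w = coset_of (z + w)"
proof -
  have "coset_of z \<otimes>\<^bsub>TP\<^esub> coset_of w = {x + y |x y. x \<in> coset_of z \<and> y \<in> coset_of w}"
    by (simp add: tensor_product_def set_mult_def) blast
  also have "\<dots> = coset_of (z + w)"
  proof (intro subset_antisym subsetI)
    fix y assume y: "y \<in> coset_of (z + w)"
    then have "y - E z \<in> coset_of w"
      using E_in_coset[OF assms(1)] keys_diff_subset[of y "V \<times> W" "E z"]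
      by (simp add: coset_of_def lift_diff)
    moreover have "y = E z + (y - E z)" by simp
    ultimately show "y \<in> {x + y |x y. x \<in> coset_of z \<and> y \<in> coset_of w}"
      using E_in_coset[OF assms(1)] by blast
  next
    fix y assume "y \<in> {x + y |x y. x \<in> coset_of z \<and> y \<in> coset_of w}"
    then obtain a b where "y = a + b" "a \<in> coset_of z" "b \<in> coset_of w"
      by blast
    then show "y \<in> coset_of (z + w)"
      using keys_add_subset[of a "V \<times> W" b] by (simp add: coset_of_def lift_add)
  qed
  finally show ?thesis .
qed

lemma comm_group_TP: "comm_group TP"
  using FA.abelian_FactGroup[OF Null_subgroup] by (simp only: tensor_product_def)

lemma one_TP: "\<one>\<^bsub>TP\<^esub> = coset_of 0"
  by (auto simp: tensor_product_def coset_of_def Null_iff)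

lemma sum_in: "(\<And>i. i \<in> I \<Longrightarrow> f i \<in> Z) \<Longrightarrow> sum f I \<in> Z"
  by (induction I rule: infinite_finite_induct) (auto simp: zero_in add_in)

lemma finprod_TP:
  assumes "finite I" "\<And>i. i \<in> I \<Longrightarrow> f i \<in> Z"
  shows "(\<Otimes>\<^bsub>TP\<^esub>i\<in>I. coset_of (f i)) = coset_of (\<Sum>i\<in>I. f i)"
  using assms
proof (induction I rule: finite_induct)
  case (insert i I)
  interpret TP: comm_group TP
    by (rule comm_group_TP)
  show ?case
    using insert by (subst TP.finprod_insert) (auto simp: carrier_TP mult_TP sum_in)
qed (simp add: comm_monoid.finprod_empty[OF comm_group.axioms(1)[OF comm_group_TP]] one_TP)

text \<open>The use of \<open>the_elem\<close> in \<open>tensor_map\<close> is justified here: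
  \<open>lift\<close> carries the induced map of the free group to \<open>t\<close>, so all
  representatives of a coset are sent into one fibre.\<close>

lemma tensor_map_coset_of:
  assumes \<phi>: "\<And>m. m \<in> V \<Longrightarrow> \<phi> m \<in> V" and \<psi>: "\<And>n. n \<in> W \<Longrightarrow> \<psi> n \<in> W"
    and t_diff: "\<And>z w. t (z - w) = t z - t w"
    and t: "\<And>m n. m \<in> V \<Longrightarrow> n \<in> W \<Longrightarrow> lift (frag_of (\<phi> m, \<psi> n)) = t (lift (frag_of (m, n)))"
    and z: "z \<in> Z"
  shows "tensor_map sV sW V W \<phi> \<psi> (coset_of z) = coset_of (t z)"
proof -
  define g where "g = frag_extend (\<lambda>(m, n). frag_of (\<phi> m, \<psi> n))"
  have g: "Poly_Mapping.keys (g x) \<subseteq> V \<times> W \<and> lift (g x) = t (lift x)"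
    if "Poly_Mapping.keys x \<subseteq> V \<times> W" for x
  proof (rule free_Abelian_group_induct[OF that])
    show "Poly_Mapping.keys (g 0) \<subseteq> V \<times> W \<and> lift (g 0) = t (lift 0)"
      using t_diff[of 0 0] by (simp add: g_def lift_0)
    fix x y
    assume "Poly_Mapping.keys (g x) \<subseteq> V \<times> W \<and> lift (g x) = t (lift x)"
      "Poly_Mapping.keys (g y) \<subseteq> V \<times> W \<and> lift (g y) = t (lift y)"
    then show "Poly_Mapping.keys (g (x - y)) \<subseteq> V \<times> W \<and> lift (g (x - y)) = t (lift (x - y))"
      by (simp add: g_def frag_extend_diff lift_diff t_diff keys_diff_subset)
  next
    fix a assume "a \<in> V \<times> W"
    then show "Poly_Mapping.keys (g (frag_of a)) \<subseteq> V \<times> W \<and> lift (g (frag_of a)) = t (lift (frag_of a))"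
      by (cases a) (auto simp: g_def \<phi> \<psi> t)
  qed
  have "(\<lambda>x. Null #>\<^bsub>FA\<^esub> g x) ` coset_of z = {coset_of (t z)}"
  proof -
    have "Null #>\<^bsub>FA\<^esub> g x = coset_of (t z)" if "x \<in> coset_of z" for x
      using that g[of x] by (auto simp: coset_of_def r_coset_Null)
    then show ?thesis
      using E_in_coset[OF z] by auto
  qed
  then show ?thesis
    by (simp add: tensor_map_def g_def)
qed

end

text \<open>The universal property of the free abelian group, with the additive group of a type
  regarded as an explicit group structure.\<close>

lemma frag_lift_exists:
  fixes f :: "'b \<Rightarrow> 'z::ab_group_add"
  obtains lift :: "('b \<Rightarrow>\<^sub>0 int) \<Rightarrow> 'z"
  where "\<And>x y. lift (x + y) = lift x + lift y" "\<And>b. lift (frag_of b) = f b"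
proof -
  let ?G = "\<lparr>carrier = UNIV, monoid.mult = (+), one = 0\<rparr> :: 'z monoid"
  have "comm_group ?G"
  proof (rule comm_groupI)
    fix x assume "x \<in> carrier ?G"
    show "\<exists>y\<in>carrier ?G. y \<otimes>\<^bsub>?G\<^esub> x = \<one>\<^bsub>?G\<^esub>"
      by (rule bexI[of _ "- x"]) simp_all
  qed (simp_all add: ac_simps)
  from comm_group.free_Abelian_group_universal[OF this, of f UNIV]
  obtain h where h: "h \<in> hom (free_Abelian_group UNIV) ?G" "\<And>x. x \<in> UNIV \<Longrightarrow> h (frag_of x) = f x"
    by (metis partial_object.select_convs(1) subset_UNIV)
  from h(1) have "h (x + y) = h x + h y" for x y
    using hom_mult[of h "free_Abelian_group UNIV" ?G x y] by simp
  then show ?thesis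
    using h(2) by (rule that) simp
qed

section \<open>Twisted polynomials\<close>

lemma poly_monom_add_induct [case_names monom add]:
  fixes f :: "'a::comm_monoid_add poly"
  assumes "\<And>a i. P (monom a i)" and add: "\<And>f g. P f \<Longrightarrow> P g \<Longrightarrow> P (f + g)"
  shows "P f"
proof -
  have "P (\<Sum>i\<in>I. monom (coeff f i) i)" if "finite I" for I
    using that
  proof (induction I rule: finite_induct)
    case empty
    show ?case using assms(1)[of 0 0] by simp
  next
    case (insert i I)
    then show ?case using assms by simp
  qed
  from this[of "{..degree f}"] show ?thesis
    by (simp add: poly_as_sum_of_monoms)
qed

text \<open>The formula does not mention degrees, so additivity can be checked coefficientwise even
  where degrees drop in a sum.\<close>

lemma coeff_twisted_mult:
  "coeff (twisted_mult f g) n = (\<Sum>i\<le>n. coeff f i * coeff g (n - i) ^ 2 ^ i)"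
proof -
  have "coeff (twisted_mult f g) n =
      (\<Sum>i\<le>degree f. \<Sum>j\<le>degree g. if i + j = n then coeff f i * coeff g j ^ 2 ^ i else 0)"
    by (simp add: twisted_mult_def coeff_sum)
  also have "\<dots> = (\<Sum>i\<le>degree f. if i \<le> n then coeff f i * coeff g (n - i) ^ 2 ^ i else 0)"
  proof (rule sum.cong)
    fix i
    have "(\<Sum>j\<le>degree g. if i + j = n then coeff f i * coeff g j ^ 2 ^ i else 0) =
        (\<Sum>j\<le>degree g. if n - i = j then (if i \<le> n then coeff f i * coeff g j ^ 2 ^ i else 0) else 0)"
      by (rule sum.cong) auto
    also have "\<dots> = (if i \<le> n then coeff f i * coeff g (n - i) ^ 2 ^ i else 0)"
      by (auto simp: sum.delta coeff_eq_0)
    finally show "(\<Sum>j\<le>degree g. if i + j = n then coeff f i * coeff g j ^ 2 ^ i else 0) =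
      (if i \<le> n then coeff f i * coeff g (n - i) ^ 2 ^ i else 0)" .
  qed simp
  also have "\<dots> = (\<Sum>i\<in>{..degree f} \<inter> {..n}. coeff f i * coeff g (n - i) ^ 2 ^ i)"
    by (subst sum.inter_restrict) simp_all
  also have "\<dots> = (\<Sum>i\<le>n. coeff f i * coeff g (n - i) ^ 2 ^ i)"
    by (rule sum.mono_neutral_left) (auto simp: coeff_eq_0)
  finally show ?thesis .
qed

lemma twisted_mult_add_left: "twisted_mult (f + g) h = twisted_mult f h + twisted_mult g h"
  by (rule poly_eqI) (simp add: coeff_twisted_mult ring_distribs sum.distrib)

lemma twisted_mult_0_left [simp]: "twisted_mult 0 g = 0"
  by (rule poly_eqI) (simp add: coeff_twisted_mult)

lemma twisted_mult_0_right [simp]: "twisted_mult f 0 = 0"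
  by (rule poly_eqI) (simp add: coeff_twisted_mult power_0_left)

lemma twisted_mult_monom:
  "twisted_mult (monom a i) (monom b j) = monom (a * b ^ 2 ^ i) (i + j)"
proof (rule poly_eqI)
  fix n
  have "coeff (twisted_mult (monom a i) (monom b j)) n =
      (\<Sum>k\<le>n. if k = i then (if n - k = j then a * b ^ 2 ^ i else 0) else 0)"
    unfolding coeff_twisted_mult by (rule sum.cong) auto
  also have "\<dots> = coeff (monom (a * b ^ 2 ^ i) (i + j)) n"
    by (auto simp: sum.delta)
  finally show "coeff (twisted_mult (monom a i) (monom b j)) n = coeff (monom (a * b ^ 2 ^ i) (i + j)) n" .
qed

lemma twisted_mult_1_left [simp]: "twisted_mult 1 f = f"
  by (rule poly_eqI) (simp add: coeff_twisted_mult if_distrib if_distribR flip: one_pCons cong: if_cong)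

lemma twisted_mult_const: "twisted_mult [:c:] f = smult c f"
proof (rule poly_eqI)
  fix n
  have "(\<Sum>i\<le>n. coeff [:c:] i * coeff f (n - i) ^ 2 ^ i) = (\<Sum>i\<le>n. if i = 0 then c * coeff f n else 0)"
    by (rule sum.cong) (auto simp: coeff_pCons split: nat.splits)
  then show "coeff (twisted_mult [:c:] f) n = coeff (smult c f) n"
    by (simp add: coeff_twisted_mult)
qed

lemma twisted_mult_tau:
  "twisted_mult [:0, 1:] 1 = [:0, 1:]" "twisted_mult [:0, 1:] [:0, 1:] = [:0, 0, 1:]"
  using twisted_mult_monom[of 1 1 1 0] twisted_mult_monom[of 1 1 1 1]
  by (simp_all add: monom_0 monom_Suc one_pCons)

context
  assumes char_2: "CHAR('a::field) = 2"
begin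

lemma twisted_mult_add_right:
  "twisted_mult f (g + h :: 'a poly) = twisted_mult f g + twisted_mult f h"
  by (rule poly_eqI) (simp add: coeff_twisted_mult ring_distribs sum.distrib power2_add_char_2[OF char_2])

lemma twisted_mult_sum_right:
  "twisted_mult f (\<Sum>i\<in>I. g i) = (\<Sum>i\<in>I. twisted_mult f (g i :: 'a poly))"
  by (induction I rule: infinite_finite_induct) (simp_all add: twisted_mult_add_right)

text \<open>Additivity in every argument reduces this to monomials; on the right it rests on the
  additivity of Frobenius in characteristic 2.\<close>

lemma twisted_mult_assoc:
  "twisted_mult (twisted_mult f g) h = twisted_mult f (twisted_mult g (h :: 'a poly))"
proof (induction f rule: poly_monom_add_induct)
  case (monom a i)
  show ?case
  proof (induction g rule: poly_monom_add_induct)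
    case (monom b j)
    show ?case
    proof (induction h rule: poly_monom_add_induct)
      case (monom c k)
      show ?case
        by (simp add: twisted_mult_monom power_mult_distrib power_add mult.assoc add.assoc
            mult.commute[of "2 ^ j"] flip: power_mult)
    qed (simp add: twisted_mult_add_right)
  qed (simp add: twisted_mult_add_left twisted_mult_add_right)
qed (simp add: twisted_mult_add_left)

lemma twisted_scale_add_right: "twisted_scale f (m + m') = twisted_scale f m + twisted_scale f (m' :: 'a poly ^ 2)"
  by (simp add: twisted_scale_def vec_eq_iff twisted_mult_add_right)

lemma twisted_scale_twisted_scale:
  "twisted_scale f (twisted_scale g m) = twisted_scale (twisted_mult f g) (m :: 'a poly ^ 2)"
  by (simp add: twisted_scale_def vec_eq_iff twisted_mult_assoc)

lemma motive_T_twisted_scale: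
  "motive_T \<theta> A (twisted_scale f m) = twisted_scale f (motive_T \<theta> A (m :: 'a poly ^ 2))"
  by (simp add: motive_T_def twisted_scale_def vec_eq_iff twisted_mult_assoc twisted_mult_sum_right)

lemma motive_T_funpow_twisted_scale:
  "(motive_T \<theta> A ^^ i) (twisted_scale f m) = twisted_scale f ((motive_T \<theta> A ^^ i) (m :: 'a poly ^ 2))"
  by (induction i) (simp_all add: motive_T_twisted_scale)

lemma tau_const: "twisted_mult [:0, 1:] [:c:] = twisted_mult [:c ^ 2:] [:0, 1 :: 'a:]"
proof -
  have "[:0, 1 :: 'a:] = monom 1 1" "[:c:] = monom c 0" "[:c ^ 2:] = monom (c ^ 2) 0"
    by (simp_all add: monom_0 monom_Suc numeral_2_eq_2 one_pCons)
  then show ?thesis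
    by (simp only: twisted_mult_monom) simp
qed

text \<open>Since \<open>motive_T\<close> multiplies from the right, it commutes with
  \<open>\<tau>\<close>; only the coefficients of \<open>p\<close> feel the Frobenius.\<close>

lemma motive_tau_motive_scale:
  "motive_tau (motive_scale \<theta> A p m) =
    motive_scale \<theta> A (map_poly (\<lambda>c. c ^ 2) p) (motive_tau (m :: 'a poly ^ 2))"
proof -
  have deg: "degree (map_poly (\<lambda>c. c ^ 2) p) = degree p"
    by (rule degree_map_poly) simp
  have sum: "motive_tau (\<Sum>i\<in>I. f i) = (\<Sum>i\<in>I. motive_tau (f i :: 'a poly ^ 2))" for f and I :: "nat set"
    unfolding motive_tau_def
    by (induction I rule: infinite_finite_induct)
       (simp_all add: twisted_scale_add_right, simp_all add: twisted_scale_def vec_eq_iff)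
  show ?thesis
    unfolding motive_scale_def sum deg
    by (rule sum.cong)
       (simp_all add: motive_tau_def motive_T_funpow_twisted_scale twisted_scale_twisted_scale tau_const coeff_map_poly)
qed

lemma motive_scale_0: "motive_scale \<theta> A 0 (m :: 'a poly ^ 2) = 0"
  by (simp add: motive_scale_def twisted_scale_def vec_eq_iff)

lemma motive_scale_const: "motive_scale \<theta> A [:c:] (m :: 'a poly ^ 2) = twisted_scale [:c:] m"
  by (simp add: motive_scale_def)

lemma twisted_scale_0_left: "twisted_scale 0 (m :: 'a poly ^ 2) = 0"
  by (simp add: twisted_scale_def vec_eq_iff)

lemma twisted_scale_1_left: "twisted_scale 1 (m :: 'a poly ^ 2) = m"
  by (simp add: twisted_scale_def vec_eq_iff)

lemma motive_scale_T: "motive_scale \<theta> A [:0, 1:] (m :: 'a poly ^ 2) = motive_T \<theta> A m"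
  using twisted_scale_1_left by (simp add: motive_scale_def twisted_scale_0_left one_pCons)

lemma motive_T_axis:
  "motive_T \<theta> A (axis i 1) = twisted_scale [:\<theta>:] (axis i 1) +
     (\<Sum>j\<in>UNIV. twisted_scale [:A $ i $ j:] (motive_tau (axis j 1))) + motive_tau (motive_tau (axis i (1 :: 'a poly)))"
  using exhaust_2[of i]
  by (auto simp: vec_eq_iff forall_2 motive_T_def motive_tau_def twisted_scale_def T_matrix_def mat_def
      axis_def sum_2 twisted_mult_const twisted_mult_tau)

text \<open>The span of the four basis vectors over ordinary polynomials in \<open>T\<close>. Once
  \<open>generated_UNIV\<close> shows that it is everything, its induction rule replaces induction
  on the degree in \<open>\<tau>\<close> and fits a tensor product over these polynomials.\<close>

inductive_set generated :: "'a \<Rightarrow> 'a^2^2 \<Rightarrow> ('a poly ^ 2) set" for \<theta> A where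
  axis: "axis i 1 \<in> generated \<theta> A"
| tau_axis: "motive_tau (axis i 1) \<in> generated \<theta> A"
| add: "m \<in> generated \<theta> A \<Longrightarrow> m' \<in> generated \<theta> A \<Longrightarrow> m + m' \<in> generated \<theta> A"
| scale: "m \<in> generated \<theta> A \<Longrightarrow> motive_scale \<theta> A p m \<in> generated \<theta> A"

lemma generated_0: "0 \<in> generated \<theta> A"
  using generated.scale[OF generated.axis, of \<theta> A 0] by (simp add: motive_scale_0)

lemma generated_sum: "(\<And>i. i \<in> I \<Longrightarrow> f i \<in> generated \<theta> A) \<Longrightarrow> sum f I \<in> generated \<theta> A"
  by (induction I rule: infinite_finite_induct) (auto intro: generated_0 generated.add)

lemma add_self_vec: "(m :: 'a poly ^ 2) + m = 0"
  using uminus_CHAR_2[where 'a = "'a poly"] char_2 by (simp add: vec_eq_iff eq_neg_iff_add_eq_0[symmetric])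

lemma generated_tau: "m \<in> generated \<theta> A \<Longrightarrow> motive_tau m \<in> generated \<theta> A"
proof (induction rule: generated.induct)
  case (tau_axis i)
  define b :: "'a poly ^ 2" where "b = twisted_scale [:\<theta>:] (axis i 1) +
    (\<Sum>j\<in>UNIV. twisted_scale [:A $ i $ j:] (motive_tau (axis j 1)))"
  define t :: "'a poly ^ 2" where "t = motive_tau (motive_tau (axis i 1))"
  have "motive_T \<theta> A (axis i 1) = b + t"
    by (simp only: motive_T_axis b_def t_def)
  \<comment> \<open>The relation for \<open>T e\<^sub>i\<close> solved for
    \<open>\<tau>^2 e\<^sub>i\<close>, which is possible because its coefficient there is
    \<open>1\<close>.\<close>
  then have "t = motive_T \<theta> A (axis i 1) + b"
    using add_self_vec[of b] by (simp add: ac_simps)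
  also have "\<dots> \<in> generated \<theta> A"
    unfolding b_def motive_scale_const[symmetric, of _ _ \<theta> A] motive_scale_T[symmetric]
    by (intro generated.add generated_sum generated.scale generated.axis generated.tau_axis)
  finally show ?case
    by (simp only: t_def)
next
  case (add m m')
  then show ?case by (simp add: motive_tau_def twisted_scale_add_right generated.add)
next
  case (scale m p)
  then show ?case by (simp add: motive_tau_motive_scale generated.scale)
qed (auto intro: generated.tau_axis)

lemma generated_UNIV: "m \<in> generated \<theta> A"
proof -
  have "axis j f \<in> generated \<theta> A" for j and f :: "'a poly"
  proof (induction f rule: poly_monom_add_induct)
    case (monom c i)
    have "axis j (monom 1 i) \<in> generated \<theta> A"
    proof (induction i)
      case 0
      then show ?case using generated.axis by simp
    next
      case (Suc i)
      have "twisted_mult [:0, 1 :: 'a:] (monom 1 i) = monom 1 (Suc i)"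
        using twisted_mult_monom[of "1 :: 'a" 1 1 i] by (simp add: monom_0 monom_Suc numeral_2_eq_2 one_pCons)
      then have "motive_tau (axis j (monom 1 i)) = axis j (monom 1 (Suc i) :: 'a poly)"
        by (simp add: motive_tau_def twisted_scale_def vec_eq_iff axis_def)
      with generated_tau[OF Suc] show ?case by simp
    qed
    moreover have "twisted_mult [:c:] (monom 1 i) = monom c i"
      using twisted_mult_monom[of c 0 1 i] by (simp add: monom_0 monom_Suc numeral_2_eq_2 one_pCons)
    then have "twisted_scale [:c:] (axis j (monom 1 i)) = axis j (monom c i)"
      by (simp add: twisted_scale_def vec_eq_iff axis_def)
    ultimately show ?case
      using generated.scale[of _ \<theta> A "[:c:]"] by (metis motive_scale_const)
  next
    case (add f g)
    have "axis j (f + g) = axis j f + axis j g"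
      by (simp add: vec_eq_iff axis_def)
    with add show ?case by (simp add: generated.add)
  qed
  then have "(\<Sum>j\<in>UNIV. axis j (m $ j)) \<in> generated \<theta> A"
    by (intro generated_sum)
  also have "(\<Sum>j\<in>UNIV. axis j (m $ j)) = m"
    by (simp add: vec_eq_iff axis_def)
  finally show ?thesis .
qed

end

section \<open>Coordinates on the t-motive\<close>

text \<open>A pair \<open>(x, y)\<close> stands for the element with coordinates \<open>x\<close> in the basis \<open>e\<^sub>1, e\<^sub>2\<close>
  and \<open>y\<close> in the basis \<open>\<tau> e\<^sub>1, \<tau> e\<^sub>2\<close>.\<close>

definition pair_scale :: "'a::field fps \<Rightarrow> ('a fps ^ 2) \<times> ('a fps ^ 2) \<Rightarrow> ('a fps ^ 2) \<times> ('a fps ^ 2)" where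
  "pair_scale f z = (\<chi> j. f * fst z $ j, \<chi> j. f * snd z $ j)"

text \<open>Read off from \<open>\<tau>^2 e\<^sub>i = (T - \<theta>) e\<^sub>i - \<Sum>\<^sub>j
  A\<^sub>i\<^sub>j \<tau> e\<^sub>j\<close>: coordinates at \<open>e\<^sub>j\<close> move to
  \<open>\<tau> e\<^sub>j\<close>, and those at \<open>\<tau> e\<^sub>i\<close> are expanded by this
  relation. The sign of \<open>A\<close> disappears in characteristic 2.\<close>

definition pair_tau :: "'a::field \<Rightarrow> 'a^2^2 \<Rightarrow> ('a fps ^ 2) \<times> ('a fps ^ 2) \<Rightarrow> ('a fps ^ 2) \<times> ('a fps ^ 2)" where
  "pair_tau \<theta> A z = (\<chi> j. (fps_X - fps_const \<theta>) * tate_tau (snd z $ j),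
     \<chi> j. tate_tau (fst z $ j) + (\<Sum>i\<in>UNIV. tate_tau (snd z $ i) * fps_const (A $ i $ j)))"

definition twisted_act :: "'a::field \<Rightarrow> 'a^2^2 \<Rightarrow> 'a poly \<Rightarrow> ('a fps ^ 2) \<times> ('a fps ^ 2) \<Rightarrow> ('a fps ^ 2) \<times> ('a fps ^ 2)" where
  "twisted_act \<theta> A f z =
     (\<Sum>k\<le>degree f. pair_scale (fps_const (coeff f k)) ((pair_tau \<theta> A ^^ k) z))"

text \<open>High powers of \<open>\<tau>\<close> need no explicit reduction:
  \<open>m\<^sub>j\<close> acts on the coordinates of \<open>e\<^sub>j\<close>, with
  \<open>\<tau>\<close> acting as \<open>pair_tau\<close>.\<close>

definition motive_coords :: "'a::field \<Rightarrow> 'a^2^2 \<Rightarrow> 'a poly ^ 2 \<Rightarrow> ('a fps ^ 2) \<times> ('a fps ^ 2)" where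
  "motive_coords \<theta> A m = (\<Sum>j\<in>UNIV. twisted_act \<theta> A (m $ j) (axis j 1, 0))"

lemma pair_scale_add_right: "pair_scale f (z + w) = pair_scale f z + pair_scale f w"
  by (simp add: pair_scale_def plus_prod_def vec_eq_iff ring_distribs)

lemma pair_scale_diff_right: "pair_scale f (z - w) = pair_scale f z - pair_scale f w"
  by (simp add: pair_scale_def minus_prod_def vec_eq_iff ring_distribs)

lemma pair_scale_add_left: "pair_scale (f + g) z = pair_scale f z + pair_scale g z"
  by (simp add: pair_scale_def plus_prod_def vec_eq_iff ring_distribs)

lemma pair_scale_0_left [simp]: "pair_scale 0 z = 0"
  by (simp add: pair_scale_def zero_prod_def vec_eq_iff)

lemma pair_scale_0_right [simp]: "pair_scale f 0 = 0"
  by (simp add: pair_scale_def zero_prod_def vec_eq_iff)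

lemma pair_scale_1_left [simp]: "pair_scale 1 z = z"
  by (simp add: pair_scale_def vec_eq_iff prod_eq_iff)

lemma pair_scale_pair_scale: "pair_scale f (pair_scale g z) = pair_scale (f * g) z"
  by (simp add: pair_scale_def vec_eq_iff mult.assoc)

lemma pair_scale_sum_right: "pair_scale f (\<Sum>i\<in>I. z i) = (\<Sum>i\<in>I. pair_scale f (z i))"
  by (induction I rule: infinite_finite_induct) (simp_all add: pair_scale_add_right)

lemma pair_scale_sum_left: "pair_scale (\<Sum>i\<in>I. f i) z = (\<Sum>i\<in>I. pair_scale (f i) z)"
  by (induction I rule: infinite_finite_induct) (simp_all add: pair_scale_add_left)

lemma tate_tau_0 [simp]: "tate_tau 0 = 0"
  by (simp add: tate_tau_def fps_eq_iff)

lemma tate_tau_const: "tate_tau (fps_const c) = fps_const (c ^ 2)"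
  by (simp add: tate_tau_def fps_eq_iff)

lemma tate_tau_X [simp]: "tate_tau fps_X = fps_X"
  by (simp add: tate_tau_def fps_eq_iff fps_X_def)

lemma twisted_act_bound:
  assumes "degree f \<le> n"
  shows "twisted_act \<theta> A f z = (\<Sum>k\<le>n. pair_scale (fps_const (coeff f k)) ((pair_tau \<theta> A ^^ k) z))"
  unfolding twisted_act_def
  by (rule sum.mono_neutral_left) (use assms in \<open>auto simp: coeff_eq_0\<close>)

lemma twisted_act_0_left [simp]: "twisted_act \<theta> A 0 z = 0"
  by (simp add: twisted_act_def)

lemma twisted_act_add_left: "twisted_act \<theta> A (f + g) z = twisted_act \<theta> A f z + twisted_act \<theta> A g z"
proof -
  let ?n = "max (degree f) (degree g)"
  have "degree (f + g) \<le> ?n" by (rule degree_add_le_max)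
  then show ?thesis
    by (simp add: twisted_act_bound[of _ ?n] sum.distrib pair_scale_add_left flip: fps_const_add)
qed

lemma twisted_act_sum_left: "twisted_act \<theta> A (\<Sum>i\<in>I. f i) z = (\<Sum>i\<in>I. twisted_act \<theta> A (f i) z)"
  by (induction I rule: infinite_finite_induct) (simp_all add: twisted_act_add_left)

lemma twisted_act_monom: "twisted_act \<theta> A (monom c k) z = pair_scale (fps_const c) ((pair_tau \<theta> A ^^ k) z)"
proof -
  have "twisted_act \<theta> A (monom c k) z =
      (\<Sum>i\<le>k. if i = k then pair_scale (fps_const c) ((pair_tau \<theta> A ^^ k) z) else 0)"
    unfolding twisted_act_bound[OF degree_monom_le] by (rule sum.cong) auto
  then show ?thesis by simp
qed

context
  assumes char_2: "CHAR('a::field) = 2"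
begin

lemma square_add_char_2: "(x + y) ^ 2 = x ^ 2 + (y :: 'a) ^ 2"
  using power2_add_char_2[OF char_2, of x y 1] by simp

lemma tate_tau_add: "tate_tau (f + g) = tate_tau f + tate_tau (g :: 'a fps)"
  by (simp add: tate_tau_def fps_eq_iff square_add_char_2)

lemma tate_tau_mult: "tate_tau (f * g) = tate_tau f * tate_tau (g :: 'a fps)"
proof (rule fps_ext)
  fix n
  have "(\<Sum>i=0..n. fps_nth f i * fps_nth g (n - i)) ^ 2 = (\<Sum>i=0..n. (fps_nth f i * fps_nth g (n - i)) ^ 2)"
    by (rule freshmans_dream_sum) (simp_all add: char_2)
  then show "fps_nth (tate_tau (f * g)) n = fps_nth (tate_tau f * tate_tau g) n"
    by (simp add: tate_tau_def fps_mult_nth power_mult_distrib)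
qed

lemma pair_tau_add: "pair_tau \<theta> A (z + w) = pair_tau \<theta> A z + pair_tau \<theta> A (w :: ('a fps ^ 2) \<times> ('a fps ^ 2))"
  by (simp add: pair_tau_def plus_prod_def vec_eq_iff tate_tau_add ring_distribs sum.distrib ac_simps)

lemma pair_tau_scale:
  "pair_tau \<theta> A (pair_scale f z) = pair_scale (tate_tau f) (pair_tau \<theta> A (z :: ('a fps ^ 2) \<times> ('a fps ^ 2)))"
  by (simp add: pair_tau_def pair_scale_def vec_eq_iff tate_tau_mult ring_distribs sum_distrib_left ac_simps)

lemma pair_tau_funpow_add:
  "(pair_tau \<theta> A ^^ k) (z + w) = (pair_tau \<theta> A ^^ k) z + (pair_tau \<theta> A ^^ k) (w :: ('a fps ^ 2) \<times> ('a fps ^ 2))"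
  by (induction k) (simp_all add: pair_tau_add)

lemma pair_tau_0: "pair_tau \<theta> A (0 :: ('a fps ^ 2) \<times> ('a fps ^ 2)) = 0"
  by (simp add: pair_tau_def vec_eq_iff zero_prod_def)

lemma pair_tau_funpow_0: "(pair_tau \<theta> A ^^ k) (0 :: ('a fps ^ 2) \<times> ('a fps ^ 2)) = 0"
  by (induction k) (simp_all add: pair_tau_0)

lemma pair_tau_funpow_sum:
  "(pair_tau \<theta> A ^^ k) (\<Sum>i\<in>I. f i) = (\<Sum>i\<in>I. (pair_tau \<theta> A ^^ k) (f i :: ('a fps ^ 2) \<times> ('a fps ^ 2)))"
  by (induction I rule: infinite_finite_induct) (simp_all add: pair_tau_funpow_add pair_tau_funpow_0)

lemma pair_tau_funpow_scale_const:
  "(pair_tau \<theta> A ^^ k) (pair_scale (fps_const c) z) =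
    pair_scale (fps_const (c ^ 2 ^ k)) ((pair_tau \<theta> A ^^ k) (z :: ('a fps ^ 2) \<times> ('a fps ^ 2)))"
  by (induction k) (simp_all add: pair_tau_scale tate_tau_const mult.commute flip: power_mult)

lemma pair_tau_funpow_scale_X:
  "(pair_tau \<theta> A ^^ k) (pair_scale fps_X z) = pair_scale fps_X ((pair_tau \<theta> A ^^ k) (z :: ('a fps ^ 2) \<times> ('a fps ^ 2)))"
  by (induction k) (simp_all add: pair_tau_scale)

lemma twisted_act_sum_right:
  "twisted_act \<theta> A f (\<Sum>i\<in>I. z i) = (\<Sum>i\<in>I. twisted_act \<theta> A f (z i :: ('a fps ^ 2) \<times> ('a fps ^ 2)))"
  unfolding twisted_act_def pair_tau_funpow_sum pair_scale_sum_right by (rule sum.swap)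

lemma twisted_act_scale_X:
  "twisted_act \<theta> A f (pair_scale fps_X z) = pair_scale fps_X (twisted_act \<theta> A f (z :: ('a fps ^ 2) \<times> ('a fps ^ 2)))"
  by (simp add: twisted_act_def pair_tau_funpow_scale_X pair_scale_sum_right pair_scale_pair_scale mult.commute)

lemma twisted_act_twisted_mult:
  "twisted_act \<theta> A (twisted_mult f g) z = twisted_act \<theta> A f (twisted_act \<theta> A g (z :: ('a fps ^ 2) \<times> ('a fps ^ 2)))"
  unfolding twisted_mult_def twisted_act_sum_left twisted_act_monom
  unfolding twisted_act_def pair_tau_funpow_sum pair_scale_sum_right pair_tau_funpow_scale_const pair_scale_pair_scale
  by (simp add: funpow_add)

lemma motive_coords_add: "motive_coords \<theta> A (m + m') = motive_coords \<theta> A m + motive_coords \<theta> A (m' :: 'a poly ^ 2)"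
  by (simp add: motive_coords_def twisted_act_add_left sum.distrib)

lemma motive_coords_twisted_scale:
  "motive_coords \<theta> A (twisted_scale f m) = twisted_act \<theta> A f (motive_coords \<theta> A (m :: 'a poly ^ 2))"
  by (simp add: motive_coords_def twisted_scale_def twisted_act_twisted_mult twisted_act_sum_right)

lemma motive_coords_const:
  "motive_coords \<theta> A (twisted_scale [:c:] m) = pair_scale (fps_const c) (motive_coords \<theta> A (m :: 'a poly ^ 2))"
  by (simp add: motive_coords_twisted_scale twisted_act_def)

lemma motive_coords_tau: "motive_coords \<theta> A (motive_tau m) = pair_tau \<theta> A (motive_coords \<theta> A (m :: 'a poly ^ 2))"
  by (simp add: motive_coords_twisted_scale motive_tau_def twisted_act_def)

lemma motive_coords_axis: "motive_coords \<theta> A (axis i 1) = (axis i 1, 0 :: 'a fps ^ 2)"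
  using exhaust_2[of i] by (auto simp: motive_coords_def sum_2 axis_def twisted_act_def)

text \<open>Coordinates respect the relation defining \<open>T\<close>: the term
  \<open>\<theta>\<close> cancels against the \<open>- \<theta>\<close> in \<open>pair_tau\<close>,
  the terms with \<open>A\<close> occur twice and vanish, and \<open>T e\<^sub>i\<close>
  remains.\<close>

lemma twisted_act_T_matrix:
  "(\<Sum>j\<in>UNIV. twisted_act \<theta> A (T_matrix \<theta> A $ i $ j) (axis j 1, 0)) = pair_scale fps_X (axis i 1, 0 :: 'a fps ^ 2)"
proof -
  have two: "(2 :: 'a) = 0"
    using of_nat_CHAR[where 'a = 'a] char_2 by simp
  have one: "tate_tau 1 = (1 :: 'a fps)"
    using tate_tau_const[of 1] by simp
  have quad: "[:a, b, c:] = monom a 0 + monom b 1 + monom c 2" for a b c :: 'a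
    by (simp add: monom_0 monom_Suc numeral_2_eq_2 one_pCons)
  have "pair_tau \<theta> A (axis j 1, 0) = (0, axis j (1 :: 'a fps))" for j
    using exhaust_2[of j] by (auto simp: pair_tau_def vec_eq_iff forall_2 axis_def one)
  moreover have "pair_tau \<theta> A (0, axis j (1 :: 'a fps)) =
      (axis j (fps_X - fps_const \<theta>), \<chi> k. fps_const (A $ j $ k))" for j
    using exhaust_2[of j] by (auto simp: pair_tau_def vec_eq_iff forall_2 axis_def one sum_2)
  ultimately have "twisted_act \<theta> A (T_matrix \<theta> A $ i $ j) (axis j 1, 0) =
      pair_scale (fps_const (mat \<theta> $ i $ j)) (axis j 1, 0) +
      pair_scale (fps_const (A $ i $ j)) (0, axis j 1) +
      pair_scale (fps_const (mat 1 $ i $ j)) (axis j (fps_X - fps_const \<theta>), \<chi> k. fps_const (A $ j $ k))" for j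
    by (simp add: T_matrix_def quad twisted_act_add_left twisted_act_monom numeral_2_eq_2)
  then show ?thesis
    using exhaust_2[of i]
    by (auto simp: sum_2 pair_scale_def vec_eq_iff forall_2 axis_def mat_def two)
qed

lemma motive_coords_T: "motive_coords \<theta> A (motive_T \<theta> A m) = pair_scale fps_X (motive_coords \<theta> A (m :: 'a poly ^ 2))"
proof -
  have "motive_coords \<theta> A (motive_T \<theta> A m) =
      (\<Sum>j\<in>UNIV. \<Sum>i\<in>UNIV. twisted_act \<theta> A (m $ i) (twisted_act \<theta> A (T_matrix \<theta> A $ i $ j) (axis j 1, 0)))"
    by (simp only: motive_coords_def motive_T_def vec_lambda_beta twisted_act_sum_left twisted_act_twisted_mult)
  also have "\<dots> = (\<Sum>i\<in>UNIV. twisted_act \<theta> A (m $ i)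
      (\<Sum>j\<in>UNIV. twisted_act \<theta> A (T_matrix \<theta> A $ i $ j) (axis j 1, 0)))"
    unfolding twisted_act_sum_right by (rule sum.swap)
  also have "\<dots> = pair_scale fps_X (motive_coords \<theta> A m)"
    unfolding twisted_act_T_matrix twisted_act_scale_X motive_coords_def pair_scale_sum_right ..
  finally show ?thesis .
qed

lemma motive_coords_motive_scale:
  "motive_coords \<theta> A (motive_scale \<theta> A p m) = pair_scale (fps_of_poly p) (motive_coords \<theta> A (m :: 'a poly ^ 2))"
proof -
  have T: "motive_coords \<theta> A ((motive_T \<theta> A ^^ i) m) = pair_scale (fps_X ^ i) (motive_coords \<theta> A m)" for i
    by (induction i) (simp_all add: motive_coords_T pair_scale_pair_scale)
  have sum: "motive_coords \<theta> A (\<Sum>i\<in>I. f i) = (\<Sum>i\<in>I. motive_coords \<theta> A (f i :: 'a poly ^ 2))" for f and I :: "nat set"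
    by (induction I rule: infinite_finite_induct)
       (simp_all add: motive_coords_add, simp_all add: motive_coords_def)
  have "fps_of_poly p = (\<Sum>i\<le>degree p. fps_const (coeff p i) * fps_X ^ i)"
    by (rule fps_ext) (auto simp: fps_sum_nth fps_X_power_nth coeff_eq_0 if_distrib cong: if_cong)
  then show ?thesis
    by (simp add: motive_scale_def sum motive_coords_const T pair_scale_pair_scale pair_scale_sum_left)
qed

end

section \<open>The t-motive over the Tate algebra\<close>

definition tate_pairs :: "('a::field \<Rightarrow> ereal) \<Rightarrow> (('a fps ^ 2) \<times> ('a fps ^ 2)) set" where
  "tate_pairs ord = {z. \<forall>j. fst z $ j \<in> tate_algebra ord \<and> snd z $ j \<in> tate_algebra ord}"

definition motive_lift :: "'a::field \<Rightarrow> 'a^2^2 \<Rightarrow> (('a poly ^ 2) \<times> 'a fps \<Rightarrow>\<^sub>0 int) \<Rightarrow> ('a fps ^ 2) \<times> ('a fps ^ 2)" where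
  "motive_lift \<theta> A = (SOME l. (\<forall>x y. l (x + y) = l x + l y) \<and>
     (\<forall>m n. l (frag_of (m, n)) = pair_scale n (motive_coords \<theta> A m)))"

definition motive_rep :: "('a::field fps ^ 2) \<times> ('a fps ^ 2) \<Rightarrow> (('a poly ^ 2) \<times> 'a fps \<Rightarrow>\<^sub>0 int)" where
  "motive_rep z = (\<Sum>j\<in>UNIV. frag_of (axis j 1, fst z $ j)) + (\<Sum>j\<in>UNIV. frag_of (motive_tau (axis j 1), snd z $ j))"

lemma motive_lift:
  shows motive_lift_add: "motive_lift \<theta> A (x + y) = motive_lift \<theta> A x + motive_lift \<theta> A y"
    and motive_lift_frag_of: "motive_lift \<theta> A (frag_of (m, n)) = pair_scale n (motive_coords \<theta> A m)"
proof -
  obtain l :: "(('a poly ^ 2) \<times> 'a fps \<Rightarrow>\<^sub>0 int) \<Rightarrow> ('a fps ^ 2) \<times> ('a fps ^ 2)"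
    where "\<And>x y. l (x + y) = l x + l y" "\<And>b. l (frag_of b) = (case b of (m, n) \<Rightarrow> pair_scale n (motive_coords \<theta> A m))"
    by (rule frag_lift_exists[of "\<lambda>(m, n). pair_scale n (motive_coords \<theta> A m)"]) blast
  then have "\<exists>l. (\<forall>x y. l (x + y) = l x + l y) \<and>
      (\<forall>m n. l (frag_of (m, n)) = pair_scale n (motive_coords \<theta> A m))"
    by (intro exI[of _ l]) simp
  from someI_ex[OF this] show "motive_lift \<theta> A (x + y) = motive_lift \<theta> A x + motive_lift \<theta> A y"
    "motive_lift \<theta> A (frag_of (m, n)) = pair_scale n (motive_coords \<theta> A m)"
    unfolding motive_lift_def by blast+
qed

text \<open>The relator for the sum \<open>0 + 0\<close> is literally the negative of
  \<open>frag_of (m, 0)\<close>, whence the sign.\<close>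

lemma frag_of_zero_right_in_tensor_null:
  assumes "m \<in> V" "0 \<in> W"
  shows "- frag_of (m, 0) \<in> tensor_null sV sW V W"
proof -
  have "frag_of (m, 0 + 0) - frag_of (m, 0) - frag_of (m, 0) \<in> tensor_relators sV sW V W"
    unfolding tensor_relators_def using assms by blast
  then show ?thesis
    unfolding tensor_null_def by (intro generate.incl) simp
qed

context C_infinity
begin

lemma tate_algebra_iff: "f \<in> tate_algebra ord \<longleftrightarrow> (\<lambda>i. absval (fps_nth f i)) \<longlonglongrightarrow> 0"
  by (simp add: tate_algebra_def absval_tendsto_0_iff)

lemma tendsto_0_le: "(\<And>n. 0 \<le> f n \<and> f n \<le> (g n :: real)) \<Longrightarrow> g \<longlonglongrightarrow> 0 \<Longrightarrow> f \<longlonglongrightarrow> 0"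
  by (rule Lim_null_comparison[where g = g]) (auto intro: always_eventually)

lemma tate_algebra_0: "0 \<in> tate_algebra ord"
  by (simp add: tate_algebra_iff)

lemma tate_algebra_add:
  assumes "f \<in> tate_algebra ord" "g \<in> tate_algebra ord"
  shows "f + g \<in> tate_algebra ord"
  unfolding tate_algebra_iff
proof (rule tendsto_0_le)
  show "(\<lambda>i. max (absval (fps_nth f i)) (absval (fps_nth g i))) \<longlonglongrightarrow> 0"
    using assms tendsto_max[of "\<lambda>i. absval (fps_nth f i)" 0 sequentially "\<lambda>i. absval (fps_nth g i)" 0]
    by (simp add: tate_algebra_iff)
qed (simp add: absval_nonneg absval_add)

lemma tate_algebra_const_mult:
  assumes "f \<in> tate_algebra ord"
  shows "fps_const c * f \<in> tate_algebra ord"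
  using assms tendsto_mult_right_zero[of "\<lambda>i. absval (fps_nth f i)" sequentially "absval c"]
  by (simp add: tate_algebra_iff absval_mult)

lemma tate_algebra_diff: "f \<in> tate_algebra ord \<Longrightarrow> g \<in> tate_algebra ord \<Longrightarrow> f - g \<in> tate_algebra ord"
  using tate_algebra_add[of f "- g"] by (simp add: tate_algebra_iff)

lemma tate_algebra_X_mult:
  assumes "f \<in> tate_algebra ord"
  shows "fps_X * f \<in> tate_algebra ord"
  unfolding tate_algebra_iff
proof (rule LIMSEQ_imp_Suc)
  show "(\<lambda>i. absval (fps_nth (fps_X * f) (Suc i))) \<longlonglongrightarrow> 0"
    using assms by (simp add: tate_algebra_iff)
qed

lemma tate_algebra_scale:
  assumes "f \<in> tate_algebra ord"
  shows "tate_scale p f \<in> tate_algebra ord"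
proof (induction p)
  case 0
  then show ?case by (simp add: tate_scale_def tate_algebra_0)
next
  case (pCons a p)
  have "fps_const a * f + fps_X * tate_scale p f \<in> tate_algebra ord"
    by (intro tate_algebra_add tate_algebra_const_mult tate_algebra_X_mult assms pCons)
  then show ?case
    by (simp add: tate_scale_def fps_of_poly_pCons algebra_simps)
qed

lemma tate_algebra_tau:
  assumes "f \<in> tate_algebra ord"
  shows "tate_tau f \<in> tate_algebra ord"
proof -
  have "(\<lambda>i. absval (fps_nth f i) ^ 2) \<longlonglongrightarrow> 0 ^ 2"
    using assms unfolding tate_algebra_iff by (rule tendsto_power)
  then show ?thesis
    by (simp add: tate_algebra_iff tate_tau_def absval_power)
qed

lemma tate_algebra_sum: "(\<And>i. i \<in> I \<Longrightarrow> f i \<in> tate_algebra ord) \<Longrightarrow> sum f I \<in> tate_algebra ord"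
  by (induction I rule: infinite_finite_induct) (simp_all add: tate_algebra_0 tate_algebra_add)

lemma tate_pairs_0: "0 \<in> tate_pairs ord"
  by (simp add: tate_pairs_def tate_algebra_0)

lemma tate_pairs_add: "z \<in> tate_pairs ord \<Longrightarrow> w \<in> tate_pairs ord \<Longrightarrow> z + w \<in> tate_pairs ord"
  by (simp add: tate_pairs_def tate_algebra_add)

lemma tate_pairs_diff: "z \<in> tate_pairs ord \<Longrightarrow> w \<in> tate_pairs ord \<Longrightarrow> z - w \<in> tate_pairs ord"
  by (simp add: tate_pairs_def tate_algebra_diff)

lemma tate_pairs_scale: "z \<in> tate_pairs ord \<Longrightarrow> pair_scale (fps_of_poly p) z \<in> tate_pairs ord"
  using tate_algebra_scale by (simp add: tate_pairs_def pair_scale_def tate_scale_def)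

lemma tate_pairs_tau:
  assumes "z \<in> tate_pairs ord"
  shows "pair_tau \<theta> A z \<in> tate_pairs ord"
  using assms
  by (auto simp: tate_pairs_def pair_tau_def left_diff_distrib mult.commute[of _ "fps_const _"]
      intro!: tate_algebra_add tate_algebra_diff tate_algebra_sum tate_algebra_tau
        tate_algebra_X_mult tate_algebra_const_mult)

lemma motive_coords_tau_axis: "motive_coords \<theta> A (motive_tau (axis i 1)) = (0, axis i 1)"
proof -
  have "tate_tau 1 = (1 :: 'a fps)"
    using tate_tau_const[of 1] by simp
  then show ?thesis
    using exhaust_2[of i] unfolding motive_coords_tau[OF char_2] motive_coords_axis[OF char_2]
    by (auto simp: pair_tau_def vec_eq_iff forall_2 axis_def)
qed

lemma coords_in_tate_pairs:
  assumes "n \<in> tate_algebra ord"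
  shows "pair_scale n (motive_coords \<theta> A m) \<in> tate_pairs ord"
proof -
  have 0: "pair_scale n (motive_coords \<theta> A (axis i 1)) \<in> tate_pairs ord" for i
    using assms unfolding motive_coords_axis[OF char_2]
    by (auto simp: tate_pairs_def pair_scale_def axis_def tate_algebra_0)
  have "m \<in> generated \<theta> A"
    by (rule generated_UNIV[OF char_2])
  then show ?thesis
  proof (induction rule: generated.induct[OF char_2, consumes 1, case_names axis tau_axis add scale])
    case (axis i)
    show ?case by (rule 0)
  next
    case (tau_axis i)
    show ?case
      using assms unfolding motive_coords_tau_axis
      by (auto simp: tate_pairs_def pair_scale_def axis_def tate_algebra_0)
  next
    case (add m m')
    then show ?case by (simp add: motive_coords_add[OF char_2] pair_scale_add_right tate_pairs_add)
  next
    case (scale m p)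
    have "pair_scale n (motive_coords \<theta> A (motive_scale \<theta> A p m)) =
        pair_scale (fps_of_poly p) (pair_scale n (motive_coords \<theta> A m))"
      by (simp add: motive_coords_motive_scale[OF char_2] pair_scale_pair_scale mult.commute)
    with scale show ?case by (simp add: tate_pairs_scale)
  qed
qed

text \<open>Base change of a free module. Independence of the four basis vectors is the fact that
  \<open>motive_rep\<close> is a section of the lift; spanning means that every
  \<open>m \<otimes> n\<close> agrees with the representative of its coordinates, which follows the
  generation of \<open>m\<close>.\<close>

lemma tensor_coordinates_motive:
  "tensor_coordinates (motive_scale \<theta> A) tate_scale UNIV (tate_algebra ord)
     (motive_lift \<theta> A) motive_rep (tate_pairs ord)"
proof
  let ?R = "tensor_relators (motive_scale \<theta> A) tate_scale UNIV (tate_algebra ord)"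
  let ?N = "tensor_null (motive_scale \<theta> A) tate_scale UNIV (tate_algebra ord)"
  let ?FA = "free_Abelian_group ((UNIV :: ('a poly ^ 2) set) \<times> tate_algebra ord)"
  let ?l = "motive_lift \<theta> A"
  have l_diff: "?l (x - y) = ?l x - ?l y" for x y
    using motive_lift_add[of \<theta> A "x - y" y] by (simp add: algebra_simps)
  have l_sum: "?l (\<Sum>j\<in>UNIV. f j) = (\<Sum>j\<in>UNIV. ?l (f j))" for f :: "2 \<Rightarrow> _"
    by (simp add: sum_2 motive_lift_add)
  have off_diag: "axis (1 :: 2) n $ 2 = 0" "axis (2 :: 2) n $ 1 = 0" for n :: "'a fps"
    by (simp_all add: axis_def)
  show R: "?R \<subseteq> carrier ?FA"
  proof
    fix x assume "x \<in> ?R"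
    then have "Poly_Mapping.keys x \<subseteq> UNIV \<times> tate_algebra ord"
      unfolding tensor_relators_def
      by (elim UnE CollectE exE conjE) (simp_all add: keys_diff_subset tate_algebra_add tate_algebra_scale)
    then show "x \<in> carrier ?FA"
      by simp
  qed
  show "?l (x + y) = ?l x + ?l y" for x y
    by (rule motive_lift_add)
  show "?l x = 0" if "x \<in> ?R" for x
    using that unfolding tensor_relators_def
    by (auto simp: l_diff motive_lift_frag_of motive_coords_add[OF char_2] pair_scale_add_right
        pair_scale_add_left motive_coords_motive_scale[OF char_2] pair_scale_pair_scale tate_scale_def mult.commute)
  show "?l (frag_of (m, n)) \<in> tate_pairs ord" if "n \<in> tate_algebra ord" for m n
    using that by (simp add: motive_lift_frag_of coords_in_tate_pairs)
  show "0 \<in> tate_pairs ord"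
    by (rule tate_pairs_0)
  show "z - w \<in> tate_pairs ord" if "z \<in> tate_pairs ord" "w \<in> tate_pairs ord" for z w
    using that by (rule tate_pairs_diff)
  show "motive_rep z \<in> carrier ?FA" if "z \<in> tate_pairs ord" for z
    using that by (simp add: motive_rep_def sum_2 tate_pairs_def keys_add_subset)
  show "?l (motive_rep z) = z" if "z \<in> tate_pairs ord" for z
    by (simp add: motive_rep_def l_sum motive_lift_add motive_lift_frag_of motive_coords_tau_axis
        motive_coords_axis[OF char_2] pair_scale_def sum_2 prod_eq_iff vec_eq_iff forall_2 off_diag)
  have sub: "subgroup ?N ?FA"
    unfolding tensor_null_def by (rule group.generate_is_subgroup[OF group_free_Abelian_group R])
  have N_add: "x + y \<in> ?N" if "x \<in> ?N" "y \<in> ?N" for x y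
    using subgroup.m_closed[OF sub that] by simp
  have N_minus: "- x \<in> ?N" if "x \<in> ?N" for x
    using subgroup.m_inv_closed[OF sub that] subgroup.mem_carrier[OF sub that] by simp
  have N_incl: "x \<in> ?R \<Longrightarrow> x \<in> ?N" for x
    unfolding tensor_null_def by (rule generate.incl)
  have N_add_left: "frag_of (m + m', n) - frag_of (m, n) - frag_of (m', n) \<in> ?N"
    if "n \<in> tate_algebra ord" for m m' n
    using that by (intro N_incl) (auto simp: tensor_relators_def)
  have N_add_right: "frag_of (m, n + n') - frag_of (m, n) - frag_of (m, n') \<in> ?N"
    if "n \<in> tate_algebra ord" "n' \<in> tate_algebra ord" for m n n'
    using that unfolding tensor_relators_def by (intro N_incl) (auto simp: tensor_relators_def)
  have N_scale: "frag_of (motive_scale \<theta> A r m, n) - frag_of (m, tate_scale r n) \<in> ?N"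
    if "n \<in> tate_algebra ord" for r m n
    using that by (intro N_incl) (auto simp: tensor_relators_def)
  have N_zero: "- frag_of (m, 0) \<in> ?N" for m
    by (rule frag_of_zero_right_in_tensor_null) (simp_all add: tate_algebra_0)
  have N_diff: "frag_of (m, n - n') - (frag_of (m, n) - frag_of (m, n')) \<in> ?N"
    if "n \<in> tate_algebra ord" "n' \<in> tate_algebra ord" for m n n'
    using N_minus[OF N_add_right[of "n - n'" n' m]] that tate_algebra_diff[OF that] by (simp add: algebra_simps)
  show E_diff: "motive_rep (z - w) - (motive_rep z - motive_rep w) \<in> ?N"
    if "z \<in> tate_pairs ord" "w \<in> tate_pairs ord" for z w
  proof -
    let ?d = "\<lambda>m n n'. frag_of (m, n - n') - (frag_of (m, n) - frag_of (m, n'))"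
    have "motive_rep (z - w) - (motive_rep z - motive_rep w) =
        (\<Sum>j\<in>UNIV. ?d (axis j 1) (fst z $ j) (fst w $ j)) +
        (\<Sum>j\<in>UNIV. ?d (motive_tau (axis j 1)) (snd z $ j) (snd w $ j))"
      by (simp add: motive_rep_def sum_2)
    also have "\<dots> \<in> ?N"
      using that unfolding sum_2 by (intro N_add N_diff) (auto simp: tate_pairs_def)
    finally show ?thesis .
  qed
  have E_add: "motive_rep (z + w) - (motive_rep z + motive_rep w) \<in> ?N"
    if "z \<in> tate_pairs ord" "w \<in> tate_pairs ord" for z w
    using N_minus[OF E_diff[of "z + w" w]] that tate_pairs_add[OF that] by (simp add: algebra_simps)
  show "frag_of (m, n) - motive_rep (?l (frag_of (m, n))) \<in> ?N" if "n \<in> tate_algebra ord" for m n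
  proof -
    have "m \<in> generated \<theta> A"
      by (rule generated_UNIV[OF char_2])
    then show ?thesis
      using that
    \<comment> \<open>A scalar \<open>p\<close> is moved across the tensor sign, so the hypothesis
      for \<open>m\<close> is needed at \<open>tate_scale p n\<close>.\<close>
    proof (induction arbitrary: n rule: generated.induct[OF char_2, consumes 1, case_names axis tau_axis add scale])
      case (axis i)
      have l: "?l (frag_of (axis i 1, n)) = (axis i n, 0)"
        unfolding motive_lift_frag_of motive_coords_axis[OF char_2]
        by (simp add: pair_scale_def vec_eq_iff axis_def)
      have N: "- frag_of (axis j 1, 0) + (- frag_of (motive_tau (axis 1 1), 0) + - frag_of (motive_tau (axis 2 1), 0)) \<in> ?N" for j
        by (intro N_add N_zero)
      show ?case
        using exhaust_2[of i] N[of 1] N[of 2] by (auto simp: l motive_rep_def sum_2 off_diag algebra_simps)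
    next
      case (tau_axis i)
      have l: "?l (frag_of (motive_tau (axis i 1), n)) = (0, axis i n)"
        unfolding motive_lift_frag_of motive_coords_tau_axis
        by (simp add: pair_scale_def vec_eq_iff axis_def)
      have N: "- frag_of (motive_tau (axis j 1), 0) + (- frag_of (axis 1 1, 0) + - frag_of (axis 2 1, 0)) \<in> ?N" for j
        by (intro N_add N_zero)
      show ?case
        using exhaust_2[of i] N[of 1] N[of 2] by (auto simp: l motive_rep_def sum_2 off_diag algebra_simps)
    next
      case (add m m')
      \<comment> \<open>Four relations that telescope: split the tensor, replace both parts by their
        representatives, and recombine these.\<close>
      have "(frag_of (m + m', n) - frag_of (m, n) - frag_of (m', n)) +
          (frag_of (m, n) - motive_rep (?l (frag_of (m, n)))) +
          (frag_of (m', n) - motive_rep (?l (frag_of (m', n)))) +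
          - (motive_rep (?l (frag_of (m, n)) + ?l (frag_of (m', n))) -
            (motive_rep (?l (frag_of (m, n))) + motive_rep (?l (frag_of (m', n))))) \<in> ?N"
        by (intro N_add N_minus E_add N_add_left add)
           (simp_all add: motive_lift_frag_of coords_in_tate_pairs add)
      moreover have "?l (frag_of (m + m', n)) = ?l (frag_of (m, n)) + ?l (frag_of (m', n))"
        by (simp add: motive_lift_frag_of motive_coords_add[OF char_2] pair_scale_add_right)
      ultimately show ?case
        by (simp add: algebra_simps)
    next
      case (scale m p)
      have "(frag_of (motive_scale \<theta> A p m, n) - frag_of (m, tate_scale p n)) +
          (frag_of (m, tate_scale p n) - motive_rep (?l (frag_of (m, tate_scale p n)))) \<in> ?N"
        by (intro N_add N_scale scale tate_algebra_scale)
      moreover have "?l (frag_of (motive_scale \<theta> A p m, n)) = ?l (frag_of (m, tate_scale p n))"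
        by (simp add: motive_lift_frag_of motive_coords_motive_scale[OF char_2] pair_scale_pair_scale
            tate_scale_def mult.commute)
      ultimately show ?case
        by simp
    qed
  qed
qed

abbreviation motive_class :: "'a^2^2 \<Rightarrow> ('a fps ^ 2) \<times> ('a fps ^ 2) \<Rightarrow> (('a poly ^ 2) \<times> 'a fps \<Rightarrow>\<^sub>0 int) set" where
  "motive_class A \<equiv> tensor_coordinates.coset_of UNIV (tate_algebra ord) (motive_lift \<theta> A)"

definition invariant_pairs :: "'a^2^2 \<Rightarrow> (('a fps ^ 2) \<times> ('a fps ^ 2)) set" where
  "invariant_pairs A = {z \<in> tate_pairs ord. pair_tau \<theta> A z = z}"

lemma inj_on_motive_class: "inj_on (motive_class A) (tate_pairs ord)"
  by (rule inj_onI) (rule tensor_coordinates.coset_of_inj[OF tensor_coordinates_motive])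

lemma tate_motive_tau_class:
  assumes "z \<in> tate_pairs ord"
  shows "tate_motive_tau ord \<theta> A (motive_class A z) = motive_class A (pair_tau \<theta> A z)"
  unfolding tate_motive_tau_def
proof (rule tensor_coordinates.tensor_map_coset_of[OF tensor_coordinates_motive])
  show "pair_tau \<theta> A (z - w) = pair_tau \<theta> A z - pair_tau \<theta> A w" for z w
    using pair_tau_add[OF char_2, of \<theta> A "z - w" w] by (simp add: algebra_simps)
qed (simp_all add: assms tate_algebra_tau motive_lift_frag_of motive_coords_tau[OF char_2] pair_tau_scale[OF char_2])

lemma tate_motive_scale_class:
  assumes "z \<in> tate_pairs ord"
  shows "tate_motive_scale ord \<theta> A p (motive_class A z) = motive_class A (pair_scale (fps_of_poly p) z)"
  unfolding tate_motive_scale_def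
  by (rule tensor_coordinates.tensor_map_coset_of[OF tensor_coordinates_motive])
     (simp_all add: assms pair_scale_diff_right motive_lift_frag_of motive_coords_motive_scale[OF char_2]
       pair_scale_pair_scale mult.commute)

lemma carrier_tate_motive: "carrier (tate_motive ord \<theta> A) = motive_class A ` tate_pairs ord"
  unfolding tate_motive_def by (rule tensor_coordinates.carrier_TP[OF tensor_coordinates_motive])

lemma H1_eq: "H1 ord \<theta> A = motive_class A ` invariant_pairs A"
proof -
  have "motive_class A (pair_tau \<theta> A z) = motive_class A z \<longleftrightarrow> pair_tau \<theta> A z = z" if "z \<in> tate_pairs ord" for z
    using inj_on_eq_iff[OF inj_on_motive_class tate_pairs_tau[OF that] that] .
  then show ?thesis
    by (auto simp: H1_def carrier_tate_motive invariant_pairs_def tate_motive_tau_class)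
qed

lemma finprod_tate_motive:
  assumes "finite I" "\<And>i. i \<in> I \<Longrightarrow> f i \<in> tate_pairs ord" "\<And>i. i \<in> I \<Longrightarrow> C i = motive_class A (f i)"
  shows "(\<Otimes>\<^bsub>tate_motive ord \<theta> A\<^esub>i\<in>I. C i) = motive_class A (\<Sum>i\<in>I. f i)"
proof -
  have "comm_group (tate_motive ord \<theta> A)"
    unfolding tate_motive_def by (rule tensor_coordinates.comm_group_TP[OF tensor_coordinates_motive])
  then interpret comm_group "tate_motive ord \<theta> A" .
  have "(\<Otimes>\<^bsub>tate_motive ord \<theta> A\<^esub>i\<in>I. C i) = (\<Otimes>\<^bsub>tate_motive ord \<theta> A\<^esub>i\<in>I. motive_class A (f i))"
    by (rule finprod_cong') (use assms in \<open>auto simp: carrier_tate_motive\<close>)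
  also have "\<dots> = motive_class A (\<Sum>i\<in>I. f i)"
    unfolding tate_motive_def
    by (rule tensor_coordinates.finprod_TP[OF tensor_coordinates_motive]) (use assms in auto)
  finally show ?thesis .
qed

text \<open>Transfers the notion of basis from cosets to invariant pairs. The coefficients stay
  indexed by cosets, and \<open>inv_into\<close> supplies the unique invariant pair in each.\<close>

lemma is_H1_basis_iff:
  "is_H1_basis ord \<theta> A B \<longleftrightarrow> finite B \<and> B \<subseteq> motive_class A ` invariant_pairs A \<and>
     (\<forall>z\<in>invariant_pairs A. \<exists>!c. c \<in> B \<rightarrow>\<^sub>E polys_over {0, 1} \<and>
       z = (\<Sum>b\<in>B. pair_scale (fps_of_poly (c b)) (inv_into (invariant_pairs A) (motive_class A) b)))"
proof (cases "finite B \<and> B \<subseteq> motive_class A ` invariant_pairs A")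
  case True
  let ?w = "inv_into (invariant_pairs A) (motive_class A)"
  have w: "?w b \<in> invariant_pairs A" "motive_class A (?w b) = b" if "b \<in> B" for b
    using True that by (metis inv_into_into subsetD, metis f_inv_into_f subsetD)
  then have wZ: "?w b \<in> tate_pairs ord" if "b \<in> B" for b
    using that by (auto simp: invariant_pairs_def)
  have "(\<Otimes>\<^bsub>tate_motive ord \<theta> A\<^esub>b\<in>B. tate_motive_scale ord \<theta> A (c b) b) =
      motive_class A (\<Sum>b\<in>B. pair_scale (fps_of_poly (c b)) (?w b))" for c
  proof (rule finprod_tate_motive)
    show "tate_motive_scale ord \<theta> A (c b) b = motive_class A (pair_scale (fps_of_poly (c b)) (?w b))" if "b \<in> B" for b
      using tate_motive_scale_class[OF wZ[OF that], of A "c b"] w(2)[OF that] by simp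
  qed (use True wZ tate_pairs_scale in auto)
  moreover have "(\<Sum>b\<in>B. pair_scale (fps_of_poly (c b)) (?w b)) \<in> tate_pairs ord" for c
    using wZ by (intro tensor_coordinates.sum_in[OF tensor_coordinates_motive] tate_pairs_scale)
  ultimately have "motive_class A z = (\<Otimes>\<^bsub>tate_motive ord \<theta> A\<^esub>b\<in>B. tate_motive_scale ord \<theta> A (c b) b) \<longleftrightarrow>
      z = (\<Sum>b\<in>B. pair_scale (fps_of_poly (c b)) (?w b))" if "z \<in> invariant_pairs A" for z c
    using inj_on_eq_iff[OF inj_on_motive_class, of z] that by (simp add: invariant_pairs_def)
  with True show ?thesis
    unfolding is_H1_basis_def H1_eq by simp
qed (auto simp: is_H1_basis_def H1_eq)

end

section \<open>Discrete modules over \<open>F\<^sub>2[T]\<close>\<close>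

text \<open>The reduction \<open>c0\<close> has kernel \<open>T H\<close>, and the elements of the image \<open>K\<close> lift to \<open>H\<close> with all
  coefficients but the constant one small. Since nonzero elements of \<open>H\<close> have a coefficient that is
  not small, \<open>H\<close> is spanned over polynomials (and not just over power series) by such lifts.\<close>

locale discrete_F2T_module =
  fixes s :: "'a::field poly \<Rightarrow> 'z::ab_group_add \<Rightarrow> 'z" and H :: "'z set"
    and c0 :: "'z \<Rightarrow> 'k::ab_group_add" and K :: "'k set" and small :: "nat \<Rightarrow> 'z \<Rightarrow> bool"
  assumes char_2: "CHAR('a) = 2"
    and s_add_left: "s (p + q) z = s p z + s q z"
    and s_add_right: "s p (z + w) = s p z + s p w"
    and s_mult: "s (p * q) z = s p (s q z)"
    and s_1: "s 1 z = z"
    and T_torsion_free: "s [:0, 1:] z = 0 \<Longrightarrow> z = 0"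
    and H_0: "0 \<in> H"
    and H_add: "z \<in> H \<Longrightarrow> w \<in> H \<Longrightarrow> z + w \<in> H"
    and c0_add: "c0 (z + w) = c0 z + c0 w"
    and c0_T: "c0 (s [:0, 1:] z) = 0"
    and K_char_2: "(k :: 'k) + k = 0"
    and c0_in: "z \<in> H \<Longrightarrow> c0 z \<in> K"
    and c0_kernel: "z \<in> H \<Longrightarrow> c0 z = 0 \<Longrightarrow> \<exists>z'\<in>H. z = s [:0, 1:] z'"
    and lift: "k \<in> K \<Longrightarrow> \<exists>z\<in>H. small 1 z \<and> c0 z = k"
    and small_add: "small n z \<Longrightarrow> small n w \<Longrightarrow> small n (z + w)"
    and small_mono: "small n z \<Longrightarrow> n \<le> m \<Longrightarrow> small m z"
    and small_T: "small (Suc n) (s [:0, 1:] z) \<Longrightarrow> small n z"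
    and small_exists: "z \<in> H \<Longrightarrow> \<exists>n. small n z"
    and small_0: "z \<in> H \<Longrightarrow> small 0 z \<Longrightarrow> z = 0"
    and small_zero: "small n 0"
begin

abbreviation F2T :: "'a poly set" where "F2T \<equiv> polys_over {0, 1}"

definition shift :: "'z \<Rightarrow> 'z" where
  "shift = s [:0, 1:]"

definition free_family :: "'i set \<Rightarrow> ('i \<Rightarrow> 'z) \<Rightarrow> bool" where
  "free_family I w \<longleftrightarrow> (\<forall>z\<in>H. \<exists>!c. c \<in> I \<rightarrow>\<^sub>E F2T \<and> z = (\<Sum>i\<in>I. s (c i) (w i)))"

lemma two_eq_0: "(2::'a) = 0"
  using of_nat_CHAR[where 'a = 'a] char_2 by simp

lemma F2T_add: "p \<in> F2T \<Longrightarrow> q \<in> F2T \<Longrightarrow> p + q \<in> F2T"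
  using two_eq_0 by (auto simp: polys_over_def) (metis add_0 add_0_right one_add_one)

lemma poly_minus: "- p = (p :: 'a poly)"
  by (rule poly_eqI) (simp add: uminus_CHAR_2[OF char_2])

lemma F2T_diff: "p \<in> F2T \<Longrightarrow> q \<in> F2T \<Longrightarrow> p - q \<in> F2T"
  using F2T_add[of p q] poly_minus[of q] by (metis diff_conv_add_uminus)

lemma F2T_0: "0 \<in> F2T" and F2T_1: "1 \<in> F2T"
  by (auto simp: polys_over_def coeff_1)

lemma F2T_pCons: "pCons a p \<in> F2T \<longleftrightarrow> a \<in> {0, 1} \<and> p \<in> F2T"
  by (fastforce simp: polys_over_def coeff_pCons split: nat.splits)

lemma s_0_left: "s 0 z = 0"
  using s_add_left[of 0 0 z] by simp

lemma s_0_right: "s p 0 = 0"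
  using s_add_right[of p 0 0] by simp

lemma c0_0: "c0 0 = 0"
  using c0_add[of 0 0] by simp

lemma Z_char_2: "(z :: 'z) + z = 0"
proof -
  have "z + z = s (1 + 1) z"
    by (simp only: s_add_left s_1)
  also have "(1 + 1 :: 'a poly) = 0"
    using poly_minus[of 1] by (metis add.right_inverse)
  finally show ?thesis
    by (simp add: s_0_left)
qed

lemma s_diff_left: "s (p - q) z = s p z - s q z"
  using s_add_left[of "p - q" q z] by (simp add: algebra_simps)

lemma s_sum_right: "s p (\<Sum>i\<in>I. f i) = (\<Sum>i\<in>I. s p (f i))"
  by (induction I rule: infinite_finite_induct) (simp_all add: s_0_right s_add_right)

lemma c0_sum: "c0 (\<Sum>i\<in>I. f i) = (\<Sum>i\<in>I. c0 (f i))"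
  by (induction I rule: infinite_finite_induct) (simp_all add: c0_0 c0_add)

lemma H_sum: "(\<And>i. i \<in> I \<Longrightarrow> f i \<in> H) \<Longrightarrow> sum f I \<in> H"
  by (induction I rule: infinite_finite_induct) (simp_all add: H_0 H_add)

lemma small_sum: "(\<And>i. i \<in> I \<Longrightarrow> small n (f i)) \<Longrightarrow> small n (sum f I)"
  by (induction I rule: infinite_finite_induct) (simp_all add: small_zero small_add)

lemma shift_sum: "shift (\<Sum>i\<in>I. f i) = (\<Sum>i\<in>I. shift (f i))"
  unfolding shift_def by (rule s_sum_right)

lemma s_pCons:
  assumes "a \<in> {0, 1}"
  shows "s (pCons a p) z = (if a = 1 then z else 0) + shift (s p z)"
proof -
  have "pCons a p = [:a:] + [:0, 1:] * p"
    by simp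
  then have "s (pCons a p) z = s [:a:] z + shift (s p z)"
    by (simp only: s_add_left s_mult shift_def)
  also have "s [:a:] z = (if a = 1 then z else 0)"
    using assms s_1 s_0_left by (auto simp: one_pCons)
  finally show ?thesis .
qed

lemma c0_s:
  assumes "p \<in> F2T"
  shows "c0 (s p z) = (if coeff p 0 = 1 then c0 z else 0)"
proof (cases p)
  case (pCons a q)
  with assms have "a \<in> {0, 1}"
    by (simp add: F2T_pCons)
  with pCons show ?thesis
    by (auto simp: s_pCons c0_add c0_T[folded shift_def] c0_0)
qed

lemma c0_lin_comb:
  assumes "finite I" "\<And>i. i \<in> I \<Longrightarrow> c i \<in> F2T"
  shows "c0 (\<Sum>i\<in>I. s (c i) (w i)) = (\<Sum>i\<in>{i\<in>I. coeff (c i) 0 = 1}. c0 (w i))"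
  using assms by (simp add: c0_sum c0_s sum.inter_filter)

text \<open>Modulo \<open>T\<close> a basis of \<open>H\<close> becomes an
  \<open>F\<^sub>2\<close>-basis of \<open>K\<close>. Hence the order of \<open>K\<close> determines
  the size of every basis, which makes the rank well defined.\<close>

lemma card_free_family:
  assumes I: "finite I" and w: "\<And>i. i \<in> I \<Longrightarrow> w i \<in> H" and free: "free_family I w"
  shows "card K = 2 ^ card I"
proof -
  let ?f = "\<lambda>S. \<Sum>i\<in>S. c0 (w i)"
  have inj: "inj_on ?f (Pow I)"
  proof (rule inj_onI)
    fix S S' assume S: "S \<in> Pow I" "S' \<in> Pow I" and eq: "?f S = ?f S'"
    have fin: "finite S" "finite S'" using S I finite_subset by auto
    define D where "D = (S - S') \<union> (S' - S)"
    have D: "D \<subseteq> I" using S by (auto simp: D_def)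
    define z where "z = (\<Sum>i\<in>D. w i)"
    have "?f D = 0"
      unfolding D_def using sum_symm_diff_char_2[OF K_char_2 fin, of "\<lambda>i. c0 (w i)"] eq K_char_2 by simp
    moreover have zH: "z \<in> H" using D w by (auto simp: z_def intro!: H_sum)
    ultimately obtain z' where z': "z' \<in> H" "z = shift z'"
      using c0_kernel[of z, folded shift_def] by (auto simp: z_def c0_sum)
    obtain c where c: "c \<in> I \<rightarrow>\<^sub>E F2T" "z' = (\<Sum>i\<in>I. s (c i) (w i))"
      using free z'(1) unfolding free_family_def by blast
    \<comment> \<open>Now \<open>z = T z'\<close> has two expansions, one with coefficients
      \<open>0\<close> and \<open>1\<close>, the other with coefficients divisible by
      \<open>T\<close>; uniqueness leaves only \<open>D = {}\<close>.\<close>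
    define d where "d = (\<lambda>i\<in>I. if i \<in> D then 1 else 0 :: 'a poly)"
    define d' where "d' = (\<lambda>i\<in>I. pCons 0 (c i))"
    have "(\<Sum>i\<in>I. s (d i) (w i)) = (\<Sum>i\<in>I. if i \<in> D then w i else 0)"
      by (rule sum.cong) (simp_all add: d_def s_1 s_0_left)
    also have "\<dots> = z"
      using I D by (simp add: z_def sum.inter_restrict[symmetric] Int_absorb1)
    finally have "z = (\<Sum>i\<in>I. s (d i) (w i))" ..
    moreover have "z = (\<Sum>i\<in>I. s (d' i) (w i))"
      unfolding z'(2) c(2) shift_sum by (rule sum.cong) (simp_all add: d'_def s_pCons)
    moreover have "d \<in> I \<rightarrow>\<^sub>E F2T" "d' \<in> I \<rightarrow>\<^sub>E F2T"
      using c(1) by (auto simp: d_def d'_def F2T_0 F2T_1 F2T_pCons PiE_iff)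
    ultimately have "d = d'"
      using free zH unfolding free_family_def by blast
    have "D = {}"
    proof (rule ccontr)
      assume "D \<noteq> {}"
      then obtain i where "i \<in> D" by blast
      then have "1 = pCons 0 (c i)"
        using fun_cong[OF \<open>d = d'\<close>, of i] D by (auto simp: d_def d'_def)
      then show False by (simp add: one_pCons)
    qed
    then show "S = S'" by (auto simp: D_def)
  qed
  have "?f ` Pow I = K"
  proof (intro subset_antisym subsetI)
    fix k assume "k \<in> ?f ` Pow I"
    then obtain S where S: "S \<subseteq> I" "k = ?f S" by blast
    then have "c0 (\<Sum>i\<in>S. w i) \<in> K"
      using w by (intro c0_in H_sum) auto
    with S show "k \<in> K" by (simp add: c0_sum)
  next
    fix k assume "k \<in> K"
    then obtain z where z: "z \<in> H" "c0 z = k" using lift by blast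
    then obtain c where c: "c \<in> I \<rightarrow>\<^sub>E F2T" "z = (\<Sum>i\<in>I. s (c i) (w i))"
      using free unfolding free_family_def by blast
    then have "k = ?f {i\<in>I. coeff (c i) 0 = 1}"
      using z c0_lin_comb[OF I, of c w] by (auto simp: PiE_iff)
    then show "k \<in> ?f ` Pow I" by auto
  qed
  then show ?thesis
    using card_image[OF inj] card_Pow[OF I] by simp
qed

text \<open>Expansion by repeated division by \<open>T\<close>: remove the constant term with the
  given lifts, then divide. The index from which coefficients are small drops by one each time, so
  the process stops and yields polynomials.\<close>

lemma free_family_of_small_lifts:
  assumes I: "finite I" and w: "\<And>i. i \<in> I \<Longrightarrow> w i \<in> H" "\<And>i. i \<in> I \<Longrightarrow> small 1 (w i)"
    and bij: "bij_betw (\<lambda>S. \<Sum>i\<in>S. c0 (w i)) (Pow I) K"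
  shows "free_family I w"
proof -
  have ex: "\<exists>c. c \<in> I \<rightarrow> F2T \<and> z = (\<Sum>i\<in>I. s (c i) (w i))" if "small n z" "z \<in> H" for n z
    using that
  proof (induction n arbitrary: z)
    case 0
    then have "z = 0" using small_0 by blast
    then show ?case
      by (intro exI[of _ "\<lambda>_. 0"]) (simp add: s_0_left F2T_0)
  next
    case (Suc n)
    have "c0 z \<in> (\<lambda>S. \<Sum>i\<in>S. c0 (w i)) ` Pow I"
      using bij c0_in[OF Suc.prems(2)] by (auto simp: bij_betw_def)
    then obtain S where S: "S \<subseteq> I" "c0 z = (\<Sum>i\<in>S. c0 (w i))" by blast
    define z1 where "z1 = z + (\<Sum>i\<in>S. w i)"
    have z1: "z1 \<in> H" "c0 z1 = 0" "small (Suc n) z1"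
    proof -
      show "z1 \<in> H" using S w Suc.prems by (auto simp: z1_def intro!: H_add H_sum)
      show "c0 z1 = 0" using S(2) by (simp add: z1_def c0_add c0_sum K_char_2)
      \<comment> \<open>The lifts are small from index \<open>1\<close> on and
        \<open>Suc n \<ge> 1\<close>, so removing the constant term does not spoil
        smallness.\<close>
      show "small (Suc n) z1"
        unfolding z1_def using Suc.prems S w small_mono[of 1 _ "Suc n"]
        by (auto intro!: small_add small_sum)
    qed
    then obtain z' where z': "z' \<in> H" "z1 = shift z'" using c0_kernel[folded shift_def] by blast
    then have "small n z'" using z1(3) small_T[folded shift_def] by blast
    then obtain c where c: "c \<in> I \<rightarrow> F2T" "z' = (\<Sum>i\<in>I. s (c i) (w i))"
      using Suc.IH z'(1) by blast
    have "z = z1 + (\<Sum>i\<in>S. w i)"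
      using Z_char_2[of "\<Sum>i\<in>S. w i"] by (simp add: z1_def add.assoc)
    also have "(\<Sum>i\<in>S. w i) = (\<Sum>i\<in>I. if i \<in> S then w i else 0)"
      using I S(1) by (simp add: sum.inter_restrict[symmetric] Int_absorb1)
    also have "z1 + \<dots> = (\<Sum>i\<in>I. s (pCons (if i \<in> S then 1 else 0) (c i)) (w i))"
      unfolding z'(2) c(2) shift_sum sum.distrib[symmetric]
      by (rule sum.cong) (auto simp: s_pCons add.commute)
    finally show ?case
      using c(1) by (intro exI[of _ "\<lambda>i. pCons (if i \<in> S then 1 else 0) (c i)"]) (auto simp: F2T_pCons Pi_iff)
  qed
  have c00: "coeff (p i) 0 = 0"
    if p: "\<And>i. i \<in> I \<Longrightarrow> p i \<in> F2T" "(\<Sum>i\<in>I. s (p i) (w i)) = 0" and i: "i \<in> I" for p i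
  proof -
    let ?S = "{i\<in>I. coeff (p i) 0 = 1}"
    have "(\<Sum>i\<in>?S. c0 (w i)) = 0"
      using c0_lin_comb[OF I, of p w] p by (simp add: c0_0)
    then have "?S = {}"
      using inj_onD[OF bij_betw_imp_inj_on[OF bij], of ?S "{}"] by simp
    then show ?thesis
      using p(1)[OF i] i by (auto simp: polys_over_def)
  qed
  have uniq: "coeff (p i) n = 0"
    if "\<And>i. i \<in> I \<Longrightarrow> p i \<in> F2T" "(\<Sum>i\<in>I. s (p i) (w i)) = 0" "i \<in> I" for n p i
    using that
  proof (induction n arbitrary: p i)
    case (0 p i)
    then show ?case by (rule c00)
  next
    case (Suc n p i)
    define q where "q i = poly_shift 1 (p i)" for i
    have pq: "p i = pCons 0 (q i)" if "i \<in> I" for i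
      using c00[OF Suc.prems(1,2) that] by (intro poly_eqI) (auto simp: q_def coeff_poly_shift coeff_pCons split: nat.splits)
    \<comment> \<open>All coefficients of the relation are divisible by \<open>T\<close>, and
      \<open>T\<close> can be cancelled; repeating this reaches the coefficient of index
      \<open>n\<close>.\<close>
    have "shift (\<Sum>i\<in>I. s (q i) (w i)) = (\<Sum>i\<in>I. s (p i) (w i))"
      unfolding shift_sum by (rule sum.cong) (simp_all add: pq s_pCons)
    then have "(\<Sum>i\<in>I. s (q i) (w i)) = 0"
      using Suc.prems(2) T_torsion_free[folded shift_def] by simp
    moreover have "q i \<in> F2T" if "i \<in> I" for i
      using Suc.prems(1)[OF that] pq[OF that] by (simp add: F2T_pCons)
    ultimately show ?case
      using Suc.IH[of q i] Suc.prems(3) pq[of i] by simp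
  qed
  show ?thesis
    unfolding free_family_def
  proof
    fix z assume z: "z \<in> H"
    obtain n where "small n z" using small_exists[OF z] by blast
    then obtain c where c: "c \<in> I \<rightarrow> F2T" "z = (\<Sum>i\<in>I. s (c i) (w i))"
      using ex z by blast
    show "\<exists>!c. c \<in> I \<rightarrow>\<^sub>E F2T \<and> z = (\<Sum>i\<in>I. s (c i) (w i))"
    proof (rule ex1I[of _ "restrict c I"])
      show "restrict c I \<in> I \<rightarrow>\<^sub>E F2T \<and> z = (\<Sum>i\<in>I. s (restrict c I i) (w i))"
        using c by auto
      fix d assume d: "d \<in> I \<rightarrow>\<^sub>E F2T \<and> z = (\<Sum>i\<in>I. s (d i) (w i))"
      have "(\<Sum>i\<in>I. s (d i - c i) (w i)) = 0"
        using c(2) d by (simp add: s_diff_left sum_subtractf)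
      then have "coeff (d i - c i) n = 0" if "i \<in> I" for i n
        using that c(1) d by (intro uniq[of "\<lambda>i. d i - c i"]) (auto intro: F2T_diff)
      then have "d i = c i" if "i \<in> I" for i
        using that by (intro poly_eqI) simp
      then show "d = restrict c I"
        using d by (intro ext) (auto simp: PiE_iff extensional_def)
    qed
  qed
qed

end

section \<open>The functional equation of the invariants\<close>

text \<open>With \<open>|x| = 2 powr - ord x\<close>, these are \<open>ord a11 = -1\<close>,
  \<open>-4/3 \<le> v < -2/3\<close> and \<open>v > -2u - 2\<close>; cubes and squares avoid
  fractional exponents.\<close>

locale D12_setting = C_infinity ord \<theta> for ord :: "'a::field \<Rightarrow> ereal" and \<theta> :: 'a +
  fixes a11 a12 a21 :: 'a
  assumes a11: "absval a11 = 2" and a21: "4 < absval a21 ^ 3" "absval a21 ^ 3 \<le> 16"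
    and a12: "absval a12 ^ 2 * absval a21 < 4"
begin

abbreviation A :: "'a^2^2" where
  "A \<equiv> vector [vector [a11, a12], vector [a21, 0]]"

definition G :: "'a \<times> 'a \<Rightarrow> 'a \<times> 'a" where
  "G y = (a11 * fst y ^ 2 + a21 * snd y ^ 2 + \<theta> ^ 2 * fst y ^ 4, a12 * fst y ^ 2 + \<theta> ^ 2 * snd y ^ 4)"

definition frob2 :: "'a \<times> 'a \<Rightarrow> 'a \<times> 'a" where
  "frob2 y = (fst y ^ 4, snd y ^ 4)"

text \<open>The weights are chosen such that \<^term>\<open>G\<close> contracts on the ball \<open>N < 1\<close>.\<close>

definition W :: real where
  "W = sqrt (2 * absval a21)"

definition N :: "'a \<times> 'a \<Rightarrow> real" where
  "N y = max (2 * absval (fst y)) (W * absval (snd y))"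

definition coeff_pair :: "nat \<Rightarrow> ('a fps ^ 2) \<times> ('a fps ^ 2) \<Rightarrow> 'a \<times> 'a" where
  "coeff_pair n z = (fps_nth (snd z $ 1) n, fps_nth (snd z $ 2) n)"

lemma a21_pos: "absval a21 > 0"
  using a21 absval_nonneg[of a21] by (cases "absval a21 = 0") auto

lemma absval_theta: "absval \<theta> = 2"
  using absval_eq_powr[of \<theta> "-1"] by (simp add: ord_theta one_ereal_def)

lemma square_add: "(x + y) ^ 2 = x ^ 2 + (y::'a) ^ 2" and fourth_add: "(x + y) ^ 4 = x ^ 4 + (y::'a) ^ 4"
  using power2_add_char_2[OF char_2, of x y 1] power2_add_char_2[OF char_2, of x y 2] by simp_all

lemma add_self_left: "x + (x + y) = (y::'a)"
  by (simp flip: add.assoc)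

lemma eq_add_swap: "x = y + z \<Longrightarrow> y = z + (x::'a)" "x = y + z \<Longrightarrow> z = x + (y::'a)"
  "x = y + z + t \<Longrightarrow> z = t + (x + (y::'a))"
  by (simp_all add: ac_simps add_self_left)

lemma minus_eq: "- x = (x::'a)"
  by (rule uminus_CHAR_2[OF char_2])

lemma W: "W > 0" "W ^ 2 = 2 * absval a21" "W ^ 3 \<ge> 4" "absval a12 * W \<le> 4"
proof -
  show W0: "W > 0" and W2: "W ^ 2 = 2 * absval a21"
    using a21_pos by (simp_all add: W_def absval_nonneg)
  have "(W ^ 3) ^ 2 = (W ^ 2) ^ 3"
    by (simp flip: power_mult)
  also have "\<dots> = 8 * absval a21 ^ 3"
    by (simp add: W2 power_mult_distrib)
  finally have "16 \<le> (W ^ 3) ^ 2"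
    using a21 by linarith
  then have "4 ^ 2 \<le> (W ^ 3) ^ 2"
    by simp
  then show "W ^ 3 \<ge> 4"
    by (rule power2_le_imp_le) (use W0 in simp)
  have "(absval a12 * W) ^ 2 = 2 * (absval a12 ^ 2 * absval a21)"
    by (simp add: power_mult_distrib W2)
  then have "(absval a12 * W) ^ 2 \<le> 16"
    using a12 by linarith
  then have "(absval a12 * W) ^ 2 \<le> 4 ^ 2"
    by simp
  then show "absval a12 * W \<le> 4"
    by (rule power2_le_imp_le) simp
qed

lemma N_nonneg: "0 \<le> N y"
  using absval_nonneg by (simp add: N_def le_max_iff_disj)

lemma N_eq_0_iff: "N y = 0 \<longleftrightarrow> y = 0"
  using absval_nonneg[of "fst y"] absval_nonneg[of "snd y"] W(1)
  by (auto simp: N_def max_def prod_eq_iff split: if_splits)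

lemma N_le_iff: "N y \<le> r \<longleftrightarrow> 2 * absval (fst y) \<le> r \<and> W * absval (snd y) \<le> r"
  by (simp add: N_def)

lemma N_less_iff: "N y < r \<longleftrightarrow> 2 * absval (fst y) < r \<and> W * absval (snd y) < r"
  by (simp add: N_def)

lemma N_add_le: "N x \<le> r \<Longrightarrow> N y \<le> r \<Longrightarrow> N (x + y) \<le> r"
  using absval_add_le[of "fst x" "r / 2" "fst y"] absval_add_le[of "snd x" "r / W" "snd y"] W(1)
  by (simp add: N_le_iff pos_le_divide_eq mult.commute)

lemma N_diff: "N (x - y) \<le> max (N x) (N y)"
proof -
  have "N (- y) = N y" by (simp add: N_def)
  then show ?thesis
    using N_add_le[of x "max (N x) (N y)" "- y"] by simp
qed

lemma N_add_less: "N x < r \<Longrightarrow> N y < r \<Longrightarrow> N (x + y) < r"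
  using N_add_le[of x "max (N x) (N y)" y] by simp

lemma G_add: "G (x + y) = G x + G y"
  by (simp add: G_def square_add fourth_add algebra_simps)

lemma G_0: "G 0 = 0"
  by (simp add: G_def zero_prod_def)

text \<open>The weights \<open>2\<close> and \<open>W\<close> make the squared terms in the first
  component exact: \<open>2 |a11| = 2^2\<close> and \<open>2 |a21| = W^2\<close>. The remaining
  terms fit because \<open>W |a12| \<le> 4\<close> and \<open>W^3 \<ge> 4\<close>.\<close>

lemma N_G:
  assumes "N y \<le> 1"
  shows "N (G y) \<le> N y ^ 2"
proof -
  let ?a = "absval (fst y)" and ?b = "absval (snd y)"
  define M where "M = N y"
  have ab: "0 \<le> ?a" "0 \<le> ?b" by (simp_all add: absval_nonneg)
  have p: "2 * ?a \<le> M" and q: "W * ?b \<le> M" and M: "0 \<le> M" "M \<le> 1"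
    using N_le_iff[of y M] N_nonneg[of y] assms by (simp_all add: M_def)
  have p2: "4 * ?a ^ 2 \<le> M ^ 2"
    using power_mono[OF p, of 2] ab by (simp add: power_mult_distrib)
  have q2: "W ^ 2 * ?b ^ 2 \<le> M ^ 2"
    using power_mono[OF q, of 2] ab W(1) by (simp add: power_mult_distrib)
  have M4: "M ^ 4 \<le> M ^ 2"
    using M by (intro power_decreasing) auto
  have p4: "16 * ?a ^ 4 \<le> M ^ 2"
    using power_mono[OF p, of 4] ab M4 by (simp add: power_mult_distrib)
  then have p4': "8 * ?a ^ 4 \<le> M ^ 2"
    using zero_le_power[OF ab(1), of 4] by linarith
  have q4: "W ^ 4 * ?b ^ 4 \<le> M ^ 2"
    using power_mono[OF q, of 4] ab W(1) M4 by (simp add: power_mult_distrib)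
  have "absval (fst (G y)) \<le> M ^ 2 / 2"
    unfolding G_def fst_conv
    by (intro absval_add_le)
       (use p2 q2 p4' ab in \<open>auto simp: absval_mult absval_power a11 absval_theta W(2)\<close>)
  moreover have "absval (snd (G y)) \<le> M ^ 2 / W"
    unfolding G_def snd_conv
  proof (rule absval_add_le)
    have "absval a12 * W * ?a ^ 2 \<le> 4 * ?a ^ 2"
      using W(4) by (intro mult_right_mono) auto
    also note p2
    finally show "absval (a12 * fst y ^ 2) \<le> M ^ 2 / W"
      using W(1) by (simp add: absval_mult absval_power pos_le_divide_eq algebra_simps)
    have "4 * (W * ?b ^ 4) \<le> W ^ 3 * (W * ?b ^ 4)"
      using W ab by (intro mult_right_mono) auto
    also have "\<dots> = W ^ 4 * ?b ^ 4"
      by (simp add: eval_nat_numeral)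
    also note q4
    finally show "absval (\<theta> ^ 2 * snd y ^ 4) \<le> M ^ 2 / W"
      using W(1) by (simp add: absval_mult absval_power absval_theta pos_le_divide_eq algebra_simps)
  qed
  ultimately show ?thesis
    using W(1) by (simp add: N_le_iff M_def pos_le_divide_eq mult.commute)
qed

lemma N_frob2: "N (frob2 y) \<le> N y ^ 4"
proof -
  let ?a = "absval (fst y)" and ?b = "absval (snd y)"
  have ab: "0 \<le> ?a" "0 \<le> ?b" by (simp_all add: absval_nonneg)
  have "(2 * ?a) ^ 4 \<le> N y ^ 4" "(W * ?b) ^ 4 \<le> N y ^ 4"
    using N_le_iff[of y "N y"] ab W(1) by (blast intro: power_mono mult_nonneg_nonneg less_imp_le zero_le_numeral)+
  moreover have "W * ?b ^ 4 \<le> W ^ 3 * (W * ?b ^ 4)"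
    using W mult_right_mono[of 1 "W ^ 3" "W * ?b ^ 4"] by simp
  moreover have "W ^ 3 * (W * ?b ^ 4) = (W * ?b) ^ 4"
    by (simp add: eval_nat_numeral)
  moreover have "(2 * ?a) ^ 4 = 16 * ?a ^ 4"
    by (simp add: power_mult_distrib)
  ultimately have "2 * ?a ^ 4 \<le> N y ^ 4" "W * ?b ^ 4 \<le> N y ^ 4"
    using zero_le_power[OF ab(1), of 4] by linarith+
  then show ?thesis
    by (simp add: N_le_iff frob2_def absval_power)
qed

lemma fixed_point_small: "y = G y \<Longrightarrow> N y < 1 \<Longrightarrow> y = 0"
proof -
  assume y: "y = G y" "N y < 1"
  then have "N y \<le> N y * N y"
    using N_G[of y] by (simp add: power2_eq_square)
  have "N y = 0"
  proof (rule ccontr)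
    assume "N y \<noteq> 0"
    then have "N y * N y < N y * 1"
      using y(2) N_nonneg[of y] by (intro mult_strict_left_mono) auto
    with \<open>N y \<le> N y * N y\<close> show False by simp
  qed
  then show "y = 0" by (simp add: N_eq_0_iff)
qed

lemma N_complete:
  assumes "(\<lambda>n. N (X (Suc n) - X n)) \<longlonglongrightarrow> 0"
  shows "\<exists>x. (\<lambda>n. N (X n - x)) \<longlonglongrightarrow> 0"
proof -
  have 1: "(\<lambda>n. absval (fst (X (Suc n)) - fst (X n))) \<longlonglongrightarrow> 0"
    by (rule tendsto_0_le[OF _ assms]) (use absval_nonneg in \<open>auto simp: N_def le_max_iff_disj\<close>)
  have "(\<lambda>n. N (X (Suc n) - X n) / W) \<longlonglongrightarrow> 0"
    using tendsto_divide[OF assms tendsto_const[of W]] W(1) by simp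
  then have 2: "(\<lambda>n. absval (snd (X (Suc n)) - snd (X n))) \<longlonglongrightarrow> 0"
    by (rule tendsto_0_le[rotated])
       (use W(1) absval_nonneg in \<open>auto simp: N_def pos_le_divide_eq le_max_iff_disj mult.commute\<close>)
  obtain x1 where x1: "(\<lambda>n. absval (fst (X n) - x1)) \<longlonglongrightarrow> 0"
    using absval_complete[OF 1] by blast
  obtain x2 where x2: "(\<lambda>n. absval (snd (X n) - x2)) \<longlonglongrightarrow> 0"
    using absval_complete[OF 2] by blast
  have "(\<lambda>n. max (2 * absval (fst (X n) - x1)) (W * absval (snd (X n) - x2))) \<longlonglongrightarrow> max (2 * 0) (W * 0)"
    by (intro tendsto_max tendsto_mult tendsto_const x1 x2)
  then show ?thesis
    by (intro exI[of _ "(x1, x2)"]) (simp add: N_def)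
qed

text \<open>On the ball of radius \<open>N c\<close> the quadratic bound for \<open>G\<close> is a
  contraction with factor \<open>N c\<close> itself.\<close>

lemma solve_small:
  assumes "N c < 1"
  shows "\<exists>y. y = c + G y \<and> N y \<le> N c"
proof (rule additive_contraction[where N = N and \<rho> = "N c" and l = "N c"])
  show "N (G x) \<le> N c * N x" if "N x \<le> N c" for x
    using N_G[of x] that assms mult_right_mono[OF that N_nonneg[of x]] by (simp add: power2_eq_square)
qed (use assms N_nonneg N_eq_0_iff N_diff N_complete G_add in auto)

text \<open>The possible balances between the terms of the two equations bound \<open>y\<close>. The
  targets are \<open>2 |y1|^4 < 1\<close> and \<open>2 |a21| |y2|^8 < 1\<close>, the latter being
  the square of \<open>W |y2|^4 < 1\<close>.\<close>

lemma kernel_frob2: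
  assumes "y = G y"
  shows "N (frob2 y) < 1"
proof -
  obtain y1 y2 where y: "y = (y1, y2)" by (cases y)
  have e1: "y1 = a11 * y1 ^ 2 + a21 * y2 ^ 2 + \<theta> ^ 2 * y1 ^ 4" and e2: "y2 = a12 * y1 ^ 2 + \<theta> ^ 2 * y2 ^ 4"
    using assms by (simp_all add: y G_def)
  let ?a = "absval y1" and ?b = "absval y2" and ?U = "absval a12" and ?V = "absval a21"
  have ab: "0 \<le> ?a" "0 \<le> ?b" "0 \<le> ?U" by (simp_all add: absval_nonneg)
  \<comment> \<open>Otherwise the quartic terms dominate both equations in turn:
    \<open>|a21| |y2|^2 = 4 |y1|^4 > 1\<close>, so \<open>|y2|^3 > 1/4\<close> by
    \<open>|a21|^3 \<le> 16\<close>, and then \<open>|a12| |y1|^2 = 4 |y2|^4\<close>. Eliminating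
    \<open>|y1|\<close> gives \<open>|a12|^2 |a21| = 64 |y2|^6 > 4\<close>, a contradiction.\<close>
  have a: "?a ^ 2 \<le> 1 / 2"
  proof (rule ccontr)
    assume "\<not> ?a ^ 2 \<le> 1 / 2"
    then have a: "1 / 2 < ?a ^ 2" by simp
    have a0: "0 < ?a" using a ab by (cases "?a = 0") auto
    have "(1 / 2) ^ 3 < (?a ^ 2) ^ 3"
      using a by (intro power_strict_mono) auto
    then have "(1 / 4) ^ 2 < (?a ^ 3) ^ 2"
      by (simp add: power2_eq_square eval_nat_numeral)
    then have a3: "1 / 4 < ?a ^ 3"
      using ab by (intro power2_less_imp_less[of "1 / 4"]) auto
    have "?a ^ 4 = ?a * ?a ^ 3" "?a ^ 4 = ?a ^ 2 * ?a ^ 2" by (simp_all add: eval_nat_numeral)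
    moreover have "?a * (1 / 4) < ?a * ?a ^ 3"
      using a3 a0 by (rule mult_strict_left_mono)
    moreover have "?a ^ 2 * (1 / 2) < ?a ^ 2 * ?a ^ 2"
      using a a0 by (intro mult_strict_left_mono) auto
    ultimately have dom: "?a < 4 * ?a ^ 4" "2 * ?a ^ 2 < 4 * ?a ^ 4"
      by linarith+
    have "a21 * y2 ^ 2 = \<theta> ^ 2 * y1 ^ 4 + (y1 + a11 * y1 ^ 2)"
      using e1 by (rule eq_add_swap(3))
    moreover have "absval (\<theta> ^ 2 * y1 ^ 4 + (y1 + a11 * y1 ^ 2)) = absval (\<theta> ^ 2 * y1 ^ 4)"
      by (rule absval_add_eq, rule le_less_trans[OF absval_add])
         (use dom in \<open>auto simp: absval_mult absval_power absval_theta a11\<close>)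
    ultimately have Vb: "?V * ?b ^ 2 = 4 * ?a ^ 4"
      by (simp add: absval_theta flip: absval_mult absval_power) (simp add: absval_mult absval_power absval_theta)
    have "4 * ?a ^ 4 > 1"
      using power_strict_mono[OF a, of 2] by (simp add: power_divide)
    then have "1 < ?V * ?b ^ 2" using Vb by simp
    then have "1 < (?V * ?b ^ 2) ^ 3"
      by (intro one_less_power) auto
    also have "\<dots> = ?V ^ 3 * (?b ^ 3) ^ 2"
      by (simp add: power_mult_distrib flip: power_mult)
    also have "\<dots> \<le> 16 * (?b ^ 3) ^ 2"
      using a21 by (intro mult_right_mono) auto
    finally have b6: "1 / 16 < (?b ^ 3) ^ 2" by simp
    then have b3: "1 / 4 < ?b ^ 3"
      using ab by (intro power2_less_imp_less[of "1 / 4"]) (auto simp: power2_eq_square)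
    have b0: "0 < ?b" using b3 ab by (cases "?b = 0") auto
    have "?b ^ 4 = ?b * ?b ^ 3" by (simp add: eval_nat_numeral)
    then have "?b < 4 * ?b ^ 4"
      using mult_strict_left_mono[OF b3 b0] by simp
    moreover have "a12 * y1 ^ 2 = \<theta> ^ 2 * y2 ^ 4 + y2"
      using e2 by (rule eq_add_swap(1))
    moreover have "absval (\<theta> ^ 2 * y2 ^ 4) = 4 * ?b ^ 4"
      by (simp add: absval_mult absval_power absval_theta)
    ultimately have "?U * ?a ^ 2 = 4 * ?b ^ 4"
      using absval_add_eq[of y2 "\<theta> ^ 2 * y2 ^ 4"] by (simp flip: absval_mult absval_power)
    then have "(?U * ?a ^ 2) ^ 2 = (4 * ?b ^ 4) ^ 2" by simp
    moreover have "4 * (?U * ?a ^ 2) ^ 2 = ?U ^ 2 * (4 * ?a ^ 4)"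
      by (simp add: power_mult_distrib)
    moreover have "4 * (4 * ?b ^ 4) ^ 2 = 64 * (?b ^ 3) ^ 2 * ?b ^ 2"
      by (simp add: power_mult_distrib flip: power_mult power_add)
    ultimately have "?U ^ 2 * ?V * ?b ^ 2 = 64 * (?b ^ 3) ^ 2 * ?b ^ 2"
      unfolding Vb[symmetric] by (simp only: mult.assoc)
    then have "?U ^ 2 * ?V = 64 * (?b ^ 3) ^ 2"
      using b0 by simp
    then show False using b6 a12 by simp
  qed
  have "?a ^ 4 = ?a ^ 2 * ?a ^ 2" by (simp add: eval_nat_numeral)
  also have "\<dots> \<le> 1 / 2 * (1 / 2)"
    using a by (intro mult_mono) auto
  finally have a4: "2 * ?a ^ 4 < 1" by simp
  \<comment> \<open>The second equation bounds \<open>4 |y2|^4\<close> by \<open>|y2|\<close> or by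
    \<open>|a12| |y1|^2 \<le> |a12| / 2\<close>. Cubing the target brings in
    \<open>|a21|^3 \<le> 16\<close> in the first case; squaring the bound brings in
    \<open>|a12|^2 |a21| < 4\<close> in the second.\<close>
  have b8: "2 * ?V * (?b ^ 4) ^ 2 < 1"
  proof -
    have "\<theta> ^ 2 * y2 ^ 4 = y2 + a12 * y1 ^ 2"
      using e2 by (rule eq_add_swap(2))
    then have "4 * ?b ^ 4 \<le> max ?b (?U * ?a ^ 2)"
      using absval_add[of y2 "a12 * y1 ^ 2"] by (simp add: absval_mult absval_power absval_theta flip: \<open>\<theta> ^ 2 * y2 ^ 4 = _\<close>)
    then consider "4 * ?b ^ 4 \<le> ?b" | "4 * ?b ^ 4 \<le> ?U * ?a ^ 2" by (auto simp: le_max_iff_disj)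
    then show ?thesis
    proof cases
      case 1
      show ?thesis
      proof (cases "?b = 0")
        case False
        then have b0: "0 < ?b" using ab by simp
        have "?b ^ 4 = ?b * ?b ^ 3" by (simp add: eval_nat_numeral)
        with 1 have "?b * (4 * ?b ^ 3) \<le> ?b * 1" by simp
        then have "4 * ?b ^ 3 \<le> 1" using b0 by (simp only: mult_le_cancel_left_pos)
        then have "(?b ^ 3) ^ 8 \<le> (1 / 4) ^ 8"
          using ab by (intro power_mono) auto
        then have "?V ^ 3 * (?b ^ 3) ^ 8 \<le> 16 * (1 / 4) ^ 8"
          using a21 ab by (intro mult_mono) auto
        moreover have "(2 * ?V * (?b ^ 4) ^ 2) ^ 3 = 8 * (?V ^ 3 * (?b ^ 3) ^ 8)"
          by (simp add: power_mult_distrib flip: power_mult)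
        moreover have "8 * (16 * (1 / 4) ^ 8) < (1 :: real)"
          by (simp add: power_divide)
        ultimately have "(2 * ?V * (?b ^ 4) ^ 2) ^ 3 < 1"
          by linarith
        then have "(2 * ?V * (?b ^ 4) ^ 2) ^ 3 < 1 ^ 3"
          by simp
        then show ?thesis
          by (rule power_less_imp_less_base) simp
      qed simp
    next
      case 2
      have "?U * ?a ^ 2 \<le> ?U * (1 / 2)"
        using a ab by (intro mult_left_mono)
      with 2 have "(4 * ?b ^ 4) ^ 2 \<le> (?U / 2) ^ 2"
        using ab by (intro power_mono) auto
      then have "?V * (64 * (?b ^ 4) ^ 2) \<le> ?V * ?U ^ 2"
        using a21_pos by (intro mult_left_mono) (auto simp: power_mult_distrib power_divide absval_nonneg)
      then show ?thesis using a12 by (simp add: mult.commute)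
    qed
  qed
  have "(W * ?b ^ 4) ^ 2 < 1 ^ 2"
    using b8 by (simp add: power_mult_distrib W(2))
  then have "W * ?b ^ 4 < 1"
    by (rule power_less_imp_less_base) simp
  with a4 show ?thesis
    by (simp add: N_less_iff frob2_def y absval_power)
qed

end

context D12_setting
begin

section \<open>The group of solutions of \<open>y = G y\<close>\<close>

definition kernel :: "('a \<times> 'a) set" where
  "kernel = {y. y = G y}"

lemma kernel_add: "x \<in> kernel \<Longrightarrow> y \<in> kernel \<Longrightarrow> x + y \<in> kernel"
  by (simp add: kernel_def G_add)

text \<open>Eliminating \<open>y\<^sub>2\<close> from \<open>y = G y\<close> leaves an additive polynomial of degree 16 in \<open>y\<^sub>1\<close>.\<close>

lemma card_kernel: "card kernel = 16"
proof -
  have a21_0: "a21 \<noteq> 0"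
    using a21_pos by auto
  define s where "s x = (x + a11 * x ^ 2 + \<theta> ^ 2 * x ^ 4) / a21" for x
  \<comment> \<open>The first equation says \<open>y2^2 = s y1\<close>. Squaring the second and
    inserting this gives \<open>s x = a12^2 x^4 + \<theta>^4 (s x)^4\<close>; the list contains its
    coefficients at \<open>x, x^2, x^4, x^8, x^16\<close>.\<close>
  define c where "c i = [1 / a21, a11 / a21, \<theta> ^ 2 / a21 + a12 ^ 2 + \<theta> ^ 4 / a21 ^ 4,
    \<theta> ^ 4 * a11 ^ 4 / a21 ^ 4, \<theta> ^ 12 / a21 ^ 4] ! i" for i
  have L: "additive_poly c 4 x = s x + (a12 ^ 2 * x ^ 4 + \<theta> ^ 4 * s x ^ 4)" for x
  proof -
    have "s x ^ 4 = (x ^ 4 + a11 ^ 4 * x ^ 8 + \<theta> ^ 8 * x ^ 16) / a21 ^ 4"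
      by (simp add: s_def power_divide fourth_add power_mult_distrib flip: power_mult)
    moreover have "additive_poly c 4 x = c 0 * x + c 1 * x ^ 2 + c 2 * x ^ 4 + c 3 * x ^ 8 + c 4 * x ^ 16"
      by (simp add: additive_poly_def eval_nat_numeral)
    ultimately show ?thesis
      by (simp add: c_def s_def add_divide_distrib algebra_simps flip: power_add)
  qed
  \<comment> \<open>No square root has to be taken: as \<open>y2^4 = (s y1)^2\<close>, the second
    equation expresses \<open>y2\<close> through \<open>y1\<close>.\<close>
  have kernel_iff: "(y1, y2) \<in> kernel \<longleftrightarrow> additive_poly c 4 y1 = 0 \<and> y2 = a12 * y1 ^ 2 + \<theta> ^ 2 * s y1 ^ 2" for y1 y2
  proof
    assume "(y1, y2) \<in> kernel"
    then have e1: "y1 = a11 * y1 ^ 2 + a21 * y2 ^ 2 + \<theta> ^ 2 * y1 ^ 4" and e2: "y2 = a12 * y1 ^ 2 + \<theta> ^ 2 * y2 ^ 4"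
      by (simp_all add: kernel_def G_def)
    have "a21 * y2 ^ 2 = \<theta> ^ 2 * y1 ^ 4 + (y1 + a11 * y1 ^ 2)"
      using e1 by (rule eq_add_swap(3))
    then have s2: "y2 ^ 2 = s y1"
      using a21_0 by (simp add: s_def eq_divide_eq ac_simps)
    then have s4: "y2 ^ 4 = s y1 ^ 2"
      by (simp flip: s2 power_mult)
    have "y2 ^ 2 = a12 ^ 2 * y1 ^ 4 + \<theta> ^ 4 * (y2 ^ 2) ^ 4"
      by (subst e2) (simp add: square_add power_mult_distrib flip: power_mult)
    then have "additive_poly c 4 y1 = 0"
      unfolding L s2 by (simp add: add_eq_0_iff_eq)
    then show "additive_poly c 4 y1 = 0 \<and> y2 = a12 * y1 ^ 2 + \<theta> ^ 2 * s y1 ^ 2"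
      using e2 s4 by simp
  next
    assume *: "additive_poly c 4 y1 = 0 \<and> y2 = a12 * y1 ^ 2 + \<theta> ^ 2 * s y1 ^ 2"
    then have "y2 ^ 2 = a12 ^ 2 * y1 ^ 4 + \<theta> ^ 4 * s y1 ^ 4"
      by (simp add: square_add power_mult_distrib flip: power_mult)
    then have s2: "y2 ^ 2 = s y1"
      using * by (simp add: L add_eq_0_iff_eq)
    then have "y2 ^ 4 = s y1 ^ 2"
      by (simp flip: s2 power_mult)
    moreover have "a21 * s y1 = y1 + a11 * y1 ^ 2 + \<theta> ^ 2 * y1 ^ 4"
      using a21_0 by (simp add: s_def)
    ultimately show "(y1, y2) \<in> kernel"
      using * s2 by (simp add: kernel_def G_def ac_simps add_self_left)
  qed
  have "kernel = (\<lambda>x. (x, a12 * x ^ 2 + \<theta> ^ 2 * s x ^ 2)) ` {x. additive_poly c 4 x = 0}"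
    using kernel_iff by auto
  then have "card kernel = card {x. additive_poly c 4 x = 0}"
    by (simp add: card_image inj_on_def)
  also have "\<dots> = 2 ^ 4"
  proof (rule card_additive_poly_roots)
    have "\<theta> \<noteq> 0" using absval_theta by auto
    then show "c 0 \<noteq> 0" "c 4 \<noteq> 0" using a21_0 by (simp_all add: c_def)
  qed
  finally show ?thesis by simp
qed

section \<open>Invariants as sequences of coefficient pairs\<close>

lemma coeff_pair_add: "coeff_pair n (z + w) = coeff_pair n z + coeff_pair n w"
  by (simp add: coeff_pair_def)

lemma A_nth: "A $ 1 $ 1 = a11" "A $ 1 $ 2 = a12" "A $ 2 $ 1 = a21" "A $ 2 $ 2 = 0"
  by (simp_all add: vector_2)

lemma invariant_pairs_fst:
  fixes z :: "('a fps ^ 2) \<times> ('a fps ^ 2)"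
  assumes "z \<in> invariant_pairs A"
  shows "fst z $ j = (fps_X - fps_const \<theta>) * tate_tau (snd z $ j)"
proof -
  have "fst (pair_tau \<theta> A z) = fst z"
    using assms by (simp add: invariant_pairs_def)
  then show ?thesis
    by (simp add: pair_tau_def vec_eq_iff)
qed

text \<open>One half of invariance is \<open>x = (T - \<theta>) y'\<close>; inserted into the other
  half it gives \<open>y = (T + \<theta>^2) y'' + y' A\<close>. The factor \<open>T\<close> produces
  the contribution of the preceding coefficient, absent at index \<open>0\<close>.\<close>

lemma invariant_pairs_iff:
  "z \<in> invariant_pairs A \<longleftrightarrow> z \<in> tate_pairs ord \<and>
     (\<forall>j. fst z $ j = (fps_X - fps_const \<theta>) * tate_tau (snd z $ j)) \<and>
     coeff_pair 0 z = G (coeff_pair 0 z) \<and>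
     (\<forall>n. coeff_pair (Suc n) z = frob2 (coeff_pair n z) + G (coeff_pair (Suc n) z))"
proof -
  let ?X = "\<forall>j. fst z $ j = (fps_X - fps_const \<theta>) * tate_tau (snd z $ j)"
  let ?y1 = "snd z $ 1" and ?y2 = "snd z $ 2"
  have tt: "tate_tau ((fps_X - fps_const \<theta>) * tate_tau f) = (fps_X + fps_const (\<theta> ^ 2)) * tate_tau (tate_tau f)" for f
  proof -
    have "tate_tau (fps_X - fps_const \<theta>) = fps_X + fps_const (\<theta> ^ 2)"
      by (rule fps_ext) (auto simp: tate_tau_def fps_X_def diff_eq_add square_add minus_eq)
    then show ?thesis
      by (simp add: tate_tau_mult[OF char_2])
  qed
  have nth0: "fps_nth ((fps_X + fps_const c) * f) 0 = c * fps_nth f 0"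
    and nthSuc: "fps_nth ((fps_X + fps_const c) * f) (Suc n) = fps_nth f n + c * fps_nth f (Suc n)" for c :: 'a and f n
    by (simp_all add: distrib_right)
  have "pair_tau \<theta> A z = z \<longleftrightarrow> ?X \<and> (\<forall>j. snd z $ j = tate_tau (fst z $ j) + (\<Sum>i\<in>UNIV. tate_tau (snd z $ i) * fps_const (A $ i $ j)))"
    by (simp only: prod_eq_iff pair_tau_def fst_conv snd_conv vec_eq_iff vec_lambda_beta eq_commute)
  also have "\<dots> \<longleftrightarrow> ?X \<and>
      ?y1 = (fps_X + fps_const (\<theta> ^ 2)) * tate_tau (tate_tau ?y1) + (tate_tau ?y1 * fps_const a11 + tate_tau ?y2 * fps_const a21) \<and>
      ?y2 = (fps_X + fps_const (\<theta> ^ 2)) * tate_tau (tate_tau ?y2) + tate_tau ?y1 * fps_const a12"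
  proof (rule conj_cong[OF refl])
    assume X: ?X
    show "(\<forall>j. snd z $ j = tate_tau (fst z $ j) + (\<Sum>i\<in>UNIV. tate_tau (snd z $ i) * fps_const (A $ i $ j))) \<longleftrightarrow>
      ?y1 = (fps_X + fps_const (\<theta> ^ 2)) * tate_tau (tate_tau ?y1) + (tate_tau ?y1 * fps_const a11 + tate_tau ?y2 * fps_const a21) \<and>
      ?y2 = (fps_X + fps_const (\<theta> ^ 2)) * tate_tau (tate_tau ?y2) + tate_tau ?y1 * fps_const a12"
      by (simp add: forall_2 sum_2 A_nth X[rule_format] tt)
  qed
  also have "\<dots> \<longleftrightarrow> ?X \<and> (\<forall>n. fps_nth ?y1 n = fps_nth ((fps_X + fps_const (\<theta> ^ 2)) * tate_tau (tate_tau ?y1)) n + (fps_nth ?y1 n ^ 2 * a11 + fps_nth ?y2 n ^ 2 * a21)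
      \<and> fps_nth ?y2 n = fps_nth ((fps_X + fps_const (\<theta> ^ 2)) * tate_tau (tate_tau ?y2)) n + fps_nth ?y1 n ^ 2 * a12)"
  proof -
    have "fps_nth (tate_tau f * fps_const c) n = fps_nth f n ^ 2 * c" for f :: "'a fps" and c n
      by (simp add: tate_tau_def)
    then show ?thesis
      by (simp only: fps_eq_iff[of ?y1] fps_eq_iff[of ?y2] fps_add_nth all_conj_distrib)
  qed
  also have "\<dots> \<longleftrightarrow> ?X \<and> coeff_pair 0 z = G (coeff_pair 0 z) \<and>
     (\<forall>n. coeff_pair (Suc n) z = frob2 (coeff_pair n z) + G (coeff_pair (Suc n) z))"
  proof -
    have all: "(\<forall>n. Q n) \<longleftrightarrow> Q 0 \<and> (\<forall>n. Q (Suc n))" for Q :: "nat \<Rightarrow> bool"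
      by (metis nat.exhaust)
    have sq: "fps_nth (tate_tau (tate_tau f)) n = fps_nth f n ^ 4" for f :: "'a fps" and n
      by (simp add: tate_tau_def flip: power_mult)
    show ?thesis
      by (subst all, simp only: nth0 nthSuc sq) (simp add: coeff_pair_def G_def frob2_def ac_simps)
  qed
  finally show ?thesis
    unfolding invariant_pairs_def by (simp only: mem_Collect_eq)
qed

lemma coeff_pair_tendsto_0:
  assumes "z \<in> tate_pairs ord"
  shows "(\<lambda>n. N (coeff_pair n z)) \<longlonglongrightarrow> 0"
proof -
  have "(\<lambda>n. max (2 * absval (fps_nth (snd z $ 1) n)) (W * absval (fps_nth (snd z $ 2) n))) \<longlonglongrightarrow> max (2 * 0) (W * 0)"
    using assms by (intro tendsto_max tendsto_mult tendsto_const) (auto simp: tate_pairs_def tate_algebra_iff)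
  then show ?thesis
    by (simp add: N_def coeff_pair_def)
qed

text \<open>Only the coordinates at \<open>\<tau> e\<^sub>1, \<tau> e\<^sub>2\<close> have to be
  constructed; the others are forced and inherit convergence.\<close>

lemma invariant_of_sequence:
  assumes Y0: "Y 0 = G (Y 0)" and YSuc: "\<And>n. Y (Suc n) = frob2 (Y n) + G (Y (Suc n))"
    and lim: "(\<lambda>n. N (Y n)) \<longlonglongrightarrow> 0"
  obtains z where "z \<in> invariant_pairs A" "\<And>n. coeff_pair n z = Y n"
proof -
  define y :: "'a fps ^ 2" where "y = vector [Abs_fps (\<lambda>n. fst (Y n)), Abs_fps (\<lambda>n. snd (Y n))]"
  define z where "z = (\<chi> j. (fps_X - fps_const \<theta>) * tate_tau (y $ j), y)"
  have cz: "coeff_pair n z = Y n" for n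
    by (simp add: z_def coeff_pair_def y_def vector_2)
  have "(\<lambda>n. absval (fst (Y n))) \<longlonglongrightarrow> 0"
    by (rule tendsto_0_le[OF _ lim]) (use absval_nonneg in \<open>auto simp: N_def le_max_iff_disj\<close>)
  moreover have "(\<lambda>n. N (Y n) / W) \<longlonglongrightarrow> 0"
    using tendsto_divide[OF lim tendsto_const[of W]] W(1) by simp
  then have "(\<lambda>n. absval (snd (Y n))) \<longlonglongrightarrow> 0"
    by (rule tendsto_0_le[rotated])
       (use W(1) absval_nonneg in \<open>auto simp: N_def pos_le_divide_eq le_max_iff_disj mult.commute\<close>)
  ultimately have y: "y $ j \<in> tate_algebra ord" for j
    using exhaust_2[of j] by (auto simp: tate_algebra_iff y_def vector_2)
  then have "z \<in> tate_pairs ord"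
    by (auto simp: z_def tate_pairs_def left_diff_distrib
      intro!: tate_algebra_diff tate_algebra_X_mult tate_algebra_const_mult tate_algebra_tau)
  then have "z \<in> invariant_pairs A"
    unfolding invariant_pairs_iff cz using Y0 YSuc by (simp add: z_def)
  with cz show ?thesis by (intro that)
qed

lemma lift_kernel:
  assumes "k \<in> kernel"
  shows "\<exists>z\<in>invariant_pairs A. (\<forall>i\<ge>1. N (coeff_pair i z) < 1) \<and> coeff_pair 0 z = k"
proof -
  define nxt where "nxt x = (SOME y. y = frob2 x + G y \<and> N y \<le> N (frob2 x))" for x
  have nxt: "nxt x = frob2 x + G (nxt x) \<and> N (nxt x) \<le> N (frob2 x)" if "N (frob2 x) < 1" for x
    unfolding nxt_def using solve_small[OF that] by (rule someI_ex)
  define Y where "Y = rec_nat k (\<lambda>_. nxt)"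
  have Y0: "Y 0 = k" and YS: "Y (Suc n) = nxt (Y n)" for n
    by (simp_all add: Y_def)
  define t where "t = N (frob2 k)"
  have t: "0 \<le> t" "t < 1"
    using kernel_frob2[of k] assms N_nonneg by (auto simp: t_def kernel_def)
  \<comment> \<open>Only index \<open>0\<close> relies on \<open>kernel_frob2\<close>. Later terms
    lie in the ball, where fourth powers shrink the norm, so a geometric bound is ample.\<close>
  have Yt: "N (Y (Suc n)) \<le> t ^ Suc n \<and> N (frob2 (Y n)) < 1" for n
  proof (induction n)
    case 0
    then show ?case using nxt[of k] t by (simp add: YS Y0 t_def)
  next
    case (Suc n)
    have le1: "t ^ Suc n \<le> t" using t by (simp add: mult_left_le power_le_one)
    let ?N = "N (Y (Suc n))"
    have N01: "0 \<le> ?N" "?N \<le> t" using Suc le1 N_nonneg by auto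
    have "N (frob2 (Y (Suc n))) \<le> ?N ^ 4"
      by (rule N_frob2)
    also have "\<dots> \<le> ?N ^ 2"
      using N01 t by (intro power_decreasing) auto
    also have "\<dots> \<le> t * t ^ Suc n"
      unfolding power2_eq_square using N01 Suc t by (intro mult_mono) auto
    finally have le: "N (frob2 (Y (Suc n))) \<le> t ^ Suc (Suc n)" by simp
    moreover have "t ^ Suc (Suc n) < 1"
      using t power_le_one[of t "Suc n"] mult_left_le[of "t ^ Suc n" t] by simp
    ultimately have "N (frob2 (Y (Suc n))) < 1" by linarith
    with nxt[of "Y (Suc n)"] le show ?case
      using YS[of "Suc n"] by simp
  qed
  have "(\<lambda>n. N (Y (Suc n))) \<longlonglongrightarrow> 0"
    by (rule tendsto_0_le[where g = "\<lambda>n. t ^ Suc n"])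
       (use Yt N_nonneg LIMSEQ_Suc[OF LIMSEQ_power_zero[of t]] t in auto)
  then have "(\<lambda>n. N (Y n)) \<longlonglongrightarrow> 0"
    by (rule LIMSEQ_imp_Suc)
  moreover have "Y 0 = G (Y 0)"
    using assms by (simp add: Y0 kernel_def)
  moreover have "Y (Suc n) = frob2 (Y n) + G (Y (Suc n))" for n
    using nxt[of "Y n"] Yt[of n] by (simp add: YS)
  ultimately obtain z where z: "z \<in> invariant_pairs A" "\<And>n. coeff_pair n z = Y n"
    using invariant_of_sequence[of Y] by blast
  have "N (coeff_pair i z) < 1" if i: "i \<ge> 1" for i
  proof -
    obtain n where "i = Suc n" using i by (cases i) auto
    moreover have "t ^ Suc n < 1"
      using t power_le_one[of t n] mult_left_le[of "t ^ n" t] by simp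
    ultimately show ?thesis
      using Yt[of n] by (simp add: z(2))
  qed
  then show ?thesis
    using z by (intro bexI[of _ z]) (auto simp: Y0)
qed

lemma pair_scale_X_inj: "pair_scale fps_X z = pair_scale fps_X w \<Longrightarrow> z = w" for z w :: "('a fps ^ 2) \<times> ('a fps ^ 2)"
  by (auto simp: pair_scale_def vec_eq_iff prod_eq_iff)

text \<open>The variable \<open>T\<close> is fixed by \<open>\<tau>\<close> and can be cancelled, so
  the quotient is again invariant.\<close>

lemma invariant_pairs_divide_X:
  assumes z: "z \<in> invariant_pairs A" and 0: "coeff_pair 0 z = 0"
  shows "\<exists>z'\<in>invariant_pairs A. z = pair_scale fps_X z'"
proof -
  have X: "f = fps_X * fps_shift 1 f" if "fps_nth f 0 = 0" for f :: "'a fps"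
    using that by (intro fps_ext) (auto simp: not_less_eq_eq)
  define z' where "z' = (\<chi> j. fps_shift 1 (fst z $ j), \<chi> j. fps_shift 1 (snd z $ j))"
  have snd0: "fps_nth (snd z $ j) 0 = 0" for j
    using 0 exhaust_2[of j] by (auto simp: coeff_pair_def zero_prod_def)
  then have fst0: "fps_nth (fst z $ j) 0 = 0" for j
    unfolding invariant_pairs_fst[OF z] by (simp add: tate_tau_def)
  have zz': "z = pair_scale fps_X z'"
    using X[OF fst0] X[OF snd0] by (auto simp: z'_def pair_scale_def prod_eq_iff vec_eq_iff)
  have "z' \<in> tate_pairs ord"
    using z LIMSEQ_Suc by (auto simp: z'_def invariant_pairs_def tate_pairs_def tate_algebra_iff)
  moreover have "pair_scale fps_X (pair_tau \<theta> A z') = pair_scale fps_X z'"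
    using z pair_tau_scale[OF char_2, of \<theta> A fps_X z'] by (simp add: invariant_pairs_def flip: zz')
  then have "pair_tau \<theta> A z' = z'"
    by (rule pair_scale_X_inj)
  ultimately show ?thesis
    using zz' by (intro bexI[of _ z']) (simp_all add: invariant_pairs_def)
qed

text \<open>Once a coefficient is \<open>0\<close>, the next one solves \<open>y = G y\<close>, and
  \<open>0\<close> is the only solution in the ball.\<close>

lemma invariant_pairs_small_eq_0:
  assumes z: "z \<in> invariant_pairs A" and small: "\<And>i. N (coeff_pair i z) < 1"
  shows "z = 0"
proof -
  note eqs = z[unfolded invariant_pairs_iff]
  have "coeff_pair n z = 0" for n
  proof (induction n)
    case 0
    then show ?case using eqs small fixed_point_small by blast
  next
    case (Suc n)
    have "frob2 0 = 0" by (simp add: frob2_def zero_prod_def)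
    then have "coeff_pair (Suc n) z = G (coeff_pair (Suc n) z)"
      using eqs Suc by (metis add_0)
    then show ?case using small fixed_point_small by blast
  qed
  then have snd: "snd z $ j = 0" for j
    using exhaust_2[of j] by (auto simp: coeff_pair_def fps_eq_iff zero_prod_def)
  then have "fst z $ j = 0" for j
    by (simp add: invariant_pairs_fst[OF z])
  with snd show ?thesis
    by (simp add: prod_eq_iff vec_eq_iff)
qed

sublocale discrete_F2T_module "\<lambda>p. pair_scale (fps_of_poly p)" "invariant_pairs A" "coeff_pair 0" kernel
  "\<lambda>n z. \<forall>i\<ge>n. N (coeff_pair i z) < 1"
proof
  have X: "fps_of_poly [:0, 1:] = (fps_X :: 'a fps)"
    by (simp add: fps_of_poly_pCons)
  have cX: "coeff_pair 0 (pair_scale fps_X z) = 0" "coeff_pair (Suc n) (pair_scale fps_X z) = coeff_pair n z" for n z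
    by (simp_all add: coeff_pair_def pair_scale_def zero_prod_def)
  show "CHAR('a) = 2" by (rule char_2)
  show "pair_scale (fps_of_poly (p + q)) z = pair_scale (fps_of_poly p) z + pair_scale (fps_of_poly q) z"
    for p q :: "'a poly" and z by (simp add: fps_of_poly_add pair_scale_add_left)
  show "pair_scale (fps_of_poly p) (z + w) = pair_scale (fps_of_poly p) z + pair_scale (fps_of_poly p) w"
    for p :: "'a poly" and z w by (rule pair_scale_add_right)
  show "pair_scale (fps_of_poly (p * q)) z = pair_scale (fps_of_poly p) (pair_scale (fps_of_poly q) z)"
    for p q :: "'a poly" and z by (simp add: fps_of_poly_mult pair_scale_pair_scale)
  show "pair_scale (fps_of_poly 1) z = z" for z :: "('a fps ^ 2) \<times> ('a fps ^ 2)" by simp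
  show "z = 0" if "pair_scale (fps_of_poly [:0, 1:]) z = 0" for z :: "('a fps ^ 2) \<times> ('a fps ^ 2)"
    using that pair_scale_X_inj[of z 0] by (simp add: X)
  show "0 \<in> invariant_pairs A"
    by (simp add: invariant_pairs_def tate_pairs_0 pair_tau_0[OF char_2])
  show "z + w \<in> invariant_pairs A" if "z \<in> invariant_pairs A" "w \<in> invariant_pairs A" for z w
    using that by (simp add: invariant_pairs_def tate_pairs_add pair_tau_add[OF char_2])
  show "coeff_pair 0 (z + w) = coeff_pair 0 z + coeff_pair 0 w" for z w
    by (rule coeff_pair_add)
  show "coeff_pair 0 (pair_scale (fps_of_poly [:0, 1:]) z) = 0" for z
    by (simp add: X cX)
  show "k + k = 0" for k :: "'a \<times> 'a"
    by (simp add: prod_eq_iff)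
  show "coeff_pair 0 z \<in> kernel" if "z \<in> invariant_pairs A" for z
    using that by (simp add: invariant_pairs_iff kernel_def)
  show "\<exists>z'\<in>invariant_pairs A. z = pair_scale (fps_of_poly [:0, 1:]) z'"
    if "z \<in> invariant_pairs A" "coeff_pair 0 z = 0" for z
    using invariant_pairs_divide_X[OF that] by (simp add: X)
  show "\<exists>z\<in>invariant_pairs A. (\<forall>i\<ge>1. N (coeff_pair i z) < 1) \<and> coeff_pair 0 z = k" if "k \<in> kernel" for k
    using lift_kernel[OF that] .
  show "\<forall>i\<ge>n. N (coeff_pair i (z + w)) < 1"
    if "\<forall>i\<ge>n. N (coeff_pair i z) < 1" "\<forall>i\<ge>n. N (coeff_pair i w) < 1" for n z w
    using that by (simp add: coeff_pair_add N_add_less)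
  show "\<forall>i\<ge>m. N (coeff_pair i z) < 1" if "\<forall>i\<ge>n. N (coeff_pair i z) < 1" "n \<le> m" for n m z
    using that by auto
  show "\<forall>i\<ge>n. N (coeff_pair i z) < 1"
    if "\<forall>i\<ge>Suc n. N (coeff_pair i (pair_scale (fps_of_poly [:0, 1:]) z)) < 1" for n z
    using that cX(2)[of _ z] by (metis X Suc_le_mono)
  show "\<exists>n. \<forall>i\<ge>n. N (coeff_pair i z) < 1" if "z \<in> invariant_pairs A" for z
  proof -
    have "(\<lambda>n. N (coeff_pair n z)) \<longlonglongrightarrow> 0"
      using that by (intro coeff_pair_tendsto_0) (simp add: invariant_pairs_def)
    then have "eventually (\<lambda>n. N (coeff_pair n z) < 1) sequentially"
      by (rule order_tendstoD) simp
    then show ?thesis by (simp add: eventually_sequentially)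
  qed
  show "z = 0" if "z \<in> invariant_pairs A" "\<forall>i\<ge>0. N (coeff_pair i z) < 1" for z
    using invariant_pairs_small_eq_0 that by simp
  show "\<forall>i\<ge>n. N (coeff_pair i 0) < 1" for n
    by (simp add: coeff_pair_def N_def)
qed

lemma h1_eq_4: "h1 ord \<theta> A = 4"
proof -
  let ?\<nu> = "inv_into (invariant_pairs A) (motive_class A)"
  have basis_iff: "is_H1_basis ord \<theta> A B \<longleftrightarrow>
      finite B \<and> B \<subseteq> motive_class A ` invariant_pairs A \<and> free_family B ?\<nu>" for B
    unfolding is_H1_basis_iff free_family_def ..
  have card4: "card B = 4" if "is_H1_basis ord \<theta> A B" for B
  proof -
    have "card kernel = 2 ^ card B"
      using that unfolding basis_iff by (intro card_free_family[of B ?\<nu>]) (auto intro: inv_into_into)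
    then have "(2::nat) ^ card B = 2 ^ 4"
      by (simp add: card_kernel)
    then show ?thesis by (rule power_inject_exp[THEN iffD1, rotated]) simp
  qed
  have "finite kernel"
    using card_kernel card.infinite by fastforce
  then obtain D where D: "D \<subseteq> kernel" "bij_betw (\<lambda>S. \<Sum>S) (Pow D) kernel"
    using elementary_2_group_basis[of kernel] kernel_add K_char_2 by (auto simp: kernel_def G_0)
  define L where "L k = (SOME z. z \<in> invariant_pairs A \<and> (\<forall>i\<ge>1. N (coeff_pair i z) < 1) \<and> coeff_pair 0 z = k)" for k
  have L: "L k \<in> invariant_pairs A \<and> (\<forall>i\<ge>1. N (coeff_pair i (L k)) < 1) \<and> coeff_pair 0 (L k) = k" if "k \<in> kernel" for k
    unfolding L_def by (rule someI_ex) (use lift_kernel[OF that] in blast)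
  define g where "g = motive_class A \<circ> L"
  have inj: "inj_on (motive_class A) (invariant_pairs A)"
    by (rule inj_on_subset[OF inj_on_motive_class]) (auto simp: invariant_pairs_def)
  \<comment> \<open>A class contains only one invariant pair, so the representative chosen by
    \<open>inv_into\<close> is the small lift itself.\<close>
  have \<nu>g: "?\<nu> (g k) = L k" if "k \<in> D" for k
    using L[of k] that D(1) inv_into_f_f[OF inj, of "L k"] by (auto simp: g_def)
  have cg: "coeff_pair 0 (?\<nu> (g k)) = k" if "k \<in> D" for k
    using \<nu>g[OF that] L[of k] D(1) that by auto
  have inj_g: "inj_on g D"
    by (rule inj_on_inverseI) (rule cg)
  have fD: "finite D"
    using D(1) \<open>finite kernel\<close> finite_subset by blast
  have bij: "bij_betw (\<lambda>S. \<Sum>b\<in>S. coeff_pair 0 (?\<nu> b)) (Pow (g ` D)) kernel"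
  proof -
    have "(\<Sum>b\<in>g ` S. coeff_pair 0 (?\<nu> b)) = \<Sum>S" if "S \<subseteq> D" for S
    proof -
      have "(\<Sum>b\<in>g ` S. coeff_pair 0 (?\<nu> b)) = (\<Sum>k\<in>S. coeff_pair 0 (?\<nu> (g k)))"
        by (simp add: sum.reindex[OF inj_on_subset[OF inj_g that]])
      also have "\<dots> = \<Sum>S"
        by (rule sum.cong[OF refl], rule cg) (use that in blast)
      finally show ?thesis .
    qed
    moreover have "bij_betw (\<lambda>S. g ` S) (Pow D) (Pow (g ` D))"
      using inj_g by (intro bij_betw_Pow) (simp add: bij_betw_def)
    ultimately show ?thesis
      using D(2) bij_betw_comp_iff[of "(`) g" "Pow D" "Pow (g ` D)" "\<lambda>S. \<Sum>b\<in>S. coeff_pair 0 (?\<nu> b)" kernel]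
        bij_betw_cong[of "Pow D" "(\<lambda>S. \<Sum>b\<in>S. coeff_pair 0 (?\<nu> b)) \<circ> (`) g" "\<lambda>S. \<Sum>S" kernel]
      by simp
  qed
  have "is_H1_basis ord \<theta> A (g ` D)"
    unfolding basis_iff
  proof (intro conjI)
    show "g ` D \<subseteq> motive_class A ` invariant_pairs A"
      using L D(1) by (auto simp: g_def)
    show "free_family (g ` D) ?\<nu>"
      by (rule free_family_of_small_lifts[OF _ _ _ bij]) (use fD L \<nu>g D(1) in auto)
  qed (use fD in simp)
  then show ?thesis
    unfolding h1_def using card4 by (intro the_equality) auto
qed

end

theorem proposition7p3:
  fixes ord :: "'a::field \<Rightarrow> ereal" and \<theta> a11 a12 a21 :: 'a
    and A :: "'a^2^2" and u v :: ereal
  assumes "C_infinity ord \<theta>"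
    and "A = vector [vector [a11, a12], vector [a21, 0]]"
    and "ord a11 = -1"
    and "a12 \<noteq> 0"
    and "a21 \<noteq> 0"
    and "u = ord a12"
    and "v = ord a21"
    and "(u, v) \<in> D12 ord \<theta>"
    and "v \<ge> ereal (- 4 / 3)"
  shows "h1 ord \<theta> A = 4"
proof -
  interpret C_infinity ord \<theta>
    by (rule assms(1))
  \<comment> \<open>Membership in \<open>D12\<close> only provides some entries with valuations
    \<open>u\<close> and \<open>v\<close>; the inequalities carry over because they depend on
    absolute values alone.\<close>
  obtain b12 b21 where b: "u = ord b12" "v = ord b21" "b12 \<noteq> 0" "b21 \<noteq> 0"
    "ord (\<theta> ^ 2 / b21) < ord (\<theta> ^ (2 ^ 2) / b21 ^ (2 ^ 2))" "ord (\<theta> ^ 2 / b21) < ord (b12 ^ 2)"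
    using assms(8) unfolding D12_def by blast
  have less: "absval x < absval y \<longleftrightarrow> ord y < ord x" for x y
    using absval_le_iff[of y x] by (simp add: not_le flip: not_le)
  have eq: "absval b12 = absval a12" "absval b21 = absval a21"
    using assms b by (simp_all add: absval_def)
  have theta: "absval \<theta> = 2" and "absval a11 = 2"
    using absval_eq_powr[of _ "-1"] assms(3) by (simp_all add: ord_theta one_ereal_def)
  moreover have "absval a21 ^ 3 \<le> 16"
  proof -
    have "absval a21 \<le> 2 powr (4 / 3)"
      using assms absval_le_powr_iff[of a21 "- 4 / 3"] by simp
    then have "absval a21 ^ 3 \<le> (2 powr (4 / 3)) ^ 3"
      by (intro power_mono absval_nonneg)
    also have "\<dots> = 2 powr 4"
      by (simp add: powr_power)
    finally show ?thesis by simp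
  qed
  moreover have pos: "0 < absval a21"
    using assms(5) by simp
  have "4 < absval a21 ^ 3"
  proof -
    have "16 / absval a21 ^ 4 < 4 / absval a21"
      using b(5) by (simp add: absval_divide absval_power theta eq flip: less)
    then have "16 < 4 / absval a21 * absval a21 ^ 4"
      using pos by (simp only: pos_divide_less_eq zero_less_power)
    also have "\<dots> = 4 * absval a21 ^ 3"
      using pos by (simp add: eval_nat_numeral)
    finally show ?thesis by simp
  qed
  moreover have "absval a12 ^ 2 * absval a21 < 4"
  proof -
    have "absval a12 ^ 2 < 4 / absval a21"
      using b(6) by (simp add: absval_divide absval_power theta eq flip: less)
    then show ?thesis
      using pos by (simp add: pos_less_divide_eq)
  qed
  ultimately interpret D12_setting ord \<theta> a11 a12 a21
    by unfold_locales
  show ?thesis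
    unfolding assms(2) by (rule h1_eq_4)
qed

end
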